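(* Let $G$ be a Lie group and let $A$ be a smooth $G$-module. Let $\mathcal{S}(G,A)$ denote the set of equivalence classes of Lie group extensions of $G$ by $A$ that admit a symmetric smooth section and correspond to the given action of $G$ on $A$. Let $HS_s^2(G,A)$ denote the second symmetric smooth cohomology group of $G$ with coefficients in $A$. Then there is a bijection $\Psi:\mathcal{S}(G,A)\to HS_s^2(G,A)$.
   Context: Lie groups are finite-dimensional, real and second countable. A smooth $G$-module is an abelian Lie group $A$ (written additively) with a smooth action $G\times A\to A$ by group automorphisms. Symmetric smooth cohomology. For $n\ge 0$ let $C_s^n(G,A)$ be the abelian group of all smooth maps $G^n\to A$, with coboundary $$\partial^n(\sigma)(g_1,\dots,g_{n+1})=g_1\sigma(g_2,\dots,g_{n+1})+\sum_{i=1}^n(-1)^i\sigma(g_1,\dots,g_ig_{i+1},\dots,g_{n+1})+(-1)^{n+1}\sigma(g_1,\dots,g_n).$$ The symmetric group $\Sigma_{n+1}$ acts on $C_s^n(G,A)$; the action is determined by the adjacent transpositions $\tau_i=(i,i+1)$, $1\le i\le n$. For $n=1$: $(\tau_1\sigma)(g)=-g\,\sigma(g^{-1})$. For $n\ge 2$: $$(\tau_1\sigma)(g_1,\dots,g_n)=-g_1\sigma(g_1^{-1},g_1g_2,g_3,\dots,g_n),$$ $$(\tau_i\sigma)(g_1,\dots,g_n)=-\sigma(g_1,\dots,g_{i-2},g_{i-1}g_i,g_i^{-1},g_ig_{i+1},g_{i+2},\dots,g_n)\quad(1<i<n),$$ $$(\tau_n\sigma)(g_1,\dots,g_n)=-\sigma(g_1,\dots,g_{n-2},g_{n-1}g_n,g_n^{-1}).$$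 This action is compatible with the coboundaries, so the invariants $CS_s^n(G,A)=C_s^n(G,A)^{\Sigma_{n+1}}$ form a subcomplex; $HS_s^n(G,A)$ is the $n$-th cohomology group of this subcomplex. Extensions. An extension of Lie groups $0\to A\xrightarrow{i}E\xrightarrow{\pi}G\to1$ is an algebraically exact sequence of Lie groups in which $i$ and $\pi$ are smooth homomorphisms and $\pi$ admits a smooth local section $U\to E$ on some open neighbourhood $U\subset G$ of the identity. A section is a map $s:G\to E$ with $\pi(s(g))=g$ for all $g\in G$; it is symmetric if $s(g^{-1})=s(g)^{-1}$ for all $g\in G$. The extension corresponds to the given action of $G$ on $A$ if $ga=i^{-1}\big(s(g)i(a)s(g)^{-1}\big)$ for all $a\in A$, $g\in G$, where $s$ is any section (the right-hand side does not depend on $s$). Two extensions $0\to A\xrightarrow{i}E\xrightarrow{\pi}G\to1$ and $0\to A\xrightarrow{i'}E'\xrightarrow{\pi'}G\to1$ are equivalent if there is a group isomorphism $\phi:E\to E'$, smooth with smooth inverse, such that $\phi i=i'$ and $\pi'\phi=\pi$. *)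

theory Defs
  imports "HOL-Analysis.Analysis" "HOL-Algebra.Bij" "HOL-Algebra.Coset" "HOL-Algebra.FiniteProduct"
begin

section \<open>Smooth manifolds\<close>

text \<open>
  \<^emph>\<open>R^n\<close> is the topological space \<^const>\<open>Euclidean_space\<close> \<open>n\<close>, i.e. the sequences \<open>x :: nat \<Rightarrow> real\<close>
  with \<open>x i = 0\<close> for \<open>i \<ge> n\<close>, coordinates being indexed from \<open>0\<close>. In this way the dimension is an
  ordinary natural number, and dimension \<open>0\<close> (discrete groups) is included.

  \<open>Ck_on k n U f\<close>: the real function \<open>f\<close> is \<open>k\<close> times continuously differentiable on \<open>U\<close>, an open
  subset of \<open>Euclidean_space n\<close>; \<open>f'\<close> is the \<open>i\<close>-th partial derivative.
\<close>

primrec Ck_on :: "nat \<Rightarrow> nat \<Rightarrow> (nat \<Rightarrow> real) set \<Rightarrow> ((nat \<Rightarrow> real) \<Rightarrow> real) \<Rightarrow> bool" where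
  "Ck_on 0 n U f \<longleftrightarrow> continuous_map (subtopology (Euclidean_space n) U) euclideanreal f"
| "Ck_on (Suc k) n U f \<longleftrightarrow>
     continuous_map (subtopology (Euclidean_space n) U) euclideanreal f \<and>
     (\<forall>i<n. \<exists>f'. (\<forall>x\<in>U. ((\<lambda>t. f (x(i := t))) has_real_derivative f' x) (at (x i))) \<and>
                 Ck_on k n U f')"

definition smooth_on :: "nat \<Rightarrow> (nat \<Rightarrow> real) set \<Rightarrow> ((nat \<Rightarrow> real) \<Rightarrow> real) \<Rightarrow> bool" where
  "smooth_on n U f \<longleftrightarrow> (\<forall>k. Ck_on k n U f)"

text \<open>
  A chart is a pair \<open>(U, \<phi>)\<close>; only the values of \<open>\<phi>\<close> on \<open>U\<close> matter. The atlas is not required to be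
  maximal: smoothness of maps depends only on the smooth structure generated by it.
\<close>

type_synonym 'x chart = "'x set \<times> ('x \<Rightarrow> nat \<Rightarrow> real)"

record 'x manifold =
  mtop :: "'x topology"
  mdim :: nat
  atlas :: "'x chart set"

definition is_chart :: "'x topology \<Rightarrow> nat \<Rightarrow> 'x chart \<Rightarrow> bool" where
  "is_chart X n = (\<lambda>(U, \<phi>).
     openin X U \<and> openin (Euclidean_space n) (\<phi> ` U) \<and>
     homeomorphic_map (subtopology X U) (subtopology (Euclidean_space n) (\<phi> ` U)) \<phi>)"

definition smooth_manifold :: "'x manifold \<Rightarrow> bool" where
  "smooth_manifold M \<longleftrightarrow>
     Hausdorff_space (mtop M) \<and> second_countable (mtop M) \<and>
     (\<forall>c\<in>atlas M. is_chart (mtop M) (mdim M) c) \<and>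
     (\<Union>(U, \<phi>)\<in>atlas M. U) = topspace (mtop M) \<and>
     (\<forall>(U, \<phi>)\<in>atlas M. \<forall>(V, \<psi>)\<in>atlas M. \<forall>j<mdim M.
        smooth_on (mdim M) (\<phi> ` (U \<inter> V)) (\<lambda>p. \<psi> (inv_into U \<phi> p) j))"

definition smooth_map :: "'x manifold \<Rightarrow> 'y manifold \<Rightarrow> ('x \<Rightarrow> 'y) \<Rightarrow> bool" where
  "smooth_map M N f \<longleftrightarrow>
     continuous_map (mtop M) (mtop N) f \<and>
     (\<forall>(U, \<phi>)\<in>atlas M. \<forall>(V, \<psi>)\<in>atlas N. \<forall>j<mdim N.
        smooth_on (mdim M) (\<phi> ` (U \<inter> f -` V)) (\<lambda>p. \<psi> (f (inv_into U \<phi> p)) j))"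

definition open_submanifold :: "'x manifold \<Rightarrow> 'x set \<Rightarrow> 'x manifold" where
  "open_submanifold M W =
     \<lparr>mtop = subtopology (mtop M) W, mdim = mdim M,
      atlas = (\<lambda>(U, \<phi>). (U \<inter> W, \<phi>)) ` atlas M\<rparr>"

definition prod_manifold :: "'x manifold \<Rightarrow> 'y manifold \<Rightarrow> ('x \<times> 'y) manifold" where
  "prod_manifold M N =
     \<lparr>mtop = prod_topology (mtop M) (mtop N), mdim = mdim M + mdim N,
      atlas = {(U \<times> V, \<lambda>(x, y) k. if k < mdim M then \<phi> x k else \<psi> y (k - mdim M)) |U \<phi> V \<psi>.
               (U, \<phi>) \<in> atlas M \<and> (V, \<psi>) \<in> atlas N}\<rparr>"

text \<open>
  The \<open>n\<close>-fold power. Its points are the extensional functions on \<open>{1..n}\<close>; the \<open>d\<close> coordinates of the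
  \<open>i\<close>-th component (\<open>d\<close> being the dimension of \<open>M\<close>) are placed at the indices \<open>(i-1)d, \<dots>, id-1\<close>.
\<close>

definition power_manifold :: "nat \<Rightarrow> 'x manifold \<Rightarrow> (nat \<Rightarrow> 'x) manifold" where
  "power_manifold n M =
     \<lparr>mtop = product_topology (\<lambda>_. mtop M) {1..n}, mdim = n * mdim M,
      atlas = {(\<Pi>\<^sub>E i\<in>{1..n}. fst (c i),
                \<lambda>x k. if k < n * mdim M
                      then snd (c (k div mdim M + 1)) (x (k div mdim M + 1)) (k mod mdim M)
                      else 0) |c.
               c \<in> {1..n} \<rightarrow> atlas M}\<rparr>"


section \<open>Lie groups and smooth modules\<close>

record 'x lie_group = "'x monoid" +
  mfd :: "'x manifold"

definition is_lie_group :: "'x lie_group \<Rightarrow> bool" where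
  "is_lie_group G \<longleftrightarrow>
     group G \<and> smooth_manifold (mfd G) \<and> topspace (mtop (mfd G)) = carrier G \<and>
     smooth_map (prod_manifold (mfd G) (mfd G)) (mfd G) (\<lambda>(x, y). x \<otimes>\<^bsub>G\<^esub> y) \<and>
     smooth_map (mfd G) (mfd G) (\<lambda>x. inv\<^bsub>G\<^esub> x)"

text \<open>The module \<open>A\<close> is written multiplicatively throughout.\<close>

definition smooth_module :: "'g lie_group \<Rightarrow> 'a lie_group \<Rightarrow> ('g \<Rightarrow> 'a \<Rightarrow> 'a) \<Rightarrow> bool" where
  "smooth_module G A act \<longleftrightarrow>
     is_lie_group A \<and> comm_group A \<and> act \<in> hom G (AutoGroup A) \<and>
     smooth_map (prod_manifold (mfd G) (mfd A)) (mfd A) (\<lambda>(g, a). act g a)"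


section \<open>Symmetric smooth cohomology\<close>

abbreviation tuples :: "'g lie_group \<Rightarrow> nat \<Rightarrow> (nat \<Rightarrow> 'g) set" where
  "tuples G n \<equiv> {1..n} \<rightarrow>\<^sub>E carrier G"

definition cochains :: "'g lie_group \<Rightarrow> 'a lie_group \<Rightarrow> nat \<Rightarrow> ((nat \<Rightarrow> 'g) \<Rightarrow> 'a) set" where
  "cochains G A n =
     {\<sigma> \<in> extensional (tuples G n). smooth_map (power_manifold n (mfd G)) (mfd A) \<sigma>}"

definition cochain_group :: "'g lie_group \<Rightarrow> 'a lie_group \<Rightarrow> nat \<Rightarrow> ((nat \<Rightarrow> 'g) \<Rightarrow> 'a) monoid" where
  "cochain_group G A n =
     \<lparr>carrier = cochains G A n,
      mult = (\<lambda>\<sigma> \<tau>. \<lambda>g\<in>tuples G n. \<sigma> g \<otimes>\<^bsub>A\<^esub> \<tau> g),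
      one = (\<lambda>g\<in>tuples G n. \<one>\<^bsub>A\<^esub>)\<rparr>"

text \<open>Multiplicatively, the sign \<open>(-1)^i\<close> becomes the integer exponent \<open>(-1)^i\<close>.\<close>

definition coboundary ::
  "'g lie_group \<Rightarrow> 'a lie_group \<Rightarrow> ('g \<Rightarrow> 'a \<Rightarrow> 'a) \<Rightarrow> nat \<Rightarrow>
   ((nat \<Rightarrow> 'g) \<Rightarrow> 'a) \<Rightarrow> (nat \<Rightarrow> 'g) \<Rightarrow> 'a" where
  "coboundary G A act n \<sigma> = (\<lambda>g\<in>tuples G (n + 1).
     act (g 1) (\<sigma> (\<lambda>j\<in>{1..n}. g (j + 1)))
     \<otimes>\<^bsub>A\<^esub> (\<Otimes>\<^bsub>A\<^esub>i\<in>{1..n}.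
            \<sigma> (\<lambda>j\<in>{1..n}. if j < i then g j
                          else if j = i then g i \<otimes>\<^bsub>G\<^esub> g (i + 1)
                          else g (j + 1)) [^]\<^bsub>A\<^esub> ((-1) ^ i :: int))
     \<otimes>\<^bsub>A\<^esub> \<sigma> (\<lambda>j\<in>{1..n}. g j) [^]\<^bsub>A\<^esub> ((-1) ^ (n + 1) :: int))"

text \<open>
  The action of the adjacent transposition \<open>\<tau>\<^sub>i = (i, i+1)\<close>, for \<open>1 \<le> i \<le> n\<close>. The single formula covers
  all the cases of the usual definition: for \<open>i = 1\<close> there is no position \<open>i - 1\<close>, and \<open>g\<^sub>1\<close> acts on the
  value instead; for \<open>i = n\<close> there is no position \<open>i + 1\<close>.
\<close>

definition transp_act ::
  "'g lie_group \<Rightarrow> 'a lie_group \<Rightarrow> ('g \<Rightarrow> 'a \<Rightarrow> 'a) \<Rightarrow> nat \<Rightarrow> nat \<Rightarrow>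
   ((nat \<Rightarrow> 'g) \<Rightarrow> 'a) \<Rightarrow> (nat \<Rightarrow> 'g) \<Rightarrow> 'a" where
  "transp_act G A act n i \<sigma> = (\<lambda>g\<in>tuples G n.
     let v = \<sigma> (\<lambda>j\<in>{1..n}. if j + 1 = i then g j \<otimes>\<^bsub>G\<^esub> g i
                           else if j = i then inv\<^bsub>G\<^esub> (g i)
                           else if j = i + 1 then g i \<otimes>\<^bsub>G\<^esub> g j
                           else g j)
     in inv\<^bsub>A\<^esub> (if i = 1 then act (g 1) v else v))"

text \<open>
  \<open>sym_acts G A act n p F\<close>: the permutation \<open>p\<close> of \<open>{1..n+1}\<close> acts on \<open>n\<close>-cochains by the operator \<open>F\<close>.
  The adjacent transpositions are involutions generating the symmetric group, so every \<open>p\<close> is a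
  product of them.
\<close>

inductive sym_acts ::
  "'g lie_group \<Rightarrow> 'a lie_group \<Rightarrow> ('g \<Rightarrow> 'a \<Rightarrow> 'a) \<Rightarrow> nat \<Rightarrow>
   (nat \<Rightarrow> nat) \<Rightarrow> (((nat \<Rightarrow> 'g) \<Rightarrow> 'a) \<Rightarrow> (nat \<Rightarrow> 'g) \<Rightarrow> 'a) \<Rightarrow> bool"
  for G A act n where
  "sym_acts G A act n id id"
| "\<lbrakk>sym_acts G A act n p F; 1 \<le> i; i \<le> n\<rbrakk> \<Longrightarrow>
     sym_acts G A act n (Transposition.transpose i (i + 1) \<circ> p) (transp_act G A act n i \<circ> F)"

definition sym_cochains ::
  "'g lie_group \<Rightarrow> 'a lie_group \<Rightarrow> ('g \<Rightarrow> 'a \<Rightarrow> 'a) \<Rightarrow> nat \<Rightarrow> ((nat \<Rightarrow> 'g) \<Rightarrow> 'a) set" where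
  "sym_cochains G A act n =
     {\<sigma> \<in> cochains G A n. \<forall>p F. sym_acts G A act n p F \<longrightarrow> F \<sigma> = \<sigma>}"

definition sym_cocycles ::
  "'g lie_group \<Rightarrow> 'a lie_group \<Rightarrow> ('g \<Rightarrow> 'a \<Rightarrow> 'a) \<Rightarrow> nat \<Rightarrow> ((nat \<Rightarrow> 'g) \<Rightarrow> 'a) set" where
  "sym_cocycles G A act n =
     {\<sigma> \<in> sym_cochains G A act n. coboundary G A act n \<sigma> = \<one>\<^bsub>cochain_group G A (n + 1)\<^esub>}"

definition sym_coboundaries ::
  "'g lie_group \<Rightarrow> 'a lie_group \<Rightarrow> ('g \<Rightarrow> 'a \<Rightarrow> 'a) \<Rightarrow> nat \<Rightarrow> ((nat \<Rightarrow> 'g) \<Rightarrow> 'a) set" where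
  "sym_coboundaries G A act n =
     (case n of 0 \<Rightarrow> {\<one>\<^bsub>cochain_group G A 0\<^esub>}
      | Suc m \<Rightarrow> coboundary G A act m ` sym_cochains G A act m)"

definition sym_smooth_cohomology ::
  "'g lie_group \<Rightarrow> 'a lie_group \<Rightarrow> ('g \<Rightarrow> 'a \<Rightarrow> 'a) \<Rightarrow> nat \<Rightarrow> ((nat \<Rightarrow> 'g) \<Rightarrow> 'a) set monoid" where
  "sym_smooth_cohomology G A act n =
     (cochain_group G A n)\<lparr>carrier := sym_cocycles G A act n\<rparr> Mod sym_coboundaries G A act n"


section \<open>Extensions of Lie groups\<close>

text \<open>An extension is a triple \<open>(E, i, \<pi>)\<close>.\<close>

type_synonym ('a, 'e, 'g) extension = "'e lie_group \<times> ('a \<Rightarrow> 'e) \<times> ('e \<Rightarrow> 'g)"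

definition lie_extension :: "'g lie_group \<Rightarrow> 'a lie_group \<Rightarrow> ('a, 'e, 'g) extension \<Rightarrow> bool" where
  "lie_extension G A = (\<lambda>(E, i, \<pi>).
     is_lie_group E \<and>
     i \<in> hom A E \<and> smooth_map (mfd A) (mfd E) i \<and>
     \<pi> \<in> hom E G \<and> smooth_map (mfd E) (mfd G) \<pi> \<and>
     inj_on i (carrier A) \<and> i ` carrier A = kernel E G \<pi> \<and> \<pi> ` carrier E = carrier G \<and>
     (\<exists>U s. openin (mtop (mfd G)) U \<and> \<one>\<^bsub>G\<^esub> \<in> U \<and>
        smooth_map (open_submanifold (mfd G) U) (mfd E) s \<and> (\<forall>g\<in>U. \<pi> (s g) = g)))"

definition is_section ::
  "'g lie_group \<Rightarrow> ('a, 'e, 'g) extension \<Rightarrow> ('g \<Rightarrow> 'e) \<Rightarrow> bool" where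
  "is_section G = (\<lambda>(E, i, \<pi>) s. s \<in> carrier G \<rightarrow> carrier E \<and> (\<forall>g\<in>carrier G. \<pi> (s g) = g))"

definition has_symmetric_smooth_section ::
  "'g lie_group \<Rightarrow> ('a, 'e, 'g) extension \<Rightarrow> bool" where
  "has_symmetric_smooth_section G = (\<lambda>(E, i, \<pi>).
     \<exists>s. is_section G (E, i, \<pi>) s \<and> smooth_map (mfd G) (mfd E) s \<and>
         (\<forall>g\<in>carrier G. s (inv\<^bsub>G\<^esub> g) = inv\<^bsub>E\<^esub> (s g)))"

definition corresponds_to_action ::
  "'g lie_group \<Rightarrow> 'a lie_group \<Rightarrow> ('g \<Rightarrow> 'a \<Rightarrow> 'a) \<Rightarrow> ('a, 'e, 'g) extension \<Rightarrow> bool" where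
  "corresponds_to_action G A act = (\<lambda>(E, i, \<pi>).
     \<forall>s. is_section G (E, i, \<pi>) s \<longrightarrow>
       (\<forall>g\<in>carrier G. \<forall>a\<in>carrier A.
          act g a = inv_into (carrier A) i (s g \<otimes>\<^bsub>E\<^esub> i a \<otimes>\<^bsub>E\<^esub> inv\<^bsub>E\<^esub> (s g))))"

definition equivalent_extensions ::
  "'a lie_group \<Rightarrow> ('a, 'e, 'g) extension \<Rightarrow> ('a, 'f, 'g) extension \<Rightarrow> bool" where
  "equivalent_extensions A = (\<lambda>(E, i, \<pi>) (E', i', \<pi>').
     \<exists>\<phi>. \<phi> \<in> iso E E' \<and>
         smooth_map (mfd E) (mfd E') \<phi> \<and>
         smooth_map (mfd E') (mfd E) (inv_into (carrier E) \<phi>) \<and>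
         (\<forall>a\<in>carrier A. \<phi> (i a) = i' a) \<and> (\<forall>e\<in>carrier E. \<pi>' (\<phi> e) = \<pi> e))"

definition sym_extensions ::
  "'g lie_group \<Rightarrow> 'a lie_group \<Rightarrow> ('g \<Rightarrow> 'a \<Rightarrow> 'a) \<Rightarrow> ('a, 'e, 'g) extension set" where
  "sym_extensions G A act =
     {X. lie_extension G A X \<and> has_symmetric_smooth_section G X \<and> corresponds_to_action G A act X}"

text \<open>
  The equivalence classes of those extensions whose underlying set is a subset of the type \<open>'e\<close>.
  The underlying set of any extension is in bijection with the product of those of \<open>G\<close> and \<open>A\<close>, so as
  soon as this product embeds into \<open>'e\<close> (e.g. for \<open>'e = 'g \<times> 'a\<close>) every extension is equivalent to
  one of these.
\<close>

definition sym_extension_classes ::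
  "'g lie_group \<Rightarrow> 'a lie_group \<Rightarrow> ('g \<Rightarrow> 'a \<Rightarrow> 'a) \<Rightarrow> ('a, 'e, 'g) extension set set" where
  "sym_extension_classes G A act =
     sym_extensions G A act //
       {(X, Y). X \<in> sym_extensions G A act \<and> Y \<in> sym_extensions G A act \<and>
                equivalent_extensions A X Y}"

end

theory Submission
  imports Defs
begin

text \<open>
  A symmetric smooth section \<open>s\<close> of an extension \<open>A \<rightarrow> E \<rightarrow> G\<close> yields the factor set
  \<open>(g, h) \<mapsto> i\<^sup>-\<^sup>1 (s g s h (s (gh))\<^sup>-\<^sup>1)\<close>. It is a cocycle, it is invariant under the symmetric group exactly
  because \<open>s\<close> is symmetric, and replacing \<open>s\<close> changes it by the coboundary of a symmetric 1-cochain.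
  Conversely a symmetric cocycle \<open>\<sigma>\<close> defines a group structure on the manifold \<open>G \<times> A\<close>; neither \<open>s\<close> nor
  \<open>\<sigma>\<close> is normalised, so the identity element is \<open>(1, \<sigma>(1, 1)\<^sup>-\<^sup>1)\<close>.

  The analytic difficulty is the smoothness of \<open>i\<^sup>-\<^sup>1\<close> on the kernel, since \<open>i\<close> is only assumed to be a
  smooth injective homomorphism. An injective smooth map has a smooth local left inverse somewhere
  in its domain (straighten one coordinate after the other); by the Baire category theorem \<open>i\<close> is a
  homeomorphism onto the closed subgroup \<open>ker \<pi>\<close>; translations then spread the local left inverse over
  the whole kernel.
\<close>

section \<open>Differentiable functions on Euclidean space\<close>

text \<open>Smoothness of \<open>i^-1\<close> is needed because factor sets, the
  \<open>A\<close>-component of an element of \<open>E\<close> and the difference of two sections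
  are all defined as values of \<open>i^-1\<close> and must be smooth as maps into \<open>A\<close>.
  Injectivity alone allows the derivative of a smooth map to degenerate at a given point, so a left
  inverse is first found at some uncontrolled spot, and homogeneity does the rest. All calculus runs
  along coordinate lines: points are real sequences, derivatives are partial derivatives, and the
  mean value theorem in one variable carries both the chain rule and implicit functions. Injectivity
  of the classification rests on the fact that multiplying a factor set by a symmetric coboundary
  amounts to choosing another section in the same extension, so cohomologous factor sets may be
  assumed equal. For surjectivity the group on pairs \<open>(g, a)\<close> is transported along an
  injection into \<open>'e\<close>, the type from which extensions are drawn.\<close>

abbreviation euc :: "nat \<Rightarrow> (nat \<Rightarrow> real) set" where
  "euc n \<equiv> topspace (Euclidean_space n)"

section \<open>Open boxes and coordinatewise convergence\<close>

lemma mem_euc: "x \<in> euc n \<longleftrightarrow> (\<forall>i\<ge>n. x i = 0)"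
  by (simp add: topspace_Euclidean_space)

lemma continuous_map_coordinate: "continuous_map (Euclidean_space n) euclideanreal (\<lambda>x. x i)"
  unfolding Euclidean_space_def
  by (intro continuous_map_from_subtopology continuous_map_product_projection) auto

lemma openin_Euclidean_iff:
  "openin (Euclidean_space n) U \<longleftrightarrow>
     U \<subseteq> euc n \<and> (\<forall>p\<in>U. \<exists>e>0. \<forall>y\<in>euc n. (\<forall>i<n. \<bar>y i - p i\<bar> < e) \<longrightarrow> y \<in> U)"
  (is "?L \<longleftrightarrow> ?R")
proof
  assume L: ?L
  show ?R
  proof (intro conjI ballI)
    show "U \<subseteq> euc n" using L openin_subset by blast
    fix p assume p: "p \<in> U"
    from L obtain T where T: "openin (powertop_real UNIV) T" "U = T \<inter> {x. \<forall>i\<ge>n. x i = 0}"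
      unfolding Euclidean_space_def openin_subtopology by blast
    with p have "p \<in> T" by blast
    from product_topology_open_contains_basis[OF T(1) this]
    obtain X where X: "p \<in> (\<Pi>\<^sub>E i\<in>UNIV. X i)" "\<And>i. open (X i)" "(\<Pi>\<^sub>E i\<in>UNIV. X i) \<subseteq> T"
      by auto
    have "\<exists>e>0. \<forall>y. \<bar>y - p i\<bar> < e \<longrightarrow> y \<in> X i" for i
      using X(2)[of i] X(1) unfolding open_dist by (auto simp: dist_real_def PiE_UNIV_domain)
    then obtain e where e: "\<And>i. e i > (0::real)" "\<And>i y. \<bar>y - p i\<bar> < e i \<Longrightarrow> y \<in> X i"
      by metis
    \<comment> \<open>Coordinates from \<open>n\<close> on vanish for both points, so only the first
      \<open>n\<close> bounds matter; the extra \<open>1\<close> keeps the set nonempty when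
      \<open>n = 0\<close>.\<close>
    define d where "d = Min (insert 1 (e ` {..<n}))"
    have d: "d > 0" "\<And>i. i < n \<Longrightarrow> d \<le> e i"
      by (auto simp: d_def e(1))
    show "\<exists>e>0. \<forall>y\<in>euc n. (\<forall>i<n. \<bar>y i - p i\<bar> < e) \<longrightarrow> y \<in> U"
    proof (intro exI conjI ballI impI)
      fix y assume y: "y \<in> euc n" "\<forall>i<n. \<bar>y i - p i\<bar> < d"
      have "y i \<in> X i" for i
      proof (cases "i < n")
        case True then show ?thesis using y d(2)[of i] by (intro e(2)) auto
      next
        case False
        then have "y i = 0" "p i = 0" using y p T(2) by (auto simp: topspace_Euclidean_space)
        then show ?thesis using e(1)[of i] by (intro e(2)) auto
      qed
      then have "y \<in> T" using X(3) by (auto simp: PiE_UNIV_domain)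
      then show "y \<in> U" using T(2) y(1) by (auto simp: topspace_Euclidean_space)
    qed (fact d)
  qed
next
  assume R: ?R
  show ?L
  proof (subst openin_subopen, intro ballI)
    fix p assume p: "p \<in> U"
    with R obtain e where e: "e > 0" "\<And>y. y \<in> euc n \<Longrightarrow> (\<And>i. i < n \<Longrightarrow> \<bar>y i - p i\<bar> < e) \<Longrightarrow> y \<in> U"
      by blast
    define B where "B = euc n \<inter> (\<Inter>i\<in>{..<n}. {x \<in> euc n. x i \<in> {p i - e<..<p i + e}})"
    have "openin (Euclidean_space n) B"
    \<comment> \<open>An intersection over an empty index set is everything, while
      \<open>openin_INT2\<close> wants a nonempty one.\<close>
    proof (cases "n = 0")
      case True then show ?thesis by (simp add: B_def)
    next
      case False
      then show ?thesis unfolding B_def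
        by (intro openin_Int openin_topspace openin_INT2 openin_continuous_map_preimage[OF continuous_map_coordinate]) auto
    qed
    moreover have "p \<in> B" using p R e by (auto simp: B_def)
    moreover have "B \<subseteq> U" using e(2) by (fastforce simp: B_def abs_diff_less_iff)
    ultimately show "\<exists>T. openin (Euclidean_space n) T \<and> p \<in> T \<and> T \<subseteq> U" by blast
  qed
qed

lemma open_box:
  assumes "openin (Euclidean_space n) U" "p \<in> U"
  obtains e where "e > 0" "\<And>y. y \<in> euc n \<Longrightarrow> (\<And>i. i < n \<Longrightarrow> \<bar>y i - p i\<bar> < e) \<Longrightarrow> y \<in> U"
  using assms(1)[unfolded openin_Euclidean_iff] assms(2) by (meson subsetD)

lemma openin_Euclidean_subset: "openin (Euclidean_space n) U \<Longrightarrow> x \<in> U \<Longrightarrow> x \<in> euc n"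
  using openin_subset by blast

lemma upd_euc: "x \<in> euc n \<Longrightarrow> i < n \<Longrightarrow> x(i := t) \<in> euc n"
  by (auto simp: mem_euc)

lemma eventually_in_open:
  assumes U: "openin (Euclidean_space n) U" "p \<in> U"
    and x: "\<And>i. i < n \<Longrightarrow> ((\<lambda>t. x t i) \<longlongrightarrow> p i) F" "\<forall>\<^sub>F t in F. x t \<in> euc n"
  shows "\<forall>\<^sub>F t in F. x t \<in> U"
proof -
  obtain e where e: "e > 0" "\<And>y. y \<in> euc n \<Longrightarrow> (\<And>i. i < n \<Longrightarrow> \<bar>y i - p i\<bar> < e) \<Longrightarrow> y \<in> U"
    using open_box[OF U] by metis
  have "\<forall>\<^sub>F t in F. \<forall>i\<in>{..<n}. \<bar>x t i - p i\<bar> < e"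
    using tendstoD[OF x(1) e(1)] by (intro eventually_ball_finite) (auto simp: dist_real_def)
  with x(2) show ?thesis
    by eventually_elim (auto intro: e)
qed

text \<open>Continuity is used below as convergence along families that converge coordinatewise; the
  arbitrary filter \<open>F\<close> covers the limits of difference quotients.\<close>

lemma tendsto_continuous_Euclidean:
  assumes U: "openin (Euclidean_space n) U" "p \<in> U"
    and f: "continuous_map (subtopology (Euclidean_space n) U) euclideanreal f"
    and x: "\<And>i. i < n \<Longrightarrow> ((\<lambda>t. x t i) \<longlongrightarrow> p i) F" "\<forall>\<^sub>F t in F. x t \<in> euc n"
  shows "((\<lambda>t. f (x t)) \<longlongrightarrow> f p) F"
proof (rule tendstoI)
  fix e :: real assume e: "e > 0"
  have "openin (subtopology (Euclidean_space n) U) {y \<in> topspace (subtopology (Euclidean_space n) U). f y \<in> ball (f p) e}"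
    by (intro openin_continuous_map_preimage[OF f]) auto
  then have "openin (Euclidean_space n) {y \<in> U. f y \<in> ball (f p) e}"
    using U openin_open_subtopology[OF U(1)] openin_subset[OF U(1)] by (simp add: inf.absorb2)
  from eventually_in_open[OF this _ x] U e
  show "\<forall>\<^sub>F t in F. dist (f (x t)) (f p) < e"
    by (auto simp: dist_commute elim: eventually_mono)
qed

lemma eventually_upd_in_open:
  assumes U: "openin (Euclidean_space n) U" "p \<in> U" "i < n"
  shows "\<forall>\<^sub>F t in nhds (p i). p(i := t) \<in> U"
proof (rule eventually_in_open[OF U(1,2)])
  show "((\<lambda>t. (p(i := t)) j) \<longlongrightarrow> p j) (nhds (p i))" for j
    by (cases "j = i") (auto simp: filterlim_ident)
qed (use U openin_Euclidean_subset upd_euc in auto)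

section \<open>Functions of class \<open>C^k\<close>: locality and algebraic operations\<close>

lemma Ck_on_continuous: "Ck_on k n U f \<Longrightarrow> continuous_map (subtopology (Euclidean_space n) U) euclideanreal f"
  by (cases k) auto

lemma Ck_on_Suc_ex:
  assumes "Ck_on (Suc k) n U f"
  shows "\<exists>f'. (\<forall>i<n. \<forall>x\<in>U. ((\<lambda>t. f (x(i := t))) has_real_derivative f' i x) (at (x i))) \<and>
    (\<forall>i<n. Ck_on k n U (f' i))"
proof -
  define P where "P i f' \<longleftrightarrow> (\<forall>x\<in>U. ((\<lambda>t. f (x(i := t))) has_real_derivative f' x) (at (x i))) \<and> Ck_on k n U f'" for i f'
  have "\<forall>i. \<exists>f'. i < n \<longrightarrow> P i f'" using assms unfolding Ck_on.simps P_def by blast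
  then obtain F where "\<forall>i. i < n \<longrightarrow> P i (F i)" using choice by metis
  then show ?thesis by (intro exI[of _ F]) (simp add: P_def)
qed

lemma Ck_on_SucI:
  assumes "continuous_map (subtopology (Euclidean_space n) U) euclideanreal f"
    "\<And>i x. i < n \<Longrightarrow> x \<in> U \<Longrightarrow> ((\<lambda>t. f (x(i := t))) has_real_derivative f' i x) (at (x i))"
    "\<And>i. i < n \<Longrightarrow> Ck_on k n U (f' i)"
  shows "Ck_on (Suc k) n U f"
  using assms unfolding Ck_on.simps by blast

lemma Ck_on_mono: "Ck_on k n U f \<Longrightarrow> W \<subseteq> U \<Longrightarrow> Ck_on k n W f"
proof (induction k arbitrary: f)
  case 0
  then show ?case by (auto intro: continuous_map_from_subtopology_mono)
next
  case (Suc k)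
  then have "continuous_map (subtopology (Euclidean_space n) W) euclideanreal f"
    by (auto intro: continuous_map_from_subtopology_mono)
  with Suc show ?case unfolding Ck_on.simps by (meson subsetD)
qed

lemma Ck_on_Suc_imp: "Ck_on (Suc k) n U f \<Longrightarrow> Ck_on k n U f"
proof (induction k arbitrary: f)
  case (Suc k)
  obtain f' where *: "\<forall>i<n. \<forall>x\<in>U. ((\<lambda>t. f (x(i := t))) has_real_derivative f' i x) (at (x i))"
    "\<forall>i<n. Ck_on (Suc k) n U (f' i)" using Ck_on_Suc_ex[OF Suc.prems] by blast
  note f' = *[rule_format]
  show ?case
    by (rule Ck_on_SucI[OF Ck_on_continuous[OF Suc.prems] f'(1) Suc.IH[OF f'(2)]])
qed simp

lemma partial_derivative_cong:
  assumes U: "openin (Euclidean_space n) U" "x \<in> U" "i < n" and eq: "\<And>x. x \<in> U \<Longrightarrow> f x = g x"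
  shows "((\<lambda>t. f (x(i := t))) has_real_derivative D) (at (x i)) \<longleftrightarrow>
         ((\<lambda>t. g (x(i := t))) has_real_derivative D) (at (x i))"
  using eventually_upd_in_open[OF U]
  by (intro DERIV_cong_ev) (auto elim: eventually_mono simp: eq)

text \<open>The derivative in \<open>Ck_on\<close> is that of the total function along a whole
  coordinate line. Since \<open>U\<close> is open, only arguments near \<open>x i\<close> count, and
  these stay in \<open>U\<close>.\<close>

lemma Ck_on_cong:
  assumes U: "openin (Euclidean_space n) U" and eq: "\<And>x. x \<in> U \<Longrightarrow> f x = g x"
  shows "Ck_on k n U f \<longleftrightarrow> Ck_on k n U g"
proof -
  have c: "continuous_map (subtopology (Euclidean_space n) U) euclideanreal f \<longleftrightarrow>
      continuous_map (subtopology (Euclidean_space n) U) euclideanreal g"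
    using eq by (auto intro: continuous_map_eq)
  show ?thesis
  proof (cases k)
    case (Suc m)
    have "(\<forall>x\<in>U. ((\<lambda>t. f (x(i := t))) has_real_derivative f' x) (at (x i))) \<longleftrightarrow>
          (\<forall>x\<in>U. ((\<lambda>t. g (x(i := t))) has_real_derivative f' x) (at (x i)))" if "i < n" for i f'
      by (intro ball_cong refl partial_derivative_cong[OF U _ that eq])
    then show ?thesis unfolding Suc Ck_on.simps c by blast
  qed (simp add: c)
qed

lemma continuous_map_local:
  assumes "\<And>p. p \<in> U \<Longrightarrow> \<exists>W. openin (Euclidean_space n) W \<and> p \<in> W \<and> W \<subseteq> U \<and>
    continuous_map (subtopology (Euclidean_space n) W) euclideanreal f"
  shows "continuous_map (subtopology (Euclidean_space n) U) euclideanreal f"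
proof -
  obtain W where W: "\<And>p. p \<in> U \<Longrightarrow> openin (Euclidean_space n) (W p) \<and> p \<in> W p \<and> W p \<subseteq> U \<and>
      continuous_map (subtopology (Euclidean_space n) (W p)) euclideanreal f"
    using assms by metis
  show ?thesis
  proof (rule pasting_lemma[where I = U and T = W and f = "\<lambda>_. f"])
    fix p assume p: "p \<in> U"
    show "openin (subtopology (Euclidean_space n) U) (W p)"
      using W[OF p] by (auto simp: openin_subtopology)
    show "continuous_map (subtopology (subtopology (Euclidean_space n) U) (W p)) euclideanreal f"
      using W[OF p] by (auto simp: subtopology_subtopology Int_absorb1)
  qed (use W in auto)
qed

lemma Ck_on_local:
  assumes "\<And>p. p \<in> U \<Longrightarrow> \<exists>W. openin (Euclidean_space n) W \<and> p \<in> W \<and> W \<subseteq> U \<and> Ck_on k n W f"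
  shows "Ck_on k n U f"
  using assms
proof (induction k arbitrary: f)
  case 0
  then show ?case using continuous_map_local[of U n f] by simp
next
  case (Suc k)
  have c: "continuous_map (subtopology (Euclidean_space n) U) euclideanreal f"
  proof (rule continuous_map_local)
    fix p assume "p \<in> U"
    from Suc.prems[OF this] obtain W where "openin (Euclidean_space n) W" "p \<in> W" "W \<subseteq> U" "Ck_on (Suc k) n W f"
      by blast
    then show "\<exists>W. openin (Euclidean_space n) W \<and> p \<in> W \<and> W \<subseteq> U \<and>
        continuous_map (subtopology (Euclidean_space n) W) euclideanreal f"
      by (intro exI[of _ W]) (simp add: Ck_on_continuous[of "Suc k"] del: Ck_on.simps)
  qed
  show ?case unfolding Ck_on.simps
  proof (intro conjI c allI impI)
    fix i assume i: "i < n"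
    \<comment> \<open>The neighbourhoods provide unrelated partial derivatives; \<open>deriv\<close>
      names one function on all of \<open>U\<close>, and uniqueness of derivatives makes it agree
      with each of them.\<close>
    define D where "D x = deriv (\<lambda>t. f (x(i := t))) (x i)" for x
    have *: "\<exists>W. openin (Euclidean_space n) W \<and> p \<in> W \<and> W \<subseteq> U \<and> Ck_on k n W D \<and>
         ((\<lambda>t. f (p(i := t))) has_real_derivative D p) (at (p i))" if p: "p \<in> U" for p
    proof -
      obtain W where W: "openin (Euclidean_space n) W" "p \<in> W" "W \<subseteq> U" "Ck_on (Suc k) n W f"
        using Suc.prems[OF p] by blast
      then obtain f' where f': "\<And>x. x \<in> W \<Longrightarrow> ((\<lambda>t. f (x(i := t))) has_real_derivative f' x) (at (x i))"
          "Ck_on k n W f'" using i unfolding Ck_on.simps by blast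
      have "D x = f' x" if "x \<in> W" for x
        using f'(1)[OF that] by (simp add: D_def DERIV_imp_deriv)
      then show ?thesis using W f' Ck_on_cong[OF W(1), of D f' k] by auto
    qed
    then have "Ck_on k n U D" by (intro Suc.IH) blast
    with * show "\<exists>f'. (\<forall>x\<in>U. ((\<lambda>t. f (x(i := t))) has_real_derivative f' x) (at (x i))) \<and> Ck_on k n U f'"
      by blast
  qed
qed

lemma Ck_on_const: "Ck_on k n U (\<lambda>x. c)"
proof (induction k arbitrary: c)
  case (Suc k)
  then show ?case by (auto intro!: exI[of _ "\<lambda>_. 0"])
qed simp

lemma Ck_on_coordinate: "Ck_on k n U (\<lambda>x. x j)"
proof (cases k)
  case (Suc m)
  have "((\<lambda>t. (x(i := t)) j) has_real_derivative (if j = i then 1 else 0)) (at (x i))" for x i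
    by auto
  then show ?thesis unfolding Suc
    by (intro Ck_on_SucI[where f' = "\<lambda>i x. if j = i then 1 else 0"] Ck_on_const
        continuous_map_from_subtopology continuous_map_coordinate)
qed (auto intro: continuous_map_from_subtopology continuous_map_coordinate)

lemma Ck_on_add: "Ck_on k n U f \<Longrightarrow> Ck_on k n U g \<Longrightarrow> Ck_on k n U (\<lambda>x. f x + g x)"
proof (induction k arbitrary: f g)
  case 0 then show ?case by (auto intro: continuous_map_add)
next
  case (Suc k)
  obtain f' where *: "\<forall>i<n. \<forall>x\<in>U. ((\<lambda>t. f (x(i := t))) has_real_derivative f' i x) (at (x i))"
    "\<forall>i<n. Ck_on k n U (f' i)" using Ck_on_Suc_ex[OF Suc.prems(1)] by blast
  note f' = *[rule_format]
  obtain g' where *: "\<forall>i<n. \<forall>x\<in>U. ((\<lambda>t. g (x(i := t))) has_real_derivative g' i x) (at (x i))"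
    "\<forall>i<n. Ck_on k n U (g' i)" using Ck_on_Suc_ex[OF Suc.prems(2)] by blast
  note g' = *[rule_format]
  show ?case
    using Suc.prems[THEN Ck_on_continuous]
    by (intro Ck_on_SucI[where f' = "\<lambda>i x. f' i x + g' i x"] Suc.IH f' g' DERIV_add)
      (auto intro: continuous_map_add)
qed

lemma Ck_on_mult: "Ck_on k n U f \<Longrightarrow> Ck_on k n U g \<Longrightarrow> Ck_on k n U (\<lambda>x. f x * g x)"
proof (induction k arbitrary: f g)
  case 0 then show ?case by (auto intro: continuous_map_real_mult)
next
  case (Suc k)
  obtain f' where *: "\<forall>i<n. \<forall>x\<in>U. ((\<lambda>t. f (x(i := t))) has_real_derivative f' i x) (at (x i))"
    "\<forall>i<n. Ck_on k n U (f' i)" using Ck_on_Suc_ex[OF Suc.prems(1)] by blast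
  note f' = *[rule_format]
  obtain g' where *: "\<forall>i<n. \<forall>x\<in>U. ((\<lambda>t. g (x(i := t))) has_real_derivative g' i x) (at (x i))"
    "\<forall>i<n. Ck_on k n U (g' i)" using Ck_on_Suc_ex[OF Suc.prems(2)] by blast
  note g' = *[rule_format]
  have "((\<lambda>t. f (x(i := t)) * g (x(i := t))) has_real_derivative f' i x * g x + g' i x * f x) (at (x i))"
    if "i < n" "x \<in> U" for i x
    using DERIV_mult[OF f'(1)[OF that] g'(1)[OF that]] by simp
  then show ?case
    using Suc.prems[THEN Ck_on_continuous]
    by (intro Ck_on_SucI[where f' = "\<lambda>i x. f' i x * g x + g' i x * f x"] Suc.IH f' g' Ck_on_add
        continuous_map_real_mult Suc.prems[THEN Ck_on_Suc_imp])
qed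

lemma Ck_on_sum: "(\<And>j. j \<in> J \<Longrightarrow> Ck_on k n U (f j)) \<Longrightarrow> Ck_on k n U (\<lambda>x. \<Sum>j\<in>J. f j x)"
proof (induction J rule: infinite_finite_induct)
  case (insert j J)
  then show ?case by (simp add: Ck_on_add)
qed (simp_all add: Ck_on_const)

lemma Ck_on_inverse:
  assumes "openin (Euclidean_space n) U" "Ck_on k n U f" "\<And>x. x \<in> U \<Longrightarrow> f x \<noteq> 0"
  shows "Ck_on k n U (\<lambda>x. inverse (f x))"
  using assms
proof (induction k arbitrary: f)
  case 0 then show ?case by (auto intro!: continuous_map_real_inverse)
next
  case (Suc k)
  obtain f' where *: "\<forall>i<n. \<forall>x\<in>U. ((\<lambda>t. f (x(i := t))) has_real_derivative f' i x) (at (x i))"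
    "\<forall>i<n. Ck_on k n U (f' i)" using Ck_on_Suc_ex[OF Suc.prems(2)] by blast
  note f' = *[rule_format]
  have i: "Ck_on k n U (\<lambda>x. inverse (f x))"
    using Suc Ck_on_Suc_imp by blast
  \<comment> \<open>The derivative is kept as a product with the constant \<open>-1\<close>, the
    shape in which \<open>Ck_on_mult\<close> and \<open>Ck_on_const\<close> apply.\<close>
  have "((\<lambda>t. inverse (f (x(i := t)))) has_real_derivative -1 * (inverse (f x) * f' i x * inverse (f x))) (at (x i))"
    if "i < n" "x \<in> U" for i x
    using DERIV_inverse'[OF f'(1)[OF that]] Suc.prems(3)[OF that(2)] by simp
  moreover have "continuous_map (subtopology (Euclidean_space n) U) euclideanreal (\<lambda>x. inverse (f x))"
    using Suc.prems(2)[THEN Ck_on_continuous] Suc.prems(3) by (auto intro!: continuous_map_real_inverse)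
  ultimately show ?case
    by (intro Ck_on_SucI[where f' = "\<lambda>i x. -1 * (inverse (f x) * f' i x * inverse (f x))"] Ck_on_mult i f' Ck_on_const)
qed

text \<open>The mean value theorem on the \<open>k\<close>-th coordinate line through
  \<open>x t\<close>, with the line and both end points moving. Coordinate \<open>k\<close> of
  \<open>x t\<close> is overwritten and need not converge, and \<open>u t\<close>,
  \<open>v t\<close> may coincide or come in either order. The factor \<open>q\<close> stands in for
  a total derivative, in the chain rule as well as in implicit differentiation.\<close>

lemma partial_increment:
  assumes V: "openin (Euclidean_space m) V" "p \<in> V" "k < m"
    and f': "continuous_map (subtopology (Euclidean_space m) V) euclideanreal f'"
    and der: "\<And>x. x \<in> V \<Longrightarrow> ((\<lambda>t. f (x(k := t))) has_real_derivative f' x) (at (x k))"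
    and x: "\<And>i. i < m \<Longrightarrow> i \<noteq> k \<Longrightarrow> ((\<lambda>t. x t i) \<longlongrightarrow> p i) F" "\<forall>\<^sub>F t in F. x t \<in> euc m"
    and u: "(u \<longlongrightarrow> p k) F" and v: "(v \<longlongrightarrow> p k) F"
  obtains q where "(q \<longlongrightarrow> f' p) F"
    "\<forall>\<^sub>F t in F. f ((x t)(k := u t)) - f ((x t)(k := v t)) = q t * (u t - v t)"
proof -
  obtain e where e: "e > 0" "\<And>y. y \<in> euc m \<Longrightarrow> (\<And>i. i < m \<Longrightarrow> \<bar>y i - p i\<bar> < e) \<Longrightarrow> y \<in> V"
    using open_box[OF V(1,2)] by metis
  \<comment> \<open>The bound holds for every point between \<open>u t\<close> and
    \<open>v t\<close>, whatever their order, and it forces the intermediate points to converge to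
    \<open>p k\<close>.\<close>
  define Q where "Q t w \<longleftrightarrow> \<bar>w - p k\<bar> \<le> \<bar>u t - p k\<bar> + \<bar>v t - p k\<bar> \<and>
      f ((x t)(k := u t)) - f ((x t)(k := v t)) = f' ((x t)(k := w)) * (u t - v t)" for t w
  have step: "\<exists>w. Q t w" if t: "x t \<in> euc m" "\<And>i. i < m \<Longrightarrow> i \<noteq> k \<Longrightarrow> \<bar>x t i - p i\<bar> < e"
      "\<bar>u t - p k\<bar> < e" "\<bar>v t - p k\<bar> < e" for t
  proof -
    have D: "((\<lambda>w. f ((x t)(k := w))) has_real_derivative f' ((x t)(k := w))) (at w)"
      if "\<bar>w - p k\<bar> < e" for w
    proof -
      have "(x t)(k := w) \<in> V"
        using t that V(3) upd_euc by (intro e(2)) auto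
      from der[OF this] show ?thesis by simp
    qed
    consider "u t = v t" | "u t < v t" | "v t < u t" by linarith
    then show ?thesis
    proof cases
      case 1 then show ?thesis by (intro exI[of _ "u t"]) (auto simp: Q_def)
    next
      case 2
      have "\<exists>z>u t. z < v t \<and> f ((x t)(k := v t)) - f ((x t)(k := u t)) = (v t - u t) * f' ((x t)(k := z))"
        by (rule MVT2[OF 2 D]) (use t in linarith)
      then obtain z where "u t < z" "z < v t"
         "f ((x t)(k := v t)) - f ((x t)(k := u t)) = (v t - u t) * f' ((x t)(k := z))" by blast
      then show ?thesis by (intro exI[of _ z]) (auto simp: Q_def algebra_simps)
    next
      case 3
      have "\<exists>z>v t. z < u t \<and> f ((x t)(k := u t)) - f ((x t)(k := v t)) = (u t - v t) * f' ((x t)(k := z))"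
        by (rule MVT2[OF 3 D]) (use t in linarith)
      then obtain z where "v t < z" "z < u t"
         "f ((x t)(k := u t)) - f ((x t)(k := v t)) = (u t - v t) * f' ((x t)(k := z))" by blast
      then show ?thesis by (intro exI[of _ z]) (auto simp: Q_def algebra_simps)
    qed
  qed
  define w where "w t = (SOME w. Q t w)" for t
  have ev: "\<forall>\<^sub>F t in F. Q t (w t)"
  proof -
    have "\<forall>\<^sub>F t in F. \<forall>i\<in>{..<m}-{k}. \<bar>x t i - p i\<bar> < e"
      using tendstoD[OF x(1) e(1)] by (intro eventually_ball_finite) (auto simp: dist_real_def)
    with x(2) tendstoD[OF u e(1)] tendstoD[OF v e(1)] show ?thesis
    proof eventually_elim
      case (elim t)
      then have "\<exists>w. Q t w" by (intro step) (auto simp: dist_real_def)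
      then show ?case unfolding w_def by (rule someI_ex)
    qed
  qed
  have "((\<lambda>t. \<bar>u t - p k\<bar> + \<bar>v t - p k\<bar>) \<longlongrightarrow> \<bar>p k - p k\<bar> + \<bar>p k - p k\<bar>) F"
    by (intro tendsto_intros u v)
  then have "((\<lambda>t. \<bar>u t - p k\<bar> + \<bar>v t - p k\<bar>) \<longlongrightarrow> 0) F"
    by simp
  moreover have "\<forall>\<^sub>F t in F. norm (w t - p k) \<le> \<bar>u t - p k\<bar> + \<bar>v t - p k\<bar>"
    using ev by eventually_elim (simp add: Q_def)
  ultimately have "((\<lambda>t. w t - p k) \<longlongrightarrow> 0) F"
    by (rule Lim_null_comparison[rotated])
  then have w: "(w \<longlongrightarrow> p k) F"
    using LIM_zero_iff by blast
  have "((\<lambda>t. f' ((x t)(k := w t))) \<longlongrightarrow> f' p) F"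
  proof (rule tendsto_continuous_Euclidean[OF V(1,2) f'])
    show "((\<lambda>t. ((x t)(k := w t)) i) \<longlongrightarrow> p i) F" if "i < m" for i
      using w x(1)[OF that] by (cases "i = k") auto
    show "\<forall>\<^sub>F t in F. (x t)(k := w t) \<in> euc m"
      using x(2) by eventually_elim (simp add: upd_euc V(3))
  qed
  then show thesis
  proof (rule that)
    show "\<forall>\<^sub>F t in F. f ((x t)(k := u t)) - f ((x t)(k := v t)) = f' ((x t)(k := w t)) * (u t - v t)"
      using ev by eventually_elim (simp add: Q_def)
  qed
qed

text \<open>The increment of \<open>f\<close> is telescoped along a path that changes one coordinate
  after the other from \<open>g t0\<close> to \<open>g t\<close>. Each step is a
  \<open>partial_increment\<close>, so continuity of the partial derivatives gives the chain
  rule.\<close>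

lemma has_real_derivative_compose_partials:
  assumes V: "openin (Euclidean_space m) V"
    and f': "\<And>j. j < m \<Longrightarrow> continuous_map (subtopology (Euclidean_space m) V) euclideanreal (f' j)"
    and der: "\<And>j x. j < m \<Longrightarrow> x \<in> V \<Longrightarrow> ((\<lambda>t. f (x(j := t))) has_real_derivative f' j x) (at (x j))"
    and g: "g t0 \<in> V" "\<forall>\<^sub>F t in at t0. g t \<in> euc m"
      "\<And>j. j < m \<Longrightarrow> ((\<lambda>t. g t j) has_real_derivative d j) (at t0)"
  shows "((\<lambda>t. f (g t)) has_real_derivative (\<Sum>j<m. f' j (g t0) * d j)) (at t0)"
proof -
  have lim: "((\<lambda>t. g t j) \<longlongrightarrow> g t0 j) (at t0)" if "j < m" for j
    using DERIV_isCont[OF g(3)[OF that]] by (simp add: isCont_def)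
  \<comment> \<open>The hybrid point: coordinates below \<open>k\<close> have already moved, the
    others are still those of \<open>g t0\<close>.\<close>
  define G where "G k t = (\<lambda>j. if j < k then g t j else g t0 j)" for k t
  have g0: "g t0 \<in> euc m" using V g(1) openin_Euclidean_subset by blast
  have "\<exists>q. (q \<longlongrightarrow> f' k (g t0)) (at t0) \<and>
      (\<forall>\<^sub>F t in at t0. f (G (Suc k) t) - f (G k t) = q t * (g t k - g t0 k))" if k: "k < m" for k
  proof -
    have GR: "\<forall>\<^sub>F t in at t0. G k t \<in> euc m"
      using g(2) by eventually_elim (use g0 k in \<open>auto simp: G_def mem_euc\<close>)
    have Glim: "((\<lambda>t. G k t i) \<longlongrightarrow> g t0 i) (at t0)" if "i < m" for i
      using lim[OF that] by (cases "i < k") (auto simp: G_def)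
    obtain q where q: "(q \<longlongrightarrow> f' k (g t0)) (at t0)"
      "\<forall>\<^sub>F t in at t0. f ((G k t)(k := g t k)) - f ((G k t)(k := g t0 k)) = q t * (g t k - g t0 k)"
      by (rule partial_increment[where f = f and x = "G k" and F = "at t0" and u = "\<lambda>t. g t k" and v = "\<lambda>_. g t0 k",
            OF V g(1) k f'[OF k] der[OF k]])
        (use GR Glim lim[OF k] in auto)
    moreover have "(G k t)(k := g t k) = G (Suc k) t" "(G k t)(k := g t0 k) = G k t" for t
      by (auto simp: G_def fun_eq_iff)
    ultimately show ?thesis by auto
  qed
  then have "\<forall>k. \<exists>q. k < m \<longrightarrow> (q \<longlongrightarrow> f' k (g t0)) (at t0) \<and>
      (\<forall>\<^sub>F t in at t0. f (G (Suc k) t) - f (G k t) = q t * (g t k - g t0 k))" by blast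
  from choice[OF this] obtain q where *: "\<forall>k. k < m \<longrightarrow> (q k \<longlongrightarrow> f' k (g t0)) (at t0) \<and>
      (\<forall>\<^sub>F t in at t0. f (G (Suc k) t) - f (G k t) = q k t * (g t k - g t0 k))" ..
  have q: "(q k \<longlongrightarrow> f' k (g t0)) (at t0)"
      "\<forall>\<^sub>F t in at t0. f (G (Suc k) t) - f (G k t) = q k t * (g t k - g t0 k)" if "k < m" for k
    using * that by blast+
  have "\<forall>\<^sub>F t in at t0. \<forall>k\<in>{..<m}. f (G (Suc k) t) - f (G k t) = q k t * (g t k - g t0 k)"
    using q(2) by (intro eventually_ball_finite) auto
  then have ev: "\<forall>\<^sub>F t in at t0. (\<Sum>k<m. q k t * ((g t k - g t0 k) / (t - t0))) = (f (g t) - f (g t0)) / (t - t0)"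
    using g(2)
  proof eventually_elim
    case (elim t)
    have "g t = G m t" "g t0 = G 0 t"
      using elim(2) g0 by (auto simp: G_def mem_euc fun_eq_iff)
    then have "f (g t) - f (g t0) = (\<Sum>k<m. f (G (Suc k) t) - f (G k t))"
      using sum_lessThan_telescope[of "\<lambda>k. f (G k t)" m] by metis
    also have "\<dots> = (\<Sum>k<m. q k t * (g t k - g t0 k))"
      using elim(1) by (intro sum.cong) auto
    finally show ?case by (simp add: sum_divide_distrib)
  qed
  have "((\<lambda>t. \<Sum>k<m. q k t * ((g t k - g t0 k) / (t - t0))) \<longlongrightarrow> (\<Sum>k<m. f' k (g t0) * d k)) (at t0)"
    using g(3) by (intro tendsto_sum tendsto_mult q(1)) (auto simp: has_field_derivative_iff)
  then show ?thesis
    unfolding has_field_derivative_iff by (rule Lim_transform_eventually[OF _ ev])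
qed

lemma continuous_map_into_Euclidean:
  assumes "\<And>j. j < m \<Longrightarrow> continuous_map X euclideanreal (\<lambda>x. G x j)"
    and "\<And>x. x \<in> topspace X \<Longrightarrow> G x \<in> V" "V \<subseteq> euc m"
  shows "continuous_map X (subtopology (Euclidean_space m) V) G"
proof -
  have "continuous_map X (Euclidean_space m) (\<lambda>x i. if i < m then G x i else 0)"
    using assms(1) by (simp add: continuous_map_componentwise_Euclidean_space)
  moreover have "(\<lambda>i. if i < m then G x i else 0) = G x" if "x \<in> topspace X" for x
  proof -
    have "G x \<in> euc m" using assms(2)[OF that] assms(3) by blast
    then show ?thesis by (auto simp: mem_euc fun_eq_iff)
  qed
  ultimately have "continuous_map X (Euclidean_space m) G"
    by (rule continuous_map_eq)
  then show ?thesis using assms(2) by (auto simp: continuous_map_in_subtopology)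
qed

text \<open>By the chain rule the partial derivatives of the composite are sums of products of
  \<open>f' j (G x)\<close>, of class \<open>C^k\<close> by the induction hypothesis, with partial
  derivatives of \<open>G\<close>.\<close>

lemma Ck_on_compose:
  assumes U: "openin (Euclidean_space n) U" and V: "openin (Euclidean_space m) V"
    and f: "Ck_on k m V f" and G: "\<And>j. j < m \<Longrightarrow> Ck_on k n U (\<lambda>x. G x j)"
    and GV: "\<And>x. x \<in> U \<Longrightarrow> G x \<in> V"
  shows "Ck_on k n U (\<lambda>x. f (G x))"
  using f G
proof (induction k arbitrary: f)
  case 0
  have "continuous_map (subtopology (Euclidean_space n) U) (subtopology (Euclidean_space m) V) G"
    by (rule continuous_map_into_Euclidean) (use 0 GV openin_subset[OF V] in auto)
  from continuous_map_compose[OF this, of euclideanreal f] 0(1) show ?case by (simp add: o_def)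
next
  case (Suc k)
  obtain f' where *: "\<forall>j<m. \<forall>x\<in>V. ((\<lambda>t. f (x(j := t))) has_real_derivative f' j x) (at (x j))"
    "\<forall>j<m. Ck_on k m V (f' j)" using Ck_on_Suc_ex[OF Suc.prems(1)] by blast
  note f' = *[rule_format]
  have "\<forall>j. \<exists>g'. j < m \<longrightarrow> (\<forall>i<n. \<forall>x\<in>U. ((\<lambda>t. G (x(i := t)) j) has_real_derivative g' i x) (at (x i))) \<and>
    (\<forall>i<n. Ck_on k n U (g' i))" using Ck_on_Suc_ex[OF Suc.prems(2)] by blast
  from choice[OF this] obtain g' where **:
    "\<forall>j. j < m \<longrightarrow> (\<forall>i<n. \<forall>x\<in>U. ((\<lambda>t. G (x(i := t)) j) has_real_derivative g' j i x) (at (x i))) \<and>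
    (\<forall>i<n. Ck_on k n U (g' j i))" by blast
  have g': "((\<lambda>t. G (x(i := t)) j) has_real_derivative g' j i x) (at (x i))" "Ck_on k n U (g' j i)"
    if "j < m" "i < n" "x \<in> U" for i j x using ** that by blast+
  have cont: "continuous_map (subtopology (Euclidean_space n) U) (subtopology (Euclidean_space m) V) G"
    by (rule continuous_map_into_Euclidean)
      (use Ck_on_continuous[OF Suc.prems(2)] GV openin_subset[OF V] in auto)
  show ?case
  proof (rule Ck_on_SucI)
    show "continuous_map (subtopology (Euclidean_space n) U) euclideanreal (\<lambda>x. f (G x))"
      using continuous_map_compose[OF cont Ck_on_continuous[OF Suc.prems(1)]] by (simp add: o_def)
  next
    fix i x assume i: "i < n" and x: "x \<in> U"
    have "((\<lambda>t. f (G (x(i := t)))) has_real_derivative (\<Sum>j<m. f' j (G (x(i := x i))) * g' j i x)) (at (x i))"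
    proof (rule has_real_derivative_compose_partials[OF V Ck_on_continuous[OF f'(2)] f'(1)])
      have "\<forall>\<^sub>F t in nhds (x i). G (x(i := t)) \<in> euc m"
        using eventually_upd_in_open[OF U x i]
        by eventually_elim (use GV V openin_Euclidean_subset in blast)
      then show "\<forall>\<^sub>F t in at (x i). G (x(i := t)) \<in> euc m"
        by (simp add: eventually_at_filter eventually_mono)
    qed (use GV x i g' in auto)
    then show "((\<lambda>t. f (G (x(i := t)))) has_real_derivative (\<Sum>j<m. f' j (G x) * g' j i x)) (at (x i))"
      by simp
  next
    fix i assume i: "i < n"
    show "Ck_on k n U (\<lambda>x. \<Sum>j<m. f' j (G x) * g' j i x)"
    \<comment> \<open>The facts \<open>g'\<close> carry the premise \<open>x \<in> U\<close>, so a
      point of \<open>U\<close> must be at hand to use their second half.\<close>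
    proof (cases "U = {}")
      case True then show ?thesis by (intro Ck_on_local) auto
    next
      case False
      then obtain y where "y \<in> U" by blast
      have 1: "Ck_on k n U (g' j i)" if "j < m" for j using g'(2)[OF that i \<open>y \<in> U\<close>] .
      have 2: "Ck_on k n U (\<lambda>x. f' j (G x))" if "j < m" for j
        by (rule Suc.IH[OF f'(2)[OF that] Ck_on_Suc_imp[OF Suc.prems(2)]])
      show ?thesis
        by (rule Ck_on_sum, rule Ck_on_mult) (simp_all add: 1 2)
    qed
  qed
qed

lemma smooth_on_compose:
  assumes "openin (Euclidean_space n) U" "openin (Euclidean_space m) V"
    and "smooth_on m V f" "\<And>j. j < m \<Longrightarrow> smooth_on n U (\<lambda>x. G x j)" "\<And>x. x \<in> U \<Longrightarrow> G x \<in> V"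
  shows "smooth_on n U (\<lambda>x. f (G x))"
  using assms Ck_on_compose[OF assms(1,2)] unfolding smooth_on_def by blast

lemma smooth_on_cong:
  "openin (Euclidean_space n) U \<Longrightarrow> (\<And>x. x \<in> U \<Longrightarrow> f x = g x) \<Longrightarrow> smooth_on n U f \<longleftrightarrow> smooth_on n U g"
  unfolding smooth_on_def using Ck_on_cong by blast

lemma smooth_on_local:
  assumes "\<And>p. p \<in> U \<Longrightarrow> \<exists>W. openin (Euclidean_space n) W \<and> p \<in> W \<and> W \<subseteq> U \<and> smooth_on n W f"
  shows "smooth_on n U f"
  unfolding smooth_on_def
proof
  fix k
  show "Ck_on k n U f"
  proof (rule Ck_on_local)
    fix p assume "p \<in> U"
    from assms[OF this] obtain W where "openin (Euclidean_space n) W" "p \<in> W" "W \<subseteq> U" "smooth_on n W f"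
      by blast
    then show "\<exists>W. openin (Euclidean_space n) W \<and> p \<in> W \<and> W \<subseteq> U \<and> Ck_on k n W f"
      by (auto simp: smooth_on_def)
  qed
qed

lemma smooth_on_mono: "smooth_on n U f \<Longrightarrow> W \<subseteq> U \<Longrightarrow> smooth_on n W f"
  unfolding smooth_on_def using Ck_on_mono by blast

lemma smooth_on_coordinate: "smooth_on n U (\<lambda>x. x j)"
  by (simp add: smooth_on_def Ck_on_coordinate)

lemma smooth_on_const: "smooth_on n U (\<lambda>x. c)"
  by (simp add: smooth_on_def Ck_on_const)

lemma smooth_on_continuous:
  "smooth_on n U f \<Longrightarrow> continuous_map (subtopology (Euclidean_space n) U) euclideanreal f"
  unfolding smooth_on_def using Ck_on_continuous by blast

text \<open>For each \<open>k\<close> the definition supplies some partial derivative of class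
  \<open>C^k\<close>; by uniqueness all of them agree on \<open>U\<close> with the single function
  given by \<open>deriv\<close>.\<close>

lemma smooth_on_partial:
  assumes U: "openin (Euclidean_space n) U" and f: "smooth_on n U f" and i: "i < n"
  shows "\<exists>f'. (\<forall>x\<in>U. ((\<lambda>t. f (x(i := t))) has_real_derivative f' x) (at (x i))) \<and> smooth_on n U f'"
proof -
  define D where "D x = deriv (\<lambda>t. f (x(i := t))) (x i)" for x
  have *: "Ck_on k n U D \<and> (\<forall>x\<in>U. ((\<lambda>t. f (x(i := t))) has_real_derivative D x) (at (x i)))" for k
  proof -
    obtain f' where "\<forall>i<n. \<forall>x\<in>U. ((\<lambda>t. f (x(i := t))) has_real_derivative f' i x) (at (x i))"
      "\<forall>i<n. Ck_on k n U (f' i)"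
      using Ck_on_Suc_ex[of k n U f] f[unfolded smooth_on_def] by blast
    then have f': "\<forall>x\<in>U. ((\<lambda>t. f (x(i := t))) has_real_derivative f' i x) (at (x i))" "Ck_on k n U (f' i)"
      using i by auto
    then have "D x = f' i x" if "x \<in> U" for x
      using that by (simp add: D_def DERIV_imp_deriv)
    with f' Ck_on_cong[OF U, of D "f' i" k] show ?thesis by simp
  qed
  then show ?thesis by (intro exI[of _ D]) (simp add: smooth_on_def)
qed

lemma openin_positive:
  assumes U: "openin (Euclidean_space n) U"
    and f: "continuous_map (subtopology (Euclidean_space n) U) euclideanreal f"
  shows "openin (Euclidean_space n) {x \<in> U. f x > 0}"
proof -
  have "openin (subtopology (Euclidean_space n) U) {y \<in> topspace (subtopology (Euclidean_space n) U). f y \<in> {0<..}}"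
    by (intro openin_continuous_map_preimage[OF f]) auto
  then show ?thesis
    using openin_open_subtopology[OF U] openin_subset[OF U] by (simp add: inf.absorb2)
qed

lemma smooth_on_imp: "smooth_on n U f \<Longrightarrow> Ck_on k n U f"
  by (simp add: smooth_on_def)

lemma eventually_upd_at:
  assumes "openin (Euclidean_space n) U" "p \<in> U" "i < n"
  shows "\<forall>\<^sub>F t in at (p i). p(i := t) \<in> U"
  using eventually_upd_in_open[OF assms] by (simp add: eventually_at_filter eventually_mono)

lemma Ck_on_neg: "Ck_on k n U f \<Longrightarrow> Ck_on k n U (\<lambda>x. - f x)"
  using Ck_on_mult[OF Ck_on_const[of k n U "-1"]] by simp

lemma Ck_on_upd:
  "Ck_on k n U \<xi> \<Longrightarrow> Ck_on k n U (\<lambda>z. (z(l := \<xi> z)) j)"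
  by (cases "j = l") (simp_all add: Ck_on_coordinate)

text \<open>The map \<open>z \<mapsto> z(l := \<xi> z)\<close> is a right inverse of
  \<open>x \<mapsto> x(l := f x)\<close>. When coordinate \<open>i\<close> moves, the increment of
  \<open>\<xi>\<close> times a mean value factor \<open>q\<close> equals \<open>Z t l\<close> minus
  the value of \<open>f\<close> with coordinate \<open>l\<close> frozen at \<open>\<xi> z\<close>.
  Since \<open>q\<close> tends to the nonzero \<open>f' l\<close>, dividing by it gives the
  derivative.\<close>

lemma implicit_derivative:
  assumes V: "openin (Euclidean_space n) V" and l: "l < n"
    and f': "\<And>i x. i < n \<Longrightarrow> x \<in> V \<Longrightarrow> ((\<lambda>t. f (x(i := t))) has_real_derivative f' i x) (at (x i))"
    and cont: "continuous_map (subtopology (Euclidean_space n) V) euclideanreal (f' l)"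
    and W: "openin (Euclidean_space n) W"
    and \<xi>: "continuous_map (subtopology (Euclidean_space n) W) euclideanreal \<xi>"
    and \<eta>: "\<And>z. z \<in> W \<Longrightarrow> z(l := \<xi> z) \<in> V \<and> f (z(l := \<xi> z)) = z l"
    and z: "z \<in> W" and nz: "f' l (z(l := \<xi> z)) \<noteq> 0" and i: "i < n"
  shows "((\<lambda>t. \<xi> (z(i := t))) has_real_derivative
      (if i = l then 1 else - f' i (z(l := \<xi> z))) * inverse (f' l (z(l := \<xi> z)))) (at (z i))"
proof -
  define p where "p = z(l := \<xi> z)"
  define Z where "Z t = z(i := t)" for t
  have p: "p \<in> V" "f p = z l" using \<eta>[OF z] by (auto simp: p_def)
  have ZW: "\<forall>\<^sub>F t in at (z i). Z t \<in> W" unfolding Z_def by (rule eventually_upd_at[OF W z i])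
  have ZR: "\<forall>\<^sub>F t in at (z i). Z t \<in> euc n"
    using ZW by eventually_elim (use W openin_Euclidean_subset in blast)
  have Zlim: "((\<lambda>t. Z t j) \<longlongrightarrow> z j) (at (z i))" for j
    by (cases "j = i") (auto simp: Z_def)
  have \<xi>lim: "((\<lambda>t. \<xi> (Z t)) \<longlongrightarrow> \<xi> z) (at (z i))"
    by (rule tendsto_continuous_Euclidean[OF W z \<xi> Zlim ZR])
  obtain q where q: "(q \<longlongrightarrow> f' l p) (at (z i))"
    "\<forall>\<^sub>F t in at (z i). f ((Z t)(l := \<xi> (Z t))) - f ((Z t)(l := \<xi> z)) = q t * (\<xi> (Z t) - \<xi> z)"
    by (rule partial_increment[where f = f and x = Z and F = "at (z i)" and u = "\<lambda>t. \<xi> (Z t)" and v = "\<lambda>_. \<xi> z",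
         OF V p(1) l cont f'[OF l]])
      (use Zlim ZR \<xi>lim in \<open>auto simp: p_def\<close>)
  define e where "e = (if i = l then 0 else f' i p)"
  define r where "r t = f ((Z t)(l := \<xi> z))" for t
  have r: "(r has_real_derivative e) (at (z i))"
  proof (cases "i = l")
    case True
    then have "r = (\<lambda>t. f p)" by (auto simp: r_def Z_def p_def fun_eq_iff)
    with True show ?thesis by (simp add: e_def)
  next
    case False
    have "r = (\<lambda>t. f (p(i := t)))" using False by (auto simp: r_def Z_def p_def fun_upd_twist fun_eq_iff)
    moreover have "p i = z i" using False by (simp add: p_def)
    ultimately show ?thesis using f'[OF i p(1)] False by (simp add: e_def)
  qed
  have r0: "r (z i) = z l" using p(2) by (simp add: r_def Z_def p_def)
  \<comment> \<open>The required value \<open>Z t l\<close> minus the value reached without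
    adjusting \<open>\<xi>\<close>; the adjustment of \<open>\<xi>\<close> has to make up for
    it.\<close>
  define m where "m t = Z t l - r t" for t
  have "((\<lambda>t. Z t l) has_real_derivative (if i = l then 1 else 0)) (at (z i))"
    by (cases "i = l") (auto simp: Z_def)
  from DERIV_diff[OF this r] have "(m has_real_derivative (if i = l then 1 else - f' i p)) (at (z i))"
    by (cases "i = l") (auto simp: m_def[abs_def] e_def)
  moreover have "m (z i) = 0" using r0 by (simp add: m_def Z_def)
  ultimately have "((\<lambda>t. m t / (t - z i)) \<longlongrightarrow> (if i = l then 1 else - f' i p)) (at (z i))"
    by (simp add: has_field_derivative_iff)
  then have lim: "((\<lambda>t. (m t / (t - z i)) * inverse (q t)) \<longlongrightarrow> (if i = l then 1 else - f' i p) * inverse (f' l p)) (at (z i))"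
    using q(1) nz by (intro tendsto_mult tendsto_inverse) (auto simp: p_def)
  have "\<forall>\<^sub>F t in at (z i). q t \<noteq> 0"
    using tendsto_imp_eventually_ne[OF q(1)] nz by (simp add: p_def)
  with q(2) ZW have "\<forall>\<^sub>F t in at (z i). (m t / (t - z i)) * inverse (q t) = (\<xi> (Z t) - \<xi> z) / (t - z i)"
  proof eventually_elim
    case (elim t)
    then have "m t = q t * (\<xi> (Z t) - \<xi> z)"
      using \<eta>[of "Z t"] by (simp add: m_def r_def)
    then show ?case using elim(3) by (simp add: divide_simps)
  qed
  from Lim_transform_eventually[OF lim this] show ?thesis
    unfolding has_field_derivative_iff Z_def p_def fun_upd_triv .
qed

text \<open>Bootstrapping: the formula for the partial derivatives of \<open>\<xi>\<close> contains
  only \<open>\<xi>\<close> and derivatives of \<open>f\<close>, so class \<open>C^k\<close> of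
  \<open>\<xi>\<close> yields the next class.\<close>

lemma implicit_smooth:
  assumes V: "openin (Euclidean_space n) V" and l: "l < n" and f: "smooth_on n V f"
    and f'l: "\<And>x. x \<in> V \<Longrightarrow> ((\<lambda>t. f (x(l := t))) has_real_derivative f'l x) (at (x l))"
    and W: "openin (Euclidean_space n) W"
    and \<xi>: "continuous_map (subtopology (Euclidean_space n) W) euclideanreal \<xi>"
    and \<eta>: "\<And>z. z \<in> W \<Longrightarrow> z(l := \<xi> z) \<in> V \<and> f (z(l := \<xi> z)) = z l"
    and nz: "\<And>z. z \<in> W \<Longrightarrow> f'l (z(l := \<xi> z)) \<noteq> 0"
  shows "smooth_on n W \<xi>"
proof -
  have "\<forall>i. \<exists>f'. i < n \<longrightarrow> (\<forall>x\<in>V. ((\<lambda>t. f (x(i := t))) has_real_derivative f' x) (at (x i))) \<and> smooth_on n V f'"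
    using smooth_on_partial[OF V f] by blast
  from choice[OF this] obtain f' where
    *: "\<forall>i. i < n \<longrightarrow> (\<forall>x\<in>V. ((\<lambda>t. f (x(i := t))) has_real_derivative f' i x) (at (x i))) \<and> smooth_on n V (f' i)" ..
  have f': "((\<lambda>t. f (x(i := t))) has_real_derivative f' i x) (at (x i))" if "i < n" "x \<in> V" for i x
    using * that by blast
  have sf': "smooth_on n V (f' i)" if "i < n" for i using * that by blast
  have nz': "f' l (z(l := \<xi> z)) \<noteq> 0" if "z \<in> W" for z
    using DERIV_unique[OF f'[OF l] f'l] \<eta>[OF that] nz[OF that] by metis
  have "Ck_on k n W \<xi>" for k
  proof (induction k)
    case (Suc k)
    have c: "Ck_on k n W (\<lambda>z. f' i (z(l := \<xi> z)))" if "i < n" for i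
      by (rule Ck_on_compose[OF W V smooth_on_imp[OF sf'[OF that]] Ck_on_upd[OF Suc.IH]]) (use \<eta> in blast)
    show ?case
    proof (rule Ck_on_SucI[OF \<xi>])
      show "((\<lambda>t. \<xi> (z(i := t))) has_real_derivative
        (if i = l then 1 else - f' i (z(l := \<xi> z))) * inverse (f' l (z(l := \<xi> z)))) (at (z i))" if "i < n" "z \<in> W" for i z
        by (rule implicit_derivative[OF V l f' smooth_on_continuous[OF sf'[OF l]] W \<xi> \<eta> that(2) nz'[OF that(2)] that(1)])
      show "Ck_on k n W (\<lambda>z. (if i = l then 1 else - f' i (z(l := \<xi> z))) * inverse (f' l (z(l := \<xi> z))))" if "i < n" for i
        using Ck_on_neg[OF c[OF that]] Ck_on_const
        by (intro Ck_on_mult Ck_on_inverse[OF W c[OF l] nz']) (cases "i = l", simp_all)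
    qed
  qed (use \<xi> in simp)
  then show ?thesis by (simp add: smooth_on_def)
qed

section \<open>Local left inverses of injective smooth maps\<close>

text \<open>The inverse function theorem for \<open>y \<mapsto> y(l := f y)\<close>, which changes a
  single coordinate. Along lines in direction \<open>l\<close> it is strictly monotone near
  \<open>p\<close>, so the intermediate value theorem inverts it, and \<open>implicit_smooth\<close>
  makes the inverse smooth.\<close>

lemma straighten:
  assumes V: "openin (Euclidean_space n) V" and f: "smooth_on n V f" and l: "l < n" and p: "p \<in> V"
    and d: "((\<lambda>t. f (p(l := t))) has_real_derivative d) (at (p l))" "d \<noteq> 0"
  obtains P W \<xi> where "openin (Euclidean_space n) P" "p \<in> P" "P \<subseteq> V" "openin (Euclidean_space n) W"
    "smooth_on n W \<xi>" "\<forall>z\<in>W. z(l := \<xi> z) \<in> P \<and> f (z(l := \<xi> z)) = z l"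
    "\<forall>y\<in>P. y(l := f y) \<in> W \<and> \<xi> (y(l := f y)) = y l"
proof -
  obtain f' where f': "\<And>x. x \<in> V \<Longrightarrow> ((\<lambda>t. f (x(l := t))) has_real_derivative f' x) (at (x l))"
    and sf': "smooth_on n V f'"
    using smooth_on_partial[OF V f l] by blast
  have f'p: "f' p = d" using DERIV_unique[OF f'[OF p] d(1)] .
  \<comment> \<open>Multiplying by the sign makes \<open>f\<close> increasing along the line,
    whether \<open>d\<close> is positive or negative.\<close>
  define s where "s = sgn d"
  have s: "s * d > 0" "s * s = 1" "s \<noteq> 0" using d(2) by (auto simp: s_def sgn_if)
  define N where "N = {x \<in> V. s * f' x > 0}"
  have "openin (Euclidean_space n) N" unfolding N_def
    by (rule openin_positive[OF V Ck_on_continuous[OF Ck_on_mult[OF Ck_on_const smooth_on_imp[OF sf', of 0]]]])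
  moreover have "p \<in> N" using p s f'p by (simp add: N_def)
  ultimately obtain e0 where e0: "e0 > 0" "\<And>y. y \<in> euc n \<Longrightarrow> (\<And>i. i < n \<Longrightarrow> \<bar>y i - p i\<bar> < e0) \<Longrightarrow> y \<in> N"
    using open_box by metis
  \<comment> \<open>Half of \<open>e0\<close> puts the closed box into \<open>N\<close>, so that the
    end points \<open>p l - e\<close> and \<open>p l + e\<close> may be used.\<close>
  define e where "e = e0 / 2"
  have e1: "e > 0" using e0(1) by (simp add: e_def)
  have e2: "y \<in> N" if "y \<in> euc n" "\<And>i. i < n \<Longrightarrow> \<bar>y i - p i\<bar> \<le> e" for y
  proof (rule e0(2)[OF that(1)])
    show "\<bar>y i - p i\<bar> < e0" if "i < n" for i
      using \<open>\<And>i. i < n \<Longrightarrow> \<bar>y i - p i\<bar> \<le> e\<close>[OF that] e0(1) by (simp add: e_def)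
  qed
  note e = e1 e2
  have pR: "p \<in> euc n" using p V openin_Euclidean_subset by blast
  \<comment> \<open>Coordinate \<open>l\<close> is left free: in a point of \<open>W\<close> it
    holds a value of \<open>f\<close>, which need not be close to \<open>p l\<close>.\<close>
  define Q where "Q = {y \<in> euc n. \<forall>i<n. i \<noteq> l \<longrightarrow> \<bar>y i - p i\<bar> < e}"
  have Q: "openin (Euclidean_space n) Q"
    unfolding openin_Euclidean_iff
  proof (intro conjI ballI)
    fix y assume y: "y \<in> Q"
    define b where "b = Min (insert 1 ((\<lambda>i. e - \<bar>y i - p i\<bar>) ` ({..<n} - {l})))"
    have b: "b > 0" "\<And>i. i < n \<Longrightarrow> i \<noteq> l \<Longrightarrow> b \<le> e - \<bar>y i - p i\<bar>"
      using y by (auto simp: b_def Q_def)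
    show "\<exists>b>0. \<forall>z\<in>euc n. (\<forall>i<n. \<bar>z i - y i\<bar> < b) \<longrightarrow> z \<in> Q"
    proof (intro exI[of _ b] conjI ballI impI b(1))
      fix z assume z: "z \<in> euc n" "\<forall>i<n. \<bar>z i - y i\<bar> < b"
      have "\<bar>z i - p i\<bar> < e" if "i < n" "i \<noteq> l" for i
        using b(2)[OF that] z(2) that(1) by (smt (verit))
      then show "z \<in> Q" using z by (simp add: Q_def)
    qed
  qed (auto simp: Q_def)
  have upd: "z(l := c) \<in> N" if "z \<in> Q" "\<bar>c - p l\<bar> \<le> e" for z c
    using that l by (intro e(2)) (auto simp: Q_def upd_euc intro: less_imp_le)
  have NV: "N \<subseteq> V" by (auto simp: N_def)
  have D: "((\<lambda>t. s * f (z(l := t))) has_real_derivative s * f' (z(l := c))) (at c)"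
    if "z \<in> Q" "\<bar>c - p l\<bar> \<le> e" for z c
    using DERIV_cmult[OF f'[of "z(l := c)"], of s] upd[OF that] NV by auto
  have mono: "s * f (z(l := a)) < s * f (z(l := b))" if "z \<in> Q" "a < b" "p l - e \<le> a" "b \<le> p l + e" for z a b
  proof (rule DERIV_pos_imp_increasing[OF that(2)])
    fix x assume "a \<le> x" "x \<le> b"
    then have x: "\<bar>x - p l\<bar> \<le> e" using that by auto
    show "\<exists>y. ((\<lambda>t. s * f (z(l := t))) has_real_derivative y) (at x) \<and> 0 < y"
      using D[OF that(1) x] upd[OF that(1) x] by (auto simp: N_def)
  qed
  have C: "Ck_on 0 n Q (\<lambda>z. s * f (z(l := c)))" if "\<bar>c - p l\<bar> \<le> e" for c
    by (rule Ck_on_mult[OF Ck_on_const], rule Ck_on_compose[OF Q V smooth_on_imp[OF f] Ck_on_upd[OF Ck_on_const]])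
      (use upd that NV in blast)
  have open_lt: "openin (Euclidean_space n) {z \<in> Q. s * f (z(l := c)) < s * z l}"
    "openin (Euclidean_space n) {z \<in> Q. s * z l < s * f (z(l := c))}" if "\<bar>c - p l\<bar> \<le> e" for c
  proof -
    have c: "Ck_on 0 n Q (\<lambda>z. s * z l)" by (rule Ck_on_mult[OF Ck_on_const Ck_on_coordinate])
    have "Ck_on 0 n Q (\<lambda>z. s * z l + - (s * f (z(l := c))))" "Ck_on 0 n Q (\<lambda>z. s * f (z(l := c)) + - (s * z l))"
      by (rule Ck_on_add[OF c Ck_on_neg[OF C[OF that]]], rule Ck_on_add[OF C[OF that] Ck_on_neg[OF c]])
    from this[THEN Ck_on_continuous, THEN openin_positive[OF Q]]
    show "openin (Euclidean_space n) {z \<in> Q. s * f (z(l := c)) < s * z l}"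
      "openin (Euclidean_space n) {z \<in> Q. s * z l < s * f (z(l := c))}" by simp_all
  qed
  define P where "P = {y \<in> euc n. \<forall>i<n. \<bar>y i - p i\<bar> < e}"
  have PQ: "P = {y \<in> Q. 0 < e + - (y l + - p l)} \<inter> {y \<in> Q. 0 < e + (y l + - p l)}"
    using l by (auto simp: P_def Q_def abs_less_iff)
  have P: "openin (Euclidean_space n) P" unfolding PQ
    by (intro openin_Int openin_positive[OF Q] Ck_on_continuous[where k = 0] Ck_on_add Ck_on_neg Ck_on_const Ck_on_coordinate)
  \<comment> \<open>The prescribed value \<open>z l\<close> lies strictly between the values of
    \<open>f\<close> at the two ends of the segment. This is an open condition and guarantees a
    solution in the interior.\<close>
  define W where "W = {z \<in> Q. s * f (z(l := p l - e)) < s * z l} \<inter> {z \<in> Q. s * z l < s * f (z(l := p l + e))}"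
  have W: "openin (Euclidean_space n) W" unfolding W_def using e(1) by (intro openin_Int open_lt) auto
  have "\<exists>a. p l - e < a \<and> a < p l + e \<and> s * f (z(l := a)) = s * z l" if z: "z \<in> W" for z
  proof -
    have zQ: "z \<in> Q" using z by (simp add: W_def)
    have "\<exists>a\<ge>p l - e. a \<le> p l + e \<and> s * f (z(l := a)) = s * z l"
    proof (rule IVT[where f = "\<lambda>t. s * f (z(l := t))"])
      show "\<forall>x. p l - e \<le> x \<and> x \<le> p l + e \<longrightarrow> isCont (\<lambda>t. s * f (z(l := t))) x"
      proof (intro allI impI)
        fix x assume "p l - e \<le> x \<and> x \<le> p l + e"
        then have "\<bar>x - p l\<bar> \<le> e" by auto
        from DERIV_isCont[OF D[OF zQ this]] show "isCont (\<lambda>t. s * f (z(l := t))) x" .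
      qed
    qed (use z e(1) in \<open>auto simp: W_def\<close>)
    then obtain a where a: "p l - e \<le> a" "a \<le> p l + e" "s * f (z(l := a)) = s * z l" by blast
    have "a \<noteq> p l - e" "a \<noteq> p l + e" using z a(3) by (auto simp: W_def)
    then show ?thesis using a by (intro exI[of _ a]) auto
  qed
  then have "\<forall>z. \<exists>a. z \<in> W \<longrightarrow> p l - e < a \<and> a < p l + e \<and> s * f (z(l := a)) = s * z l" by blast
  from choice[OF this] obtain \<xi> where *: "\<forall>z. z \<in> W \<longrightarrow> p l - e < \<xi> z \<and> \<xi> z < p l + e \<and> s * f (z(l := \<xi> z)) = s * z l" ..
  have \<xi>: "p l - e < \<xi> z" "\<xi> z < p l + e" "f (z(l := \<xi> z)) = z l" if "z \<in> W" for z
    using * that s(3) by auto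
  have \<eta>P: "z(l := \<xi> z) \<in> P" if z: "z \<in> W" for z
    using \<xi>(1,2)[OF z] z l by (auto simp: W_def Q_def P_def upd_euc)
  have PV: "P \<subseteq> V" using e(2) NV by (auto simp: P_def intro: less_imp_le)
  \<comment> \<open>Monotonicity turns a bound on \<open>\<xi> z\<close> into an inequality between
    continuous functions of \<open>z\<close>, whence \<open>\<xi>\<close> is upper and lower
    semicontinuous.\<close>
  have cmp: "\<xi> z < c \<longleftrightarrow> s * z l < s * f (z(l := c))" "c < \<xi> z \<longleftrightarrow> s * f (z(l := c)) < s * z l"
    if z: "z \<in> W" and c: "p l - e \<le> c" "c \<le> p l + e" for z c
  proof -
    have zQ: "z \<in> Q" using z by (simp add: W_def)
    consider "\<xi> z < c" | "\<xi> z = c" | "c < \<xi> z" by linarith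
    then have "(\<xi> z < c \<longleftrightarrow> s * z l < s * f (z(l := c))) \<and> (c < \<xi> z \<longleftrightarrow> s * f (z(l := c)) < s * z l)"
    proof cases
      case 1 then show ?thesis using mono[OF zQ 1] \<xi>[OF z] c by auto
    next
      case 2 then show ?thesis using \<xi>(3)[OF z] by auto
    next
      case 3 then show ?thesis using mono[OF zQ 3] \<xi>[OF z] c by auto
    qed
    then show "\<xi> z < c \<longleftrightarrow> s * z l < s * f (z(l := c))" "c < \<xi> z \<longleftrightarrow> s * f (z(l := c)) < s * z l" by auto
  qed
  have lt: "openin (Euclidean_space n) {z \<in> W. \<xi> z < c}" for c
  proof -
    consider "c < p l - e" | "p l - e \<le> c \<and> c \<le> p l + e" | "p l + e < c" by linarith
    then show ?thesis
    proof cases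
      case 1
      then have "{z \<in> W. \<xi> z < c} = {}" using \<xi>(1) by fastforce
      then show ?thesis by (simp only: openin_empty)
    next
      case 2
      then have "{z \<in> W. \<xi> z < c} = W \<inter> {z \<in> Q. s * z l < s * f (z(l := c))}"
        using cmp(1) by (auto simp: W_def)
      then show ?thesis using W open_lt(2)[of c] 2 by (auto intro!: openin_Int)
    next
      case 3
      then have "{z \<in> W. \<xi> z < c} = W" using \<xi>(2) by fastforce
      then show ?thesis using W by (simp only:)
    qed
  qed
  have gt: "openin (Euclidean_space n) {z \<in> W. \<xi> z > c}" for c
  proof -
    consider "c < p l - e" | "p l - e \<le> c \<and> c \<le> p l + e" | "p l + e < c" by linarith
    then show ?thesis
    proof cases
      case 3
      then have "{z \<in> W. \<xi> z > c} = {}" using \<xi>(2) by fastforce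
      then show ?thesis by (simp only: openin_empty)
    next
      case 2
      then have "{z \<in> W. \<xi> z > c} = W \<inter> {z \<in> Q. s * f (z(l := c)) < s * z l}"
        using cmp(2) by (auto simp: W_def)
      then show ?thesis using W open_lt(1)[of c] 2 by (auto intro!: openin_Int)
    next
      case 1
      then have "{z \<in> W. \<xi> z > c} = W" using \<xi>(1) by fastforce
      then show ?thesis using W by (simp only:)
    qed
  qed
  have cont: "continuous_map (subtopology (Euclidean_space n) W) euclideanreal \<xi>"
    unfolding continuous_map_upper_lower_semicontinuous_lt
    using lt gt openin_subset[OF W]
    by (auto simp: openin_open_subtopology[OF W] Int_absorb1 Collect_conj_eq[symmetric])
  show thesis
  proof (rule that[OF P _ PV W])
    show "p \<in> P" using pR e(1) by (simp add: P_def)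
    show "smooth_on n W \<xi>"
    proof (rule implicit_smooth[OF V l f f' W cont])
      show "z(l := \<xi> z) \<in> V \<and> f (z(l := \<xi> z)) = z l" if "z \<in> W" for z
        using \<eta>P[OF that] PV \<xi>(3)[OF that] by blast
      show "f' (z(l := \<xi> z)) \<noteq> 0" if "z \<in> W" for z
      proof -
        have "z(l := \<xi> z) \<in> N" using \<eta>P[OF that] by (auto simp: P_def intro!: e(2) less_imp_le)
        then show ?thesis by (auto simp: N_def)
      qed
    qed
    show "\<forall>z\<in>W. z(l := \<xi> z) \<in> P \<and> f (z(l := \<xi> z)) = z l"
      using \<eta>P \<xi>(3) by blast
    show "\<forall>y\<in>P. y(l := f y) \<in> W \<and> \<xi> (y(l := f y)) = y l"
    proof
      fix y assume y: "y \<in> P"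
      have yQ: "y \<in> Q" and yl: "\<bar>y l - p l\<bar> < e" using y l by (auto simp: P_def Q_def)
      have "y(l := f y) \<in> Q" using yQ l by (auto simp: Q_def upd_euc)
      moreover have "s * f (y(l := p l - e)) < s * f (y(l := y l))" "s * f (y(l := y l)) < s * f (y(l := p l + e))"
        by (rule mono[OF yQ]; use yl in linarith)+
      ultimately have w: "y(l := f y) \<in> W" by (simp add: W_def)
      have "\<not> \<xi> (y(l := f y)) < y l" "\<not> y l < \<xi> (y(l := f y))"
        using cmp[OF w, of "y l"] yl by auto
      with w show "y(l := f y) \<in> W \<and> \<xi> (y(l := f y)) = y l" by auto
    qed
  qed
qed

text \<open>
  Replacing the coordinates \<open>x 0, \<dots>, x (k - 1)\<close> one after the other by components of \<open>F\<close>. If all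
  components had vanishing \<open>k\<close>-th partial derivative in the coordinates obtained so far, then \<open>F\<close>
  would be constant along the \<open>k\<close>-th coordinate line.
\<close>

lemma injective_smooth_partial_left_inverse:
  fixes F :: "(nat \<Rightarrow> real) \<Rightarrow> nat \<Rightarrow> real"
  assumes U: "openin (Euclidean_space n) U" "U \<noteq> {}"
    and F: "\<forall>j<m. smooth_on n U (\<lambda>x. F x j)"
    and inj: "\<forall>x\<in>U. \<forall>y\<in>U. (\<forall>j<m. F x j = F y j) \<longrightarrow> x = y"
    and k: "k \<le> n"
  shows "\<exists>U' V J \<eta>. openin (Euclidean_space n) U' \<and> U' \<subseteq> U \<and> U' \<noteq> {} \<and> openin (Euclidean_space n) V \<and>
    (\<forall>i<k. J i < m) \<and> (\<forall>i<n. smooth_on n V (\<lambda>y. \<eta> y i)) \<and>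
    (\<forall>x\<in>U'. (\<lambda>i. if i < k then F x (J i) else x i) \<in> V \<and> \<eta> (\<lambda>i. if i < k then F x (J i) else x i) = x) \<and>
    (\<forall>y\<in>V. \<eta> y \<in> U' \<and> (\<lambda>i. if i < k then F (\<eta> y) (J i) else \<eta> y i) = y)"
  using k
proof (induction k)
  case 0
  show ?case
    by (rule exI[of _ U], rule exI[of _ U], rule exI[of _ "\<lambda>_. 0"], rule exI[of _ "\<lambda>y. y"])
      (use U in \<open>auto simp: smooth_on_coordinate\<close>)
next
  case (Suc k)
  then have k: "k < n" by simp
  define H where "H J x = (\<lambda>i. if i < k then F x (J i) else x i)" for J :: "nat \<Rightarrow> nat" and x
  obtain U' V J \<eta> where *: "openin (Euclidean_space n) U' \<and> U' \<subseteq> U \<and> U' \<noteq> {} \<and> openin (Euclidean_space n) V \<and>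
    (\<forall>i<k. J i < m) \<and> (\<forall>i<n. smooth_on n V (\<lambda>y. \<eta> y i)) \<and>
    (\<forall>x\<in>U'. H J x \<in> V \<and> \<eta> (H J x) = x) \<and> (\<forall>y\<in>V. \<eta> y \<in> U' \<and> H J (\<eta> y) = y)"
    using Suc.IH[OF Suc_leD[OF Suc.prems]] unfolding H_def by (elim exE)
  then have U': "openin (Euclidean_space n) U'" "U' \<subseteq> U" "U' \<noteq> {}"
    and V: "openin (Euclidean_space n) V" by auto
  have J: "J i < m" if "i < k" for i using * that by blast
  have \<eta>s: "smooth_on n V (\<lambda>y. \<eta> y i)" if "i < n" for i using * that by blast
  have H: "H J x \<in> V" "\<eta> (H J x) = x" if "x \<in> U'" for x using * that by blast+
  have \<eta>: "\<eta> y \<in> U'" "H J (\<eta> y) = y" if "y \<in> V" for y using * that by blast+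
  have g: "smooth_on n V (\<lambda>y. F (\<eta> y) j)" if "j < m" for j
    by (rule smooth_on_compose[OF V U(1) F[rule_format, OF that] \<eta>s]) (use \<eta>(1) U'(2) in auto)
  have "\<exists>j<m. \<exists>p\<in>V. \<exists>d. ((\<lambda>t. F (\<eta> (p(k := t))) j) has_real_derivative d) (at (p k)) \<and> d \<noteq> 0"
  proof (rule ccontr)
    assume neg: "\<not> ?thesis"
    have zero: "((\<lambda>t. F (\<eta> (p(k := t))) j) has_real_derivative 0) (at (p k))" if jp: "j < m" "p \<in> V" for j p
    proof -
      obtain g' where "\<forall>x\<in>V. ((\<lambda>t. F (\<eta> (x(k := t))) j) has_real_derivative g' x) (at (x k))"
        using smooth_on_partial[OF V g[OF jp(1)] k] by blast
      then have "((\<lambda>t. F (\<eta> (p(k := t))) j) has_real_derivative g' p) (at (p k))" using jp(2) by blast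
      moreover from this have "g' p = 0" using neg jp by blast
      ultimately show ?thesis by simp
    qed
    obtain p where p: "p \<in> V" using U'(3) H(1) by blast
    obtain e where e: "e > 0" "\<And>y. y \<in> euc n \<Longrightarrow> (\<And>i. i < n \<Longrightarrow> \<bar>y i - p i\<bar> < e) \<Longrightarrow> y \<in> V"
      using open_box[OF V p] by metis
    have pV: "p(k := c) \<in> V" if "\<bar>c - p k\<bar> < e" for c
      using that p V k openin_Euclidean_subset[OF V p] e(1) by (intro e(2)) (auto simp: upd_euc)
    \<comment> \<open>A second point of the coordinate line inside the box. Equal values of
      \<open>F\<close> at both points contradict injectivity.\<close>
    define c where "c = p k + e / 2"
    have "F (\<eta> (p(k := p k))) j = F (\<eta> (p(k := c))) j" if j: "j < m" for j
    proof -
      have D: "((\<lambda>t. F (\<eta> (p(k := t))) j) has_real_derivative 0) (at t)" if "p k \<le> t" "t \<le> c" for t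
        using zero[OF j pV[of t]] that e(1) by (simp add: c_def)
      have "p k < c" using e(1) by (simp add: c_def)
      from MVT2[OF this D] show ?thesis by auto
    qed
    then have "\<eta> (p(k := p k)) = \<eta> (p(k := c))"
      using \<eta>(1)[OF pV[of c]] \<eta>(1)[OF p] U'(2) e(1) by (intro inj[rule_format]) (auto simp: c_def)
    moreover have "p(k := c) \<in> V" using e(1) by (intro pV) (simp add: c_def)
    ultimately have "p = p(k := c)" using \<eta>(2)[OF p] \<eta>(2)[of "p(k := c)"] by (metis fun_upd_triv)
    then have "p k = c" by (metis fun_upd_same)
    then show False using e(1) by (simp add: c_def)
  qed
  then obtain j p d where j: "j < m" and p: "p \<in> V"
    and d: "((\<lambda>t. F (\<eta> (p(k := t))) j) has_real_derivative d) (at (p k))" "d \<noteq> 0" by blast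
  \<comment> \<open>The component \<open>j\<close> of \<open>F\<close>, expressed in the coordinates
    already obtained, becomes the new coordinate \<open>k\<close>; all other coordinates stay as
    they are.\<close>
  from straighten[OF V g[OF j] k p d] obtain P W \<xi> where
    P: "openin (Euclidean_space n) P" "p \<in> P" "P \<subseteq> V" and W: "openin (Euclidean_space n) W"
    and \<xi>': "smooth_on n W \<xi>" "\<forall>z\<in>W. z(k := \<xi> z) \<in> P \<and> F (\<eta> (z(k := \<xi> z))) j = z k"
    "\<forall>y\<in>P. y(k := F (\<eta> y) j) \<in> W \<and> \<xi> (y(k := F (\<eta> y) j)) = y k" .
  note \<xi> = \<xi>'(1) \<xi>'(2,3)[rule_format]
  define U1 where "U1 = {x \<in> U'. H J x \<in> P}"
  define \<eta>1 where "\<eta>1 z = \<eta> (z(k := \<xi> z))" for z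
  have eq: "(\<lambda>i. if i < Suc k then F x ((J(k := j)) i) else x i) = (H J x)(k := F x j)" for x
    by (auto simp: H_def fun_eq_iff)
  have U1: "openin (Euclidean_space n) U1"
  proof -
    have "continuous_map (subtopology (Euclidean_space n) U') (subtopology (Euclidean_space n) V) (H J)"
    proof (rule continuous_map_into_Euclidean)
      fix i assume "i < n"
      show "continuous_map (subtopology (Euclidean_space n) U') euclideanreal (\<lambda>x. H J x i)"
        using smooth_on_continuous[OF smooth_on_mono[OF F[rule_format, OF J] U'(2)]]
          smooth_on_continuous[OF smooth_on_coordinate]
        by (cases "i < k") (auto simp: H_def)
    qed (use H(1) openin_subset[OF V] in auto)
    from openin_continuous_map_preimage[OF this, of P]
    have "openin (subtopology (Euclidean_space n) U') {x \<in> topspace (subtopology (Euclidean_space n) U'). H J x \<in> P}"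
      using P V openin_open_subtopology by blast
    then show ?thesis unfolding U1_def
      using openin_open_subtopology[OF U'(1)] openin_subset[OF U'(1)] by (simp add: inf.absorb2)
  qed
  show ?case
  proof (rule exI[of _ U1], rule exI[of _ W], rule exI[of _ "J(k := j)"], rule exI[of _ \<eta>1], unfold eq, intro conjI allI ballI impI)
    show "openin (Euclidean_space n) U1" "openin (Euclidean_space n) W" by fact+
    show "U1 \<subseteq> U" using U'(2) by (auto simp: U1_def)
    show "U1 \<noteq> {}" using P \<eta> by (auto simp: U1_def intro!: exI[of _ "\<eta> p"])
    show "(J(k := j)) i < m" if "i < Suc k" for i using that J j by (auto simp: less_Suc_eq)
    show "smooth_on n W (\<lambda>y. \<eta>1 y i)" if "i < n" for i
      unfolding \<eta>1_def
    proof (rule smooth_on_compose[OF W V \<eta>s[OF that]])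
      show "smooth_on n W (\<lambda>x. (x(k := \<xi> x)) a)" for a
        using Ck_on_upd \<xi>(1) by (auto simp: smooth_on_def)
    qed (use \<xi>(2) P(3) in blast)
    show "(H J x)(k := F x j) \<in> W" "\<eta>1 ((H J x)(k := F x j)) = x" if "x \<in> U1" for x
      using \<xi>(3)[of "H J x"] that H(2)[of x] by (auto simp: U1_def \<eta>1_def)
    show "\<eta>1 z \<in> U1" "(H J (\<eta>1 z))(k := F (\<eta>1 z) j) = z" if "z \<in> W" for z
      using \<xi>(2)[OF that] \<eta>[of "z(k := \<xi> z)"] P(3) by (auto simp: U1_def \<eta>1_def)
  qed
qed

text \<open>Once all \<open>n\<close> coordinates are replaced, the remaining ones being zero, the
  new coordinates are components of \<open>F\<close> alone, so \<open>\<eta>\<close> recovers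
  \<open>x\<close> from \<open>F x\<close>.\<close>

lemma injective_smooth_left_inverse:
  fixes F :: "(nat \<Rightarrow> real) \<Rightarrow> nat \<Rightarrow> real"
  assumes U: "openin (Euclidean_space n) U" "U \<noteq> {}"
    and F: "\<forall>j<m. smooth_on n U (\<lambda>x. F x j)"
    and inj: "\<forall>x\<in>U. \<forall>y\<in>U. (\<forall>j<m. F x j = F y j) \<longrightarrow> x = y"
  obtains U' V J \<eta> where "openin (Euclidean_space n) U'" "U' \<subseteq> U" "U' \<noteq> {}" "openin (Euclidean_space n) V"
    "\<forall>i<n. J i < m" "\<forall>i<n. smooth_on n V (\<lambda>y. \<eta> y i)"
    "\<forall>x\<in>U'. (\<lambda>i. if i < n then F x (J i) else 0) \<in> V \<and> \<eta> (\<lambda>i. if i < n then F x (J i) else 0) = x"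
proof -
  obtain U' V J \<eta> where *: "openin (Euclidean_space n) U' \<and> U' \<subseteq> U \<and> U' \<noteq> {} \<and> openin (Euclidean_space n) V \<and>
    (\<forall>i<n. J i < m) \<and> (\<forall>i<n. smooth_on n V (\<lambda>y. \<eta> y i)) \<and>
    (\<forall>x\<in>U'. (\<lambda>i. if i < n then F x (J i) else x i) \<in> V \<and> \<eta> (\<lambda>i. if i < n then F x (J i) else x i) = x) \<and>
    (\<forall>y\<in>V. \<eta> y \<in> U' \<and> (\<lambda>i. if i < n then F (\<eta> y) (J i) else \<eta> y i) = y)"
    using injective_smooth_partial_left_inverse[where F = F and m = m, OF U F inj order_refl] by (elim exE)
  have eq: "(\<lambda>i. if i < n then F x (J i) else x i) = (\<lambda>i. if i < n then F x (J i) else 0)" if "x \<in> U'" for x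
    using openin_Euclidean_subset[of n U' x] * that by (auto simp: mem_euc fun_eq_iff)
  show thesis
    by (rule that[of U' V J \<eta>]) (use * eq in simp_all)
qed

section \<open>Smooth maps between manifolds\<close>

text \<open>The part of \<open>smooth_manifold\<close> on which locality and composition of
  smoothness rest. For products and transported structures it is available before compatibility of
  charts, which is then derived from smooth maps.\<close>

definition charted :: "'x manifold \<Rightarrow> bool" where
  "charted M \<longleftrightarrow> (\<forall>c\<in>atlas M. is_chart (mtop M) (mdim M) c) \<and>
     (\<Union>(U, \<phi>)\<in>atlas M. U) = topspace (mtop M)"

text \<open>\<open>W\<close> may be any set, also one that sticks out of the space, such as a
  preimage under a total function.\<close>

definition smooth_fun :: "'x manifold \<Rightarrow> 'x set \<Rightarrow> ('x \<Rightarrow> real) \<Rightarrow> bool" where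
  "smooth_fun M W h \<longleftrightarrow>
     (\<forall>(U, \<phi>)\<in>atlas M. smooth_on (mdim M) (\<phi> ` (U \<inter> W)) (\<lambda>p. h (inv_into U \<phi> p)))"

lemma smooth_manifold_charted: "smooth_manifold M \<Longrightarrow> charted M"
  by (simp add: smooth_manifold_def charted_def)

lemma is_chartD:
  assumes "is_chart X n (U, \<phi>)"
  shows "openin X U" "inj_on \<phi> U" "openin (Euclidean_space n) (\<phi> ` U)"
    "homeomorphic_map (subtopology X U) (subtopology (Euclidean_space n) (\<phi> ` U)) \<phi>"
    "topspace (subtopology X U) = U"
proof -
  show *: "openin X U" "openin (Euclidean_space n) (\<phi> ` U)"
    "homeomorphic_map (subtopology X U) (subtopology (Euclidean_space n) (\<phi> ` U)) \<phi>"
    using assms by (auto simp: is_chart_def)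
  show t: "topspace (subtopology X U) = U" using openin_subset[OF *(1)] by auto
  show "inj_on \<phi> U" using homeomorphic_imp_injective_map[OF *(3)] t by simp
qed

lemma is_chart_open_image:
  assumes "is_chart X n (U, \<phi>)" "openin X W"
  shows "openin (Euclidean_space n) (\<phi> ` (U \<inter> W))"
proof -
  note c = is_chartD[OF assms(1)]
  have "openin (subtopology X U) (U \<inter> W)" using assms(2) by (auto simp: openin_subtopology)
  then have "openin (subtopology (Euclidean_space n) (\<phi> ` U)) (\<phi> ` (U \<inter> W))"
    using homeomorphic_imp_open_map[OF c(4)] by (auto simp: open_map_def)
  then show ?thesis using openin_trans_full[OF _ c(3)] by blast
qed

lemma is_chart_continuous:
  assumes "is_chart X n (U, \<phi>)"
  shows "continuous_map (subtopology X U) (Euclidean_space n) \<phi>"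
    "continuous_map (subtopology (Euclidean_space n) (\<phi> ` U)) X (inv_into U \<phi>)"
proof -
  note c = is_chartD[OF assms]
  show "continuous_map (subtopology X U) (Euclidean_space n) \<phi>"
    using homeomorphic_imp_continuous_map[OF c(4)] by (simp add: continuous_map_in_subtopology)
  obtain g where g: "homeomorphic_maps (subtopology X U) (subtopology (Euclidean_space n) (\<phi> ` U)) \<phi> g"
    using c(4) homeomorphic_map_maps by blast
  have "continuous_map (subtopology (Euclidean_space n) (\<phi> ` U)) X g"
    using g by (auto simp: homeomorphic_maps_def continuous_map_in_subtopology)
  moreover have "g p = inv_into U \<phi> p" if "p \<in> \<phi> ` U" for p
    using g that c(2,5) by (auto simp: homeomorphic_maps_def)
  ultimately show "continuous_map (subtopology (Euclidean_space n) (\<phi> ` U)) X (inv_into U \<phi>)"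
    using openin_subset[OF c(3)] by (auto intro: continuous_map_eq)
qed

lemma is_chart_open_preimage:
  assumes "is_chart X n (U, \<phi>)" "openin (Euclidean_space n) V"
  shows "openin X {x \<in> U. \<phi> x \<in> V}"
  using openin_continuous_map_preimage[OF is_chart_continuous(1)[OF assms(1)] assms(2)]
    openin_open_subtopology[OF is_chartD(1)[OF assms(1)]]
  unfolding is_chartD(5)[OF assms(1)] by blast

lemma is_chartI:
  assumes "openin X U" "openin (Euclidean_space n) V"
    "continuous_map (subtopology X U) (subtopology (Euclidean_space n) V) \<phi>"
    "continuous_map (subtopology (Euclidean_space n) V) (subtopology X U) g"
    "\<And>x. x \<in> U \<Longrightarrow> g (\<phi> x) = x" "\<And>p. p \<in> V \<Longrightarrow> \<phi> (g p) = p"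
  shows "is_chart X n (U, \<phi>)" "\<And>p. p \<in> V \<Longrightarrow> inv_into U \<phi> p = g p"
proof -
  have h: "homeomorphic_maps (subtopology X U) (subtopology (Euclidean_space n) V) \<phi> g"
    using assms by (auto simp: homeomorphic_maps_def)
  have t: "topspace (subtopology X U) = U" "topspace (subtopology (Euclidean_space n) V) = V"
    using openin_subset[OF assms(1)] openin_subset[OF assms(2)] by auto
  have gV: "g p \<in> U" if "p \<in> V" for p
    using continuous_map_image_subset_topspace[OF assms(4)] that t by blast
  have im: "\<phi> ` U = V"
    using homeomorphic_imp_surjective_map[OF homeomorphic_maps_imp_map[OF h]] t by simp
  show "is_chart X n (U, \<phi>)"
    using assms(1,2) homeomorphic_maps_imp_map[OF h] by (simp add: is_chart_def im)
  have "inj_on \<phi> U" by (rule inj_on_inverseI) (erule assms(5))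
  then show "inv_into U \<phi> p = g p" if "p \<in> V" for p
    using inv_into_f_f[of \<phi> U "g p"] gV[OF that] assms(6)[OF that] by simp
qed

lemma charted_chart:
  assumes "charted M" "(U, \<phi>) \<in> atlas M"
  shows "is_chart (mtop M) (mdim M) (U, \<phi>)" "openin (mtop M) U" "inj_on \<phi> U" "U \<subseteq> topspace (mtop M)"
proof -
  show *: "is_chart (mtop M) (mdim M) (U, \<phi>)" using assms by (auto simp: charted_def)
  show "openin (mtop M) U" "inj_on \<phi> U" using is_chartD[OF *] by auto
  then show "U \<subseteq> topspace (mtop M)" using openin_subset by blast
qed

lemma charted_cover:
  assumes "charted M" "x \<in> topspace (mtop M)"
  obtains U \<phi> where "(U, \<phi>) \<in> atlas M" "x \<in> U"
proof -
  have "x \<in> (\<Union>(U, \<phi>)\<in>atlas M. U)" using assms unfolding charted_def by blast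
  then show thesis by (auto intro: that)
qed

lemma smooth_funD:
  "smooth_fun M W h \<Longrightarrow> (U, \<phi>) \<in> atlas M \<Longrightarrow> smooth_on (mdim M) (\<phi> ` (U \<inter> W)) (\<lambda>p. h (inv_into U \<phi> p))"
  by (auto simp: smooth_fun_def)

lemma smooth_fun_mono: "smooth_fun M W h \<Longrightarrow> W' \<subseteq> W \<Longrightarrow> smooth_fun M W' h"
  by (auto simp: smooth_fun_def intro!: smooth_on_mono[OF smooth_funD])

text \<open>Chart domains lie inside the space, so they cut off whatever part of \<open>W\<close>
  lies outside.\<close>

lemma smooth_fun_Int_topspace:
  assumes "charted M" "smooth_fun M (W \<inter> topspace (mtop M)) h"
  shows "smooth_fun M W h"
  unfolding smooth_fun_def
proof safe
  fix U \<phi> assume U: "(U, \<phi>) \<in> atlas M"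
  then have "U \<inter> (W \<inter> topspace (mtop M)) = U \<inter> W" using charted_chart(4)[OF assms(1)] by blast
  then show "smooth_on (mdim M) (\<phi> ` (U \<inter> W)) (\<lambda>p. h (inv_into U \<phi> p))"
    using smooth_funD[OF assms(2) U] by simp
qed

lemma smooth_fun_cong:
  assumes M: "charted M" and W: "openin (mtop M) W" and eq: "\<And>x. x \<in> W \<Longrightarrow> h x = h' x"
  shows "smooth_fun M W h \<longleftrightarrow> smooth_fun M W h'"
proof -
  have "smooth_on (mdim M) (\<phi> ` (U \<inter> W)) (\<lambda>p. h (inv_into U \<phi> p)) \<longleftrightarrow>
        smooth_on (mdim M) (\<phi> ` (U \<inter> W)) (\<lambda>p. h' (inv_into U \<phi> p))" if "(U, \<phi>) \<in> atlas M" for U \<phi>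
  proof (rule smooth_on_cong)
    note c = charted_chart[OF M that]
    show "openin (Euclidean_space (mdim M)) (\<phi> ` (U \<inter> W))" by (rule is_chart_open_image[OF c(1) W])
    show "h (inv_into U \<phi> p) = h' (inv_into U \<phi> p)" if "p \<in> \<phi> ` (U \<inter> W)" for p
      using that c(3) by (auto intro!: eq)
  qed
  then show ?thesis unfolding smooth_fun_def by blast
qed

lemma smooth_fun_local:
  assumes M: "charted M"
    and loc: "\<And>x. x \<in> W \<Longrightarrow> \<exists>W'. openin (mtop M) W' \<and> x \<in> W' \<and> W' \<subseteq> W \<and> smooth_fun M W' h"
  shows "smooth_fun M W h"
  unfolding smooth_fun_def
proof safe
  fix U \<phi> assume U: "(U, \<phi>) \<in> atlas M"
  show "smooth_on (mdim M) (\<phi> ` (U \<inter> W)) (\<lambda>p. h (inv_into U \<phi> p))"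
  proof (rule smooth_on_local)
    fix p assume "p \<in> \<phi> ` (U \<inter> W)"
    then obtain x where x: "x \<in> U" "x \<in> W" "p = \<phi> x" by blast
    from loc[OF x(2)] obtain W' where W': "openin (mtop M) W'" "x \<in> W'" "W' \<subseteq> W" "smooth_fun M W' h" by blast
    show "\<exists>Q. openin (Euclidean_space (mdim M)) Q \<and> p \<in> Q \<and> Q \<subseteq> \<phi> ` (U \<inter> W) \<and>
        smooth_on (mdim M) Q (\<lambda>p. h (inv_into U \<phi> p))"
      by (rule exI[of _ "\<phi> ` (U \<inter> W')"])
        (use W' x smooth_funD[OF W'(4) U] is_chart_open_image[OF charted_chart(1)[OF M U] W'(1)] in auto)
  qed
qed

lemma smooth_fun_compose:
  assumes M: "charted M" and W: "openin (mtop M) W" and V: "openin (Euclidean_space m) V"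
    and h: "smooth_on m V h" and G: "\<And>j. j < m \<Longrightarrow> smooth_fun M W (\<lambda>x. G x j)" and GV: "\<And>x. x \<in> W \<Longrightarrow> G x \<in> V"
  shows "smooth_fun M W (\<lambda>x. h (G x))"
  unfolding smooth_fun_def
proof safe
  fix U \<phi> assume U: "(U, \<phi>) \<in> atlas M"
  note c = charted_chart[OF M U]
  show "smooth_on (mdim M) (\<phi> ` (U \<inter> W)) (\<lambda>p. h (G (inv_into U \<phi> p)))"
  proof (rule smooth_on_compose[OF is_chart_open_image[OF c(1) W] V h])
    show "smooth_on (mdim M) (\<phi> ` (U \<inter> W)) (\<lambda>p. G (inv_into U \<phi> p) j)" if "j < m" for j
      using smooth_funD[OF G[OF that] U] .
    show "G (inv_into U \<phi> p) \<in> V" if "p \<in> \<phi> ` (U \<inter> W)" for p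
      using that c(3) by (auto intro!: GV)
  qed
qed

lemma smooth_map_iff:
  "smooth_map M N f \<longleftrightarrow> continuous_map (mtop M) (mtop N) f \<and>
     (\<forall>(V, \<psi>)\<in>atlas N. \<forall>j<mdim N. smooth_fun M (f -` V) (\<lambda>x. \<psi> (f x) j))"
  unfolding smooth_map_def smooth_fun_def by fast

lemma smooth_map_continuous: "smooth_map M N f \<Longrightarrow> continuous_map (mtop M) (mtop N) f"
  by (simp add: smooth_map_def)

lemma smooth_map_mem: "smooth_map M N f \<Longrightarrow> x \<in> topspace (mtop M) \<Longrightarrow> f x \<in> topspace (mtop N)"
  using continuous_map_image_subset_topspace[OF smooth_map_continuous] by blast

lemma smooth_map_chart:
  "smooth_map M N f \<Longrightarrow> (V, \<psi>) \<in> atlas N \<Longrightarrow> j < mdim N \<Longrightarrow> smooth_fun M (f -` V) (\<lambda>x. \<psi> (f x) j)"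
  unfolding smooth_map_iff by blast

text \<open>This is the compatibility of charts, read as a property of the coordinate
  functions.\<close>

lemma smooth_fun_coordinate:
  assumes "smooth_manifold M" "(U, \<phi>) \<in> atlas M" "j < mdim M"
  shows "smooth_fun M U (\<lambda>x. \<phi> x j)"
  using assms unfolding smooth_fun_def smooth_manifold_def by fast

lemma openin_preimage:
  "smooth_map M N f \<Longrightarrow> openin (mtop N) V \<Longrightarrow> openin (mtop M) {x \<in> topspace (mtop M). f x \<in> V}"
  using openin_continuous_map_preimage smooth_map_continuous by blast

text \<open>Near each point the composite factors through a chart of \<open>N\<close>: it is
  \<open>h\<close> read in that chart, applied to the coordinates of \<open>f\<close>. Composition
  of smooth maps follows from it.\<close>

lemma smooth_fun_pullback:
  assumes M: "charted M" and N: "charted N" and f: "smooth_map M N f"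
    and V: "openin (mtop N) V" and h: "smooth_fun N V h"
  shows "smooth_fun M {x \<in> topspace (mtop M). f x \<in> V} (\<lambda>x. h (f x))"
proof (rule smooth_fun_local[OF M])
  fix x assume x: "x \<in> {x \<in> topspace (mtop M). f x \<in> V}"
  then obtain U \<psi> where U: "(U, \<psi>) \<in> atlas N" "f x \<in> U"
    using charted_cover[OF N smooth_map_mem[OF f]] by blast
  note c = charted_chart[OF N U(1)]
  define W where "W = {x \<in> topspace (mtop M). f x \<in> U \<inter> V}"
  have W: "openin (mtop M) W" unfolding W_def
    by (rule openin_preimage[OF f openin_Int[OF c(2) V]])
  have "smooth_fun M W (\<lambda>x. (\<lambda>p. h (inv_into U \<psi> p)) (\<psi> (f x)))"
  proof (rule smooth_fun_compose[OF M W is_chart_open_image[OF c(1) V] smooth_funD[OF h U(1)]])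
    show "smooth_fun M W (\<lambda>x. \<psi> (f x) j)" if "j < mdim N" for j
      by (rule smooth_fun_mono[OF smooth_map_chart[OF f U(1) that]]) (auto simp: W_def)
  qed (auto simp: W_def)
  then have "smooth_fun M W (\<lambda>x. h (f x))"
    by (subst smooth_fun_cong[OF M W, of _ "\<lambda>x. h (inv_into U \<psi> (\<psi> (f x)))"])
      (use c(3) in \<open>auto simp: W_def\<close>)
  with W x U(2) show "\<exists>W'. openin (mtop M) W' \<and> x \<in> W' \<and> W' \<subseteq> {x \<in> topspace (mtop M). f x \<in> V} \<and>
      smooth_fun M W' (\<lambda>x. h (f x))"
    by (intro exI[of _ W]) (auto simp: W_def)
qed

lemma smooth_map_compose:
  assumes M: "charted M" and N: "charted N" and P: "charted P"
    and f: "smooth_map M N f" and g: "smooth_map N P g"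
  shows "smooth_map M P (\<lambda>x. g (f x))"
  unfolding smooth_map_iff
proof safe
  show "continuous_map (mtop M) (mtop P) (\<lambda>x. g (f x))"
    using continuous_map_compose[OF smooth_map_continuous[OF f] smooth_map_continuous[OF g]] by (simp add: o_def)
  fix V \<psi> j assume V: "(V, \<psi>) \<in> atlas P" and j: "j < mdim P"
  have o: "openin (mtop N) {y \<in> topspace (mtop N). g y \<in> V}"
    by (rule openin_preimage[OF g charted_chart(2)[OF P V]])
  have "smooth_fun N {y \<in> topspace (mtop N). g y \<in> V} (\<lambda>y. \<psi> (g y) j)"
    by (rule smooth_fun_mono[OF smooth_map_chart[OF g V j]]) auto
  from smooth_fun_pullback[OF M N f o this]
  have "smooth_fun M ((\<lambda>x. g (f x)) -` V \<inter> topspace (mtop M)) (\<lambda>x. \<psi> (g (f x)) j)"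
    by (rule smooth_fun_mono) (use smooth_map_mem[OF f] in auto)
  then show "smooth_fun M ((\<lambda>x. g (f x)) -` V) (\<lambda>x. \<psi> (g (f x)) j)"
    by (rule smooth_fun_Int_topspace[OF M])
qed

lemma smooth_map_cong:
  assumes M: "charted M" and N: "charted N" and f: "smooth_map M N f"
    and eq: "\<And>x. x \<in> topspace (mtop M) \<Longrightarrow> f x = g x"
  shows "smooth_map M N g"
  unfolding smooth_map_iff
proof safe
  show "continuous_map (mtop M) (mtop N) g"
    using continuous_map_eq[OF smooth_map_continuous[OF f]] eq by blast
  fix V \<psi> j assume V: "(V, \<psi>) \<in> atlas N" and j: "j < mdim N"
  have o: "openin (mtop M) {x \<in> topspace (mtop M). f x \<in> V}"
    by (rule openin_preimage[OF f charted_chart(2)[OF N V]])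
  have "smooth_fun M {x \<in> topspace (mtop M). f x \<in> V} (\<lambda>x. \<psi> (f x) j)"
    by (rule smooth_fun_mono[OF smooth_map_chart[OF f V j]]) auto
  then have "smooth_fun M {x \<in> topspace (mtop M). f x \<in> V} (\<lambda>x. \<psi> (g x) j)"
    by (subst smooth_fun_cong[OF M o, of _ "\<lambda>x. \<psi> (f x) j"]) (auto simp: eq)
  then show "smooth_fun M (g -` V) (\<lambda>x. \<psi> (g x) j)"
    by (rule smooth_fun_Int_topspace[OF M smooth_fun_mono]) (auto simp: eq)
qed

lemma smooth_map_id: "smooth_manifold M \<Longrightarrow> smooth_map M M (\<lambda>x. x)"
  unfolding smooth_map_iff by (auto simp: smooth_fun_coordinate)

lemma smooth_map_const: "c \<in> topspace (mtop N) \<Longrightarrow> smooth_map M N (\<lambda>_. c)"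
  unfolding smooth_map_iff smooth_fun_def by (auto simp: smooth_on_const)

section \<open>Products, powers and transported manifolds\<close>

lemma mdim_prod_manifold [simp]: "mdim (prod_manifold M N) = mdim M + mdim N"
  and mtop_prod_manifold [simp]: "mtop (prod_manifold M N) = prod_topology (mtop M) (mtop N)"
  by (simp_all add: prod_manifold_def)

lemma atlas_prod_manifold:
  "c \<in> atlas (prod_manifold M N) \<longleftrightarrow> (\<exists>U \<phi> V \<psi>. (U, \<phi>) \<in> atlas M \<and> (V, \<psi>) \<in> atlas N \<and>
     c = (U \<times> V, \<lambda>(x, y) k. if k < mdim M then \<phi> x k else \<psi> y (k - mdim M)))"
  by (auto simp: prod_manifold_def)

lemma continuous_map_Euclidean_reindex:
  assumes "\<And>k. k < m \<Longrightarrow> a k < n"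
  shows "continuous_map (Euclidean_space n) (Euclidean_space m) (\<lambda>p k. if k < m then p (a k) else 0)"
  using assms by (simp add: continuous_map_componentwise_Euclidean_space continuous_map_coordinate)

definition left_coords :: "nat \<Rightarrow> (nat \<Rightarrow> real) \<Rightarrow> nat \<Rightarrow> real" where
  "left_coords m p = (\<lambda>k. if k < m then p k else 0)"

definition right_coords :: "nat \<Rightarrow> nat \<Rightarrow> (nat \<Rightarrow> real) \<Rightarrow> nat \<Rightarrow> real" where
  "right_coords m n p = (\<lambda>k. if k < n then p (m + k) else 0)"

text \<open>The image is described by conditions on the two halves of the coordinates, so that its
  openness and the continuity of the inverse both come from the projections to these halves.\<close>

lemma prod_chart:
  assumes U: "is_chart X m (U, \<phi>)" and V: "is_chart Y n (V, \<psi>)"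
  defines "\<eta> \<equiv> \<lambda>(x, y) k. if k < m then \<phi> x k else \<psi> y (k - m)"
  shows "is_chart (prod_topology X Y) (m + n) (U \<times> V, \<eta>)"
proof -
  define Q where "Q = {p \<in> euc (m + n). left_coords m p \<in> \<phi> ` U \<and> right_coords m n p \<in> \<psi> ` V}"
  note u = is_chartD[OF U] and v = is_chartD[OF V]
  have l: "continuous_map (Euclidean_space (m + n)) (Euclidean_space m) (left_coords m)"
    unfolding left_coords_def[abs_def] by (rule continuous_map_Euclidean_reindex) simp
  have r: "continuous_map (Euclidean_space (m + n)) (Euclidean_space n) (right_coords m n)"
    unfolding right_coords_def[abs_def] by (rule continuous_map_Euclidean_reindex) simp
  have "Q = {p \<in> euc (m + n). left_coords m p \<in> \<phi> ` U} \<inter> {p \<in> euc (m + n). right_coords m n p \<in> \<psi> ` V}"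
    by (auto simp: Q_def)
  then have Q: "openin (Euclidean_space (m + n)) Q"
    using openin_continuous_map_preimage[OF l u(3)] openin_continuous_map_preimage[OF r v(3)]
    by (simp add: openin_Int)
  have UV: "openin (prod_topology X Y) (U \<times> V)" using u v by (simp add: openin_prod_Times_iff)
  have sub: "subtopology (prod_topology X Y) (U \<times> V) = prod_topology (subtopology X U) (subtopology Y V)"
    by (simp add: subtopology_Times)
  have \<phi>R: "\<phi> x \<in> euc m" if "x \<in> U" for x using u(3) openin_Euclidean_subset that by blast
  have \<psi>R: "\<psi> x \<in> euc n" if "x \<in> V" for x using v(3) openin_Euclidean_subset that by blast
  have left: "left_coords m (\<eta> (x, y)) = \<phi> x" if "x \<in> U" for x y
    using \<phi>R[OF that] by (auto simp: left_coords_def \<eta>_def mem_euc fun_eq_iff)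
  have right: "right_coords m n (\<eta> (x, y)) = \<psi> y" if "y \<in> V" for x y
    using \<psi>R[OF that] by (auto simp: right_coords_def \<eta>_def mem_euc fun_eq_iff)
  have \<eta>Q: "\<eta> z \<in> Q" if "z \<in> U \<times> V" for z
    using that \<psi>R by (auto simp: Q_def left right) (auto simp: mem_euc \<eta>_def)
  define g where "g p = (inv_into U \<phi> (left_coords m p), inv_into V \<psi> (right_coords m n p))" for p
  have c1: "continuous_map (subtopology (prod_topology X Y) (U \<times> V)) (subtopology (Euclidean_space (m + n)) Q) \<eta>"
  proof (rule continuous_map_into_Euclidean)
    fix j assume j: "j < m + n"
    have "continuous_map (prod_topology (subtopology X U) (subtopology Y V)) euclideanreal (\<lambda>z. \<phi> (fst z) j)"
      using continuous_map_compose[OF continuous_map_fst continuous_map_compose[OF is_chart_continuous(1)[OF U] continuous_map_coordinate]]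
      by (simp add: o_def)
    moreover have "continuous_map (prod_topology (subtopology X U) (subtopology Y V)) euclideanreal (\<lambda>z. \<psi> (snd z) (j - m))"
      using continuous_map_compose[OF continuous_map_snd continuous_map_compose[OF is_chart_continuous(1)[OF V] continuous_map_coordinate]]
      by (simp add: o_def)
    ultimately show "continuous_map (subtopology (prod_topology X Y) (U \<times> V)) euclideanreal (\<lambda>x. \<eta> x j)"
      unfolding sub by (cases "j < m") (simp_all add: \<eta>_def case_prod_beta)
  next
    show "\<eta> z \<in> Q" if "z \<in> topspace (subtopology (prod_topology X Y) (U \<times> V))" for z
      using that by (intro \<eta>Q) simp
    show "Q \<subseteq> euc (m + n)" by (auto simp: Q_def)
  qed
  have c2: "continuous_map (subtopology (Euclidean_space (m + n)) Q) (subtopology (prod_topology X Y) (U \<times> V)) g"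
  proof -
    have "continuous_map (subtopology (Euclidean_space (m + n)) Q) (subtopology (Euclidean_space m) (\<phi> ` U)) (left_coords m)"
      using continuous_map_from_subtopology[OF l] by (auto simp: continuous_map_in_subtopology Q_def)
    from continuous_map_compose[OF this is_chart_continuous(2)[OF U]]
    have a: "continuous_map (subtopology (Euclidean_space (m + n)) Q) X (\<lambda>p. inv_into U \<phi> (left_coords m p))"
      by (simp add: o_def)
    have "continuous_map (subtopology (Euclidean_space (m + n)) Q) (subtopology (Euclidean_space n) (\<psi> ` V)) (right_coords m n)"
      using continuous_map_from_subtopology[OF r] by (auto simp: continuous_map_in_subtopology Q_def)
    from continuous_map_compose[OF this is_chart_continuous(2)[OF V]]
    have b: "continuous_map (subtopology (Euclidean_space (m + n)) Q) Y (\<lambda>p. inv_into V \<psi> (right_coords m n p))"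
      by (simp add: o_def)
    have "continuous_map (subtopology (Euclidean_space (m + n)) Q) (prod_topology X Y) g"
      unfolding g_def by (rule continuous_map_pairedI[OF a b])
    then show ?thesis
      by (auto simp: continuous_map_in_subtopology g_def Q_def inv_into_into)
  qed
  have e1: "g (\<eta> z) = z" if "z \<in> U \<times> V" for z
    using that u(2) v(2) by (cases z) (auto simp: g_def left right)
  have e2: "\<eta> (g p) = p" if "p \<in> Q" for p
  proof
    fix k
    have "\<phi> (inv_into U \<phi> (left_coords m p)) = left_coords m p"
      "\<psi> (inv_into V \<psi> (right_coords m n p)) = right_coords m n p" "p \<in> euc (m + n)"
      using that by (auto simp: Q_def f_inv_into_f)
    then show "\<eta> (g p) k = p k"
      by (auto simp: \<eta>_def g_def left_coords_def right_coords_def mem_euc)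
  qed
  show ?thesis by (rule is_chartI(1)[OF UV Q c1 c2 e1 e2])
qed

lemma charted_prod_manifold:
  assumes M: "charted M" and N: "charted N"
  shows "charted (prod_manifold M N)"
  unfolding charted_def
proof (intro conjI ballI)
  fix c assume "c \<in> atlas (prod_manifold M N)"
  then obtain U \<phi> V \<psi> where c: "(U, \<phi>) \<in> atlas M" "(V, \<psi>) \<in> atlas N"
    "c = (U \<times> V, \<lambda>(x, y) k. if k < mdim M then \<phi> x k else \<psi> y (k - mdim M))"
    unfolding atlas_prod_manifold by blast
  show "is_chart (mtop (prod_manifold M N)) (mdim (prod_manifold M N)) c"
    using prod_chart[OF charted_chart(1)[OF M c(1)] charted_chart(1)[OF N c(2)]] c(3) by simp
next
  show "(\<Union>(U, \<phi>)\<in>atlas (prod_manifold M N). U) = topspace (mtop (prod_manifold M N))"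
  proof
    show "(\<Union>(U, \<phi>)\<in>atlas (prod_manifold M N). U) \<subseteq> topspace (mtop (prod_manifold M N))"
      using charted_chart(4)[OF M] charted_chart(4)[OF N] by (fastforce simp: atlas_prod_manifold)
    show "topspace (mtop (prod_manifold M N)) \<subseteq> (\<Union>(U, \<phi>)\<in>atlas (prod_manifold M N). U)"
    proof
      fix z assume "z \<in> topspace (mtop (prod_manifold M N))"
      then have z: "fst z \<in> topspace (mtop M)" "snd z \<in> topspace (mtop N)" by auto
      obtain U \<phi> where "(U, \<phi>) \<in> atlas M" "fst z \<in> U" using charted_cover[OF M z(1)] .
      moreover obtain V \<psi> where "(V, \<psi>) \<in> atlas N" "snd z \<in> V" using charted_cover[OF N z(2)] .
      ultimately show "z \<in> (\<Union>(U, \<phi>)\<in>atlas (prod_manifold M N). U)"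
        by (intro UN_I[of "(U \<times> V, \<lambda>(x, y) k. if k < mdim M then \<phi> x k else \<psi> y (k - mdim M))"])
          (auto simp: atlas_prod_manifold mem_Times_iff)
    qed
  qed
qed

text \<open>One target chart per source chart is enough if it contains the image of the source
  chart: the other target charts are reached by smooth transitions. This suits projections, which in
  product charts merely select coordinates.\<close>

lemma smooth_map_by_charts:
  assumes M: "charted M" and N: "smooth_manifold N" and f: "continuous_map (mtop M) (mtop N) f"
    and ch: "\<And>U \<phi>. (U, \<phi>) \<in> atlas M \<Longrightarrow> \<exists>V \<psi>. (V, \<psi>) \<in> atlas N \<and> f ` U \<subseteq> V \<and>
      (\<forall>j<mdim N. \<exists>L. smooth_on (mdim M) (\<phi> ` U) L \<and> (\<forall>x\<in>U. \<psi> (f x) j = L (\<phi> x)))"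
  shows "smooth_map M N f"
  unfolding smooth_map_iff
proof safe
  fix W \<zeta> j assume W: "(W, \<zeta>) \<in> atlas N" and j: "j < mdim N"
  note cN = smooth_manifold_charted[OF N]
  show "smooth_fun M (f -` W) (\<lambda>z. \<zeta> (f z) j)"
    unfolding smooth_fun_def
  proof safe
    fix U \<phi> assume U: "(U, \<phi>) \<in> atlas M"
    note cU = charted_chart[OF M U]
    from ch[OF U] obtain V \<psi> where V: "(V, \<psi>) \<in> atlas N" "f ` U \<subseteq> V" and
      "\<forall>j<mdim N. \<exists>L. smooth_on (mdim M) (\<phi> ` U) L \<and> (\<forall>x\<in>U. \<psi> (f x) j = L (\<phi> x))" by blast
    then have "\<forall>j. \<exists>L. j < mdim N \<longrightarrow> smooth_on (mdim M) (\<phi> ` U) L \<and> (\<forall>x\<in>U. \<psi> (f x) j = L (\<phi> x))" by blast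
    from choice[OF this] obtain L where
      L: "\<forall>j. j < mdim N \<longrightarrow> smooth_on (mdim M) (\<phi> ` U) (L j) \<and> (\<forall>x\<in>U. \<psi> (f x) j = L j (\<phi> x))" ..
    note cV = charted_chart[OF cN V(1)]
    define Q where "Q = \<phi> ` (U \<inter> f -` W)"
    have "openin (mtop M) {x \<in> topspace (mtop M). f x \<in> W}"
      using openin_continuous_map_preimage[OF f charted_chart(2)[OF cN W]] .
    moreover have "U \<inter> {x \<in> topspace (mtop M). f x \<in> W} = U \<inter> f -` W" using cU(4) by auto
    ultimately have Q: "openin (Euclidean_space (mdim M)) Q"
      using is_chart_open_image[OF cU(1)] by (metis Q_def)
    have sm: "smooth_on (mdim M) Q (\<lambda>p. \<psi> (f (inv_into U \<phi> p)) i)" if i: "i < mdim N" for i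
    proof -
      have "smooth_on (mdim M) Q (L i)"
        by (rule smooth_on_mono[of _ "\<phi> ` U"]) (use L i in \<open>auto simp: Q_def\<close>)
      moreover have "\<psi> (f (inv_into U \<phi> p)) i = L i p" if "p \<in> Q" for p
        using that L i cU(3) by (auto simp: Q_def)
      ultimately show ?thesis by (subst smooth_on_cong[OF Q]) auto
    qed
    \<comment> \<open>The transition from \<open>\<psi>\<close> to \<open>\<zeta>\<close>, applied
      to the coordinates of \<open>f\<close> in the chart \<open>\<psi>\<close>.\<close>
    have "smooth_on (mdim M) Q (\<lambda>p. \<zeta> (inv_into V \<psi> (\<psi> (f (inv_into U \<phi> p)))) j)"
      by (rule smooth_on_compose[OF Q is_chart_open_image[OF cV(1) charted_chart(2)[OF cN W]]
            smooth_funD[OF smooth_fun_coordinate[OF N W j] V(1)] sm])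
        (use V(2) cU(3) in \<open>auto simp: Q_def\<close>)
    then show "smooth_on (mdim M) (\<phi> ` (U \<inter> f -` W)) (\<lambda>p. \<zeta> (f (inv_into U \<phi> p)) j)"
      unfolding Q_def[symmetric] using V(2) cU(3) cV(3)
      by (subst smooth_on_cong[OF Q, of _ "\<lambda>p. \<zeta> (inv_into V \<psi> (\<psi> (f (inv_into U \<phi> p)))) j"])
        (auto simp: Q_def image_subset_iff)
  qed
qed (fact f)

lemma smooth_map_fst:
  assumes M: "smooth_manifold M" and N: "charted N"
  shows "smooth_map (prod_manifold M N) M fst"
proof (rule smooth_map_by_charts[OF charted_prod_manifold[OF smooth_manifold_charted[OF M] N] M])
  show "continuous_map (mtop (prod_manifold M N)) (mtop M) fst" by (simp add: continuous_map_fst)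
  fix UV \<eta> assume "(UV, \<eta>) \<in> atlas (prod_manifold M N)"
  then obtain U \<phi> V \<psi> where U: "(U, \<phi>) \<in> atlas M" and eq: "UV = U \<times> V"
      "\<eta> = (\<lambda>(x, y) k. if k < mdim M then \<phi> x k else \<psi> y (k - mdim M))"
    unfolding atlas_prod_manifold by blast
  have "\<exists>L. smooth_on (mdim (prod_manifold M N)) (\<eta> ` UV) L \<and> (\<forall>x\<in>UV. \<phi> (fst x) j = L (\<eta> x))" if "j < mdim M" for j
    by (rule exI[of _ "\<lambda>p. p j"]) (use that in \<open>simp add: smooth_on_coordinate eq case_prod_beta\<close>)
  then show "\<exists>V \<psi>. (V, \<psi>) \<in> atlas M \<and> fst ` UV \<subseteq> V \<and>
      (\<forall>j<mdim M. \<exists>L. smooth_on (mdim (prod_manifold M N)) (\<eta> ` UV) L \<and> (\<forall>x\<in>UV. \<psi> (fst x) j = L (\<eta> x)))"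
    by (intro exI[of _ U] exI[of _ \<phi>]) (use U eq(1) in auto)
qed

lemma smooth_map_snd:
  assumes M: "charted M" and N: "smooth_manifold N"
  shows "smooth_map (prod_manifold M N) N snd"
proof (rule smooth_map_by_charts[OF charted_prod_manifold[OF M smooth_manifold_charted[OF N]] N])
  show "continuous_map (mtop (prod_manifold M N)) (mtop N) snd" by (simp add: continuous_map_snd)
  fix UV \<eta> assume "(UV, \<eta>) \<in> atlas (prod_manifold M N)"
  then obtain U \<phi> V \<psi> where V: "(V, \<psi>) \<in> atlas N" and eq: "UV = U \<times> V"
      "\<eta> = (\<lambda>(x, y) k. if k < mdim M then \<phi> x k else \<psi> y (k - mdim M))"
    unfolding atlas_prod_manifold by blast
  have "\<exists>L. smooth_on (mdim (prod_manifold M N)) (\<eta> ` UV) L \<and> (\<forall>x\<in>UV. \<psi> (snd x) j = L (\<eta> x))" if "j < mdim N" for j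
    by (rule exI[of _ "\<lambda>p. p (mdim M + j)"]) (use that in \<open>simp add: smooth_on_coordinate eq case_prod_beta\<close>)
  then show "\<exists>V \<psi>. (V, \<psi>) \<in> atlas N \<and> snd ` UV \<subseteq> V \<and>
      (\<forall>j<mdim N. \<exists>L. smooth_on (mdim (prod_manifold M N)) (\<eta> ` UV) L \<and> (\<forall>x\<in>UV. \<psi> (snd x) j = L (\<eta> x)))"
    by (intro exI[of _ V] exI[of _ \<psi>]) (use V eq(1) in auto)
qed

lemma smooth_map_pair:
  assumes f: "smooth_map L M f" and g: "smooth_map L N g"
  shows "smooth_map L (prod_manifold M N) (\<lambda>x. (f x, g x))"
  unfolding smooth_map_iff
proof safe
  show "continuous_map (mtop L) (mtop (prod_manifold M N)) (\<lambda>x. (f x, g x))"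
    using f g by (simp add: continuous_map_pairedI smooth_map_continuous)
  fix UV \<eta> j assume "(UV, \<eta>) \<in> atlas (prod_manifold M N)" and j: "j < mdim (prod_manifold M N)"
  then obtain U \<phi> V \<psi> where UV: "(U, \<phi>) \<in> atlas M" "(V, \<psi>) \<in> atlas N"
    and eq: "UV = U \<times> V" "\<eta> = (\<lambda>(x, y) k. if k < mdim M then \<phi> x k else \<psi> y (k - mdim M))"
    unfolding atlas_prod_manifold by blast
  show "smooth_fun L ((\<lambda>x. (f x, g x)) -` UV) (\<lambda>x. \<eta> (f x, g x) j)"
  proof (cases "j < mdim M")
    case True
    from smooth_fun_mono[OF smooth_map_chart[OF f UV(1) this], of "(\<lambda>x. (f x, g x)) -` UV"]
    show ?thesis using True by (auto simp: eq)
  next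
    case False
    then have "j - mdim M < mdim N" using j by simp
    from smooth_fun_mono[OF smooth_map_chart[OF g UV(2) this], of "(\<lambda>x. (f x, g x)) -` UV"]
    show ?thesis using False by (auto simp: eq)
  qed
qed

lemma second_countable_prod_topology:
  assumes "second_countable X" "second_countable Y"
  shows "second_countable (prod_topology X Y)"
proof -
  obtain B where B': "countable B" "\<forall>V\<in>B. openin X V"
    "\<forall>U x. openin X U \<and> x \<in> U \<longrightarrow> (\<exists>V\<in>B. x \<in> V \<and> V \<subseteq> U)"
    using assms(1) unfolding second_countable_def by blast
  have B: "countable B" "\<And>V. V \<in> B \<Longrightarrow> openin X V"
    "\<And>U x. openin X U \<Longrightarrow> x \<in> U \<Longrightarrow> \<exists>V\<in>B. x \<in> V \<and> V \<subseteq> U"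
    using B' by simp_all
  obtain C where C': "countable C" "\<forall>V\<in>C. openin Y V"
    "\<forall>U x. openin Y U \<and> x \<in> U \<longrightarrow> (\<exists>V\<in>C. x \<in> V \<and> V \<subseteq> U)"
    using assms(2) unfolding second_countable_def by blast
  have C: "countable C" "\<And>V. V \<in> C \<Longrightarrow> openin Y V"
    "\<And>U x. openin Y U \<Longrightarrow> x \<in> U \<Longrightarrow> \<exists>V\<in>C. x \<in> V \<and> V \<subseteq> U"
    using C' by simp_all
  show ?thesis unfolding second_countable_def
  proof (intro exI[of _ "(\<lambda>(U, V). U \<times> V) ` (B \<times> C)"] conjI allI impI)
    show "countable ((\<lambda>(U, V). U \<times> V) ` (B \<times> C))" using B C by blast
    show "\<forall>V\<in>(\<lambda>(U, V). U \<times> V) ` (B \<times> C). openin (prod_topology X Y) V"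
      using B C by (auto simp: openin_prod_Times_iff)
    fix U z assume "openin (prod_topology X Y) U \<and> z \<in> U"
    then obtain U1 U2 where U: "openin X U1" "openin Y U2" "fst z \<in> U1" "snd z \<in> U2" "U1 \<times> U2 \<subseteq> U"
      unfolding openin_prod_topology_alt by (metis prod.collapse)
    obtain V1 where "V1 \<in> B" "fst z \<in> V1" "V1 \<subseteq> U1" using B(3)[OF U(1,3)] by blast
    moreover obtain V2 where "V2 \<in> C" "snd z \<in> V2" "V2 \<subseteq> U2" using C(3)[OF U(2,4)] by blast
    ultimately show "\<exists>V\<in>(\<lambda>(U, V). U \<times> V) ` (B \<times> C). z \<in> V \<and> V \<subseteq> U"
      by (intro bexI[of _ "V1 \<times> V2"]) (use U(5) in \<open>auto simp: mem_Times_iff\<close>)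
  qed
qed

text \<open>Smoothness of the coordinate functions is compatibility of the charts, and it follows as
  soon as the identity is known to be a smooth map. Products and transported manifolds are treated
  in this way.\<close>

lemma smooth_manifoldI:
  assumes "charted M" "Hausdorff_space (mtop M)" "second_countable (mtop M)"
    "\<And>U \<phi> j. (U, \<phi>) \<in> atlas M \<Longrightarrow> j < mdim M \<Longrightarrow> smooth_fun M U (\<lambda>x. \<phi> x j)"
  shows "smooth_manifold M"
  using assms unfolding smooth_manifold_def charted_def smooth_fun_def by fast

lemma smooth_manifold_prod_manifold:
  assumes M: "smooth_manifold M" and N: "smooth_manifold N"
  shows "smooth_manifold (prod_manifold M N)"
proof (rule smooth_manifoldI)
  note cM = smooth_manifold_charted[OF M] and cN = smooth_manifold_charted[OF N]
  show "charted (prod_manifold M N)" by (rule charted_prod_manifold[OF cM cN])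
  show "Hausdorff_space (mtop (prod_manifold M N))"
    using M N by (simp add: smooth_manifold_def Hausdorff_space_prod_topology)
  show "second_countable (mtop (prod_manifold M N))"
    using M N by (simp add: smooth_manifold_def second_countable_prod_topology)
  \<comment> \<open>The identity as a pair of projections: \<open>smooth_map_pair\<close> and the
    smoothness of projections use compatibility of charts in the factors only.\<close>
  have "smooth_map (prod_manifold M N) (prod_manifold M N) (\<lambda>z. (fst z, snd z))"
    by (rule smooth_map_pair[OF smooth_map_fst[OF M cN] smooth_map_snd[OF cM N]])
  then show "smooth_fun (prod_manifold M N) U (\<lambda>x. \<phi> x j)"
    if "(U, \<phi>) \<in> atlas (prod_manifold M N)" "j < mdim (prod_manifold M N)" for U \<phi> j
    using smooth_map_chart[OF _ that, of "prod_manifold M N" "\<lambda>z. z"] by (simp del: mdim_prod_manifold)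
qed

section \<open>Finite powers of a manifold\<close>

lemma mdim_power_manifold [simp]: "mdim (power_manifold n M) = n * mdim M"
  and mtop_power_manifold [simp]: "mtop (power_manifold n M) = product_topology (\<lambda>_. mtop M) {1..n}"
  by (simp_all add: power_manifold_def)

lemma power_chart:
  assumes c: "\<And>i. i \<in> {1..n} \<Longrightarrow> is_chart X d (U i, \<phi> i)"
  defines "\<eta> \<equiv> \<lambda>x k. if k < n * d then \<phi> (k div d + 1) (x (k div d + 1)) (k mod d) else 0"
  shows "is_chart (product_topology (\<lambda>_. X) {1..n}) (n * d) (\<Pi>\<^sub>E i\<in>{1..n}. U i, \<eta>)"
proof -
  \<comment> \<open>Factors are counted from \<open>1\<close> and coordinates from \<open>0\<close>,
    so block \<open>i\<close> starts at \<open>(i - 1) * d\<close>.\<close>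
  define block where "block i p = (\<lambda>k. if k < d then p ((i - 1) * d + k) else 0)" for i :: nat and p :: "nat \<Rightarrow> real"
  \<comment> \<open>Intersecting with \<open>euc (n * d)\<close> matters for \<open>n = 0\<close>,
    where the intersection over the blocks is everything.\<close>
  define Q where "Q = (\<Inter>i\<in>{1..n}. {p \<in> euc (n * d). block i p \<in> \<phi> i ` U i}) \<inter> euc (n * d)"
  define g where "g p = (\<lambda>i\<in>{1..n}. inv_into (U i) (\<phi> i) (block i p))" for p
  define P where "P = (\<Pi>\<^sub>E i\<in>{1..n}. U i)"
  have idx: "(i - 1) * d + k < n * d" if "i \<in> {1..n}" "k < d" for i k
  proof -
    have "(i - 1) * d + k < (i - 1) * d + d" using that by simp
    also have "\<dots> = i * d" using that by (cases i) auto
    also have "\<dots> \<le> n * d" using that by simp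
    finally show ?thesis .
  qed
  \<comment> \<open>An index below \<open>n * d\<close> exists only if \<open>d > 0\<close>, which
    makes the remainder a valid coordinate index.\<close>
  have idx2: "k div d + 1 \<in> {1..n}" "k mod d < d" if "k < n * d" for k
    using that by (auto simp: less_mult_imp_div_less Suc_le_eq intro!: mod_less_divisor gr0I)
  have bc: "continuous_map (Euclidean_space (n * d)) (Euclidean_space d) (block i)" if "i \<in> {1..n}" for i
    unfolding block_def[abs_def] by (rule continuous_map_Euclidean_reindex) (use idx[OF that] in simp)
  have Q: "openin (Euclidean_space (n * d)) Q"
    unfolding Q_def by (rule openin_INT) (auto intro!: openin_continuous_map_preimage[OF bc] is_chartD(3)[OF c])
  have sub: "subtopology (product_topology (\<lambda>_. X) {1..n}) P = product_topology (\<lambda>i. subtopology X (U i)) {1..n}"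
    unfolding P_def by (simp add: subtopology_product_topology)
  have P: "openin (product_topology (\<lambda>_. X) {1..n}) P"
    unfolding P_def using is_chartD(1)[OF c] by (subst openin_PiE) auto
  have \<eta>b: "block i (\<eta> x) = \<phi> i (x i)" if x: "x \<in> P" and i: "i \<in> {1..n}" for x i
  proof
    fix k
    have "\<phi> i (x i) \<in> euc d"
      using openin_Euclidean_subset[OF is_chartD(3)[OF c[OF i]]] x i by (auto simp: P_def PiE_iff)
    moreover have "((i - 1) * d + k) div d + 1 = i" if "k < d"
      using i that by (cases i) auto
    ultimately show "block i (\<eta> x) k = \<phi> i (x i) k"
      using idx[OF i] by (auto simp: block_def \<eta>_def mem_euc)
  qed
  have \<eta>Q: "\<eta> x \<in> Q" if "x \<in> P" for x
    using that \<eta>b[OF that] by (auto simp: Q_def P_def PiE_iff mem_euc \<eta>_def)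
  have "continuous_map (subtopology (product_topology (\<lambda>_. X) {1..n}) P) (subtopology (Euclidean_space (n * d)) Q) \<eta>"
  proof (rule continuous_map_into_Euclidean)
    fix k assume k: "k < n * d"
    let ?i = "k div d + 1"
    have "continuous_map (product_topology (\<lambda>i. subtopology X (U i)) {1..n}) (subtopology X (U ?i)) (\<lambda>x. x ?i)"
      by (rule continuous_map_product_projection[OF idx2(1)[OF k]])
    from continuous_map_compose[OF this continuous_map_compose[OF is_chart_continuous(1)[OF c[OF idx2(1)[OF k]]] continuous_map_coordinate]]
    show "continuous_map (subtopology (product_topology (\<lambda>_. X) {1..n}) P) euclideanreal (\<lambda>x. \<eta> x k)"
      unfolding sub using k by (simp add: \<eta>_def o_def)
  next
    show "\<eta> x \<in> Q" if "x \<in> topspace (subtopology (product_topology (\<lambda>_. X) {1..n}) P)" for x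
      using that by (intro \<eta>Q) simp
    show "Q \<subseteq> euc (n * d)" by (auto simp: Q_def)
  qed
  moreover have "continuous_map (subtopology (Euclidean_space (n * d)) Q) (subtopology (product_topology (\<lambda>_. X) {1..n}) P) g"
    unfolding sub
  proof (rule continuous_map_coordinatewise_then_product)
    fix i assume i: "i \<in> {1..n}"
    have "continuous_map (subtopology (Euclidean_space (n * d)) Q) (subtopology (Euclidean_space d) (\<phi> i ` U i)) (block i)"
      using continuous_map_from_subtopology[OF bc[OF i]] i by (auto simp: continuous_map_in_subtopology Q_def)
    from continuous_map_compose[OF this is_chart_continuous(2)[OF c[OF i]]]
    have "continuous_map (subtopology (Euclidean_space (n * d)) Q) X (\<lambda>p. inv_into (U i) (\<phi> i) (block i p))"
      by (simp add: o_def)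
    then show "continuous_map (subtopology (Euclidean_space (n * d)) Q) (subtopology X (U i)) (\<lambda>p. g p i)"
      using i by (auto simp: continuous_map_in_subtopology g_def Q_def inv_into_into)
  qed (auto simp: g_def)
  moreover have "g (\<eta> x) = x" if "x \<in> P" for x
  proof
    fix i
    show "g (\<eta> x) i = x i"
      using that \<eta>b[OF that, of i] is_chartD(2)[OF c, of i] by (auto simp: g_def P_def PiE_iff extensional_def)
  qed
  moreover have "\<eta> (g p) = p" if p: "p \<in> Q" for p
  proof
    fix k
    show "\<eta> (g p) k = p k"
    proof (cases "k < n * d")
      case True
      have "block (k div d + 1) p \<in> \<phi> (k div d + 1) ` U (k div d + 1)"
        using p idx2(1)[OF True] unfolding Q_def by blast
      then show ?thesis
        using idx2[OF True] True by (simp add: \<eta>_def g_def f_inv_into_f block_def)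
    next
      case False
      then show ?thesis using p by (auto simp: \<eta>_def Q_def mem_euc)
    qed
  qed
  ultimately show ?thesis using is_chartI(1)[OF P Q] unfolding P_def by blast
qed

lemma atlas_power_manifold:
  "ch \<in> atlas (power_manifold n M) \<longleftrightarrow> (\<exists>c. (\<forall>i\<in>{1..n}. c i \<in> atlas M) \<and>
     ch = (\<Pi>\<^sub>E i\<in>{1..n}. fst (c i), \<lambda>x k. if k < n * mdim M
        then snd (c (k div mdim M + 1)) (x (k div mdim M + 1)) (k mod mdim M) else 0))"
  by (auto simp: power_manifold_def Pi_iff)

lemma charted_power_manifold:
  assumes M: "charted M"
  shows "charted (power_manifold n M)"
  unfolding charted_def
proof (intro conjI ballI)
  fix ch assume "ch \<in> atlas (power_manifold n M)"
  then obtain c where c: "\<forall>i\<in>{1..n}. c i \<in> atlas M" "ch = (\<Pi>\<^sub>E i\<in>{1..n}. fst (c i), \<lambda>x k. if k < n * mdim M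
        then snd (c (k div mdim M + 1)) (x (k div mdim M + 1)) (k mod mdim M) else 0)"
    unfolding atlas_power_manifold by blast
  have "is_chart (mtop M) (mdim M) (fst (c i), snd (c i))" if "i \<in> {1..n}" for i
    using c(1) that M by (auto simp: charted_def)
  from power_chart[of n "mtop M" "mdim M" "\<lambda>i. fst (c i)" "\<lambda>i. snd (c i)", OF this]
  show "is_chart (mtop (power_manifold n M)) (mdim (power_manifold n M)) ch"
    unfolding c(2) by simp
next
  show "(\<Union>(U, \<phi>)\<in>atlas (power_manifold n M). U) = topspace (mtop (power_manifold n M))"
  proof
    have sub: "fst c \<subseteq> topspace (mtop M)" if "c \<in> atlas M" for c
      using charted_chart(4)[OF M, of "fst c" "snd c"] that by simp
    show "(\<Union>(U, \<phi>)\<in>atlas (power_manifold n M). U) \<subseteq> topspace (mtop (power_manifold n M))"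
    proof
      fix x assume "x \<in> (\<Union>(U, \<phi>)\<in>atlas (power_manifold n M). U)"
      then obtain ch where ch: "ch \<in> atlas (power_manifold n M)" "x \<in> fst ch" by auto
      then obtain c where c: "\<forall>i\<in>{1..n}. c i \<in> atlas M" "fst ch = (\<Pi>\<^sub>E i\<in>{1..n}. fst (c i))"
        unfolding atlas_power_manifold by auto
      have "fst ch \<subseteq> (\<Pi>\<^sub>E i\<in>{1..n}. topspace (mtop M))"
        unfolding c(2) using sub c(1) by (intro PiE_mono) blast
      then show "x \<in> topspace (mtop (power_manifold n M))" using ch(2) by auto
    qed
    show "topspace (mtop (power_manifold n M)) \<subseteq> (\<Union>(U, \<phi>)\<in>atlas (power_manifold n M). U)"
    proof
      fix x assume x: "x \<in> topspace (mtop (power_manifold n M))"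
      have "\<exists>c. c \<in> atlas M \<and> x i \<in> fst c" if "i \<in> {1..n}" for i
      proof -
        have "x i \<in> topspace (mtop M)" using x that by (auto simp: PiE_iff)
        from charted_cover[OF M this] show ?thesis by (metis fst_conv)
      qed
      then have "\<forall>i. \<exists>c. i \<in> {1..n} \<longrightarrow> c \<in> atlas M \<and> x i \<in> fst c" by blast
      from choice[OF this] obtain c where c: "\<forall>i. i \<in> {1..n} \<longrightarrow> c i \<in> atlas M \<and> x i \<in> fst (c i)" ..
      have "(\<Pi>\<^sub>E i\<in>{1..n}. fst (c i), \<lambda>x k. if k < n * mdim M
        then snd (c (k div mdim M + 1)) (x (k div mdim M + 1)) (k mod mdim M) else 0) \<in> atlas (power_manifold n M)"
        unfolding atlas_power_manifold using c by blast
      moreover have "x \<in> (\<Pi>\<^sub>E i\<in>{1..n}. fst (c i))" using c x by (auto simp: PiE_iff)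
      ultimately show "x \<in> (\<Union>(U, \<phi>)\<in>atlas (power_manifold n M). U)" by blast
    qed
  qed
qed

lemma smooth_map_power_projection:
  assumes M: "smooth_manifold M" and i: "i \<in> {1..n}"
  shows "smooth_map (power_manifold n M) M (\<lambda>x. x i)"
proof (rule smooth_map_by_charts[OF charted_power_manifold[OF smooth_manifold_charted[OF M]] M])
  show "continuous_map (mtop (power_manifold n M)) (mtop M) (\<lambda>x. x i)"
    unfolding mtop_power_manifold by (rule continuous_map_product_projection[OF i])
  fix U \<phi> assume "(U, \<phi>) \<in> atlas (power_manifold n M)"
  then obtain c where c: "\<forall>i\<in>{1..n}. c i \<in> atlas M" and U: "U = (\<Pi>\<^sub>E i\<in>{1..n}. fst (c i))"
    and \<phi>: "\<phi> = (\<lambda>x k. if k < n * mdim M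
        then snd (c (k div mdim M + 1)) (x (k div mdim M + 1)) (k mod mdim M) else 0)"
    unfolding atlas_power_manifold by blast
  have "\<exists>L. smooth_on (mdim (power_manifold n M)) (\<phi> ` U) L \<and> (\<forall>x\<in>U. snd (c i) (x i) j = L (\<phi> x))"
    if j: "j < mdim M" for j
  proof -
    have "(i - 1) * mdim M + j < (i - 1) * mdim M + mdim M" using j by simp
    also have "\<dots> = i * mdim M" using i by (cases i) auto
    also have "\<dots> \<le> n * mdim M" using i by simp
    finally have "(i - 1) * mdim M + j < n * mdim M" .
    moreover have "((i - 1) * mdim M + j) div mdim M + 1 = i" using i j by (cases i) auto
    ultimately have "\<forall>x\<in>U. snd (c i) (x i) j = \<phi> x ((i - 1) * mdim M + j)" using j by (simp add: \<phi>)
    then show ?thesis by (intro exI[of _ "\<lambda>p. p ((i - 1) * mdim M + j)"]) (simp add: smooth_on_coordinate)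
  qed
  then show "\<exists>V \<psi>. (V, \<psi>) \<in> atlas M \<and> (\<lambda>x. x i) ` U \<subseteq> V \<and>
      (\<forall>j<mdim M. \<exists>L. smooth_on (mdim (power_manifold n M)) (\<phi> ` U) L \<and> (\<forall>x\<in>U. \<psi> (x i) j = L (\<phi> x)))"
    by (intro exI[of _ "fst (c i)"] exI[of _ "snd (c i)"]) (use c U i in auto)
qed

lemma smooth_map_into_power:
  assumes f: "\<And>i. i \<in> {1..n} \<Longrightarrow> smooth_map L M (f i)"
  shows "smooth_map L (power_manifold n M) (\<lambda>x. \<lambda>i\<in>{1..n}. f i x)"
  unfolding smooth_map_iff
proof safe
  show "continuous_map (mtop L) (mtop (power_manifold n M)) (\<lambda>x. \<lambda>i\<in>{1..n}. f i x)"
    using f[THEN smooth_map_continuous]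
    by (simp, intro continuous_map_coordinatewise_then_product) auto
  fix U \<phi> k assume "(U, \<phi>) \<in> atlas (power_manifold n M)" and "k < mdim (power_manifold n M)"
  then obtain c where c: "\<forall>i\<in>{1..n}. c i \<in> atlas M" and U: "U = (\<Pi>\<^sub>E i\<in>{1..n}. fst (c i))"
    and \<phi>: "\<phi> = (\<lambda>x k. if k < n * mdim M
        then snd (c (k div mdim M + 1)) (x (k div mdim M + 1)) (k mod mdim M) else 0)" and k: "k < n * mdim M"
    unfolding atlas_power_manifold by auto
  let ?i = "k div mdim M + 1"
  have i: "?i \<in> {1..n}" "k mod mdim M < mdim M"
    using k by (auto simp: less_mult_imp_div_less Suc_le_eq intro!: mod_less_divisor gr0I)
  have "(fst (c ?i), snd (c ?i)) \<in> atlas M" using c i(1) by auto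
  from smooth_map_chart[OF f[OF i(1)] this i(2)]
  have "smooth_fun L (f ?i -` fst (c ?i)) (\<lambda>x. snd (c ?i) (f ?i x) (k mod mdim M))" .
  then have "smooth_fun L ((\<lambda>x. \<lambda>i\<in>{1..n}. f i x) -` U) (\<lambda>x. snd (c ?i) (f ?i x) (k mod mdim M))"
    by (rule smooth_fun_mono) (use i(1) in \<open>auto simp: U PiE_iff\<close>)
  then show "smooth_fun L ((\<lambda>x. \<lambda>i\<in>{1..n}. f i x) -` U) (\<lambda>x. \<phi> (\<lambda>i\<in>{1..n}. f i x) k)"
    using k i(1) by (simp add: \<phi>)
qed

lemma open_submanifold_topspace:
  assumes "charted M"
  shows "open_submanifold M (topspace (mtop M)) = M"
proof -
  have "(\<lambda>(U, \<phi>). (U \<inter> topspace (mtop M), \<phi>)) ` atlas M = (\<lambda>c. c) ` atlas M"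
    using charted_chart(4)[OF assms] by (intro image_cong) (auto split: prod.splits)
  then show ?thesis by (simp add: open_submanifold_def)
qed

text \<open>Pushes the structure forward along an injection. The Lie group on the pairs
  \<open>(g, a)\<close> is realised in this way inside another type.\<close>

definition transport_manifold :: "('x \<Rightarrow> 'y) \<Rightarrow> 'x manifold \<Rightarrow> 'y manifold" where
  "transport_manifold f M =
     \<lparr>mtop = pullback_topology (f ` topspace (mtop M)) (inv_into (topspace (mtop M)) f) (mtop M),
      mdim = mdim M,
      atlas = (\<lambda>(U, \<phi>). (f ` U, \<phi> \<circ> inv_into (topspace (mtop M)) f)) ` atlas M\<rparr>"

context
  fixes f :: "'x \<Rightarrow> 'y" and M :: "'x manifold"
  assumes M: "smooth_manifold M" and inj: "inj_on f (topspace (mtop M))"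
begin

private abbreviation (input) "S \<equiv> topspace (mtop M)"
private abbreviation (input) "T \<equiv> transport_manifold f M"
private abbreviation (input) "g \<equiv> inv_into S f"

lemma openin_transport: "openin (mtop T) W \<longleftrightarrow> (\<exists>U. openin (mtop M) U \<and> W = f ` U)"
proof -
  have "g -` U \<inter> f ` S = f ` U" if "openin (mtop M) U" for U
  proof -
    have "U \<subseteq> S" using openin_subset[OF that] .
    then show ?thesis using inj by (auto simp: subset_iff)
  qed
  then show ?thesis by (simp add: transport_manifold_def openin_pullback_topology) metis
qed

lemma topspace_transport: "topspace (mtop T) = f ` S"
  by (auto simp: transport_manifold_def topspace_pullback_topology inj)

lemma homeomorphic_maps_transport: "homeomorphic_maps (mtop M) (mtop T) f g"
  unfolding homeomorphic_maps_def
proof (intro conjI)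
  show "continuous_map (mtop M) (mtop T) f"
    unfolding continuous_map
  proof (intro conjI allI impI)
    fix W assume "openin (mtop T) W"
    then obtain U where U: "openin (mtop M) U" "W = f ` U" unfolding openin_transport by blast
    then have "{x \<in> S. f x \<in> W} = U" using inj openin_subset[OF U(1)] by (auto simp: inj_on_def)
    then show "openin (mtop M) {x \<in> S. f x \<in> W}" using U by simp
  qed (simp add: topspace_transport)
  show "continuous_map (mtop T) (mtop M) g"
    unfolding continuous_map
  proof (intro conjI allI impI)
    fix U assume U: "openin (mtop M) U"
    then have "{x \<in> topspace (mtop T). g x \<in> U} = f ` U"
      using inj openin_subset[OF U] by (auto simp: topspace_transport subset_iff)
    then show "openin (mtop T) {x \<in> topspace (mtop T). g x \<in> U}" using U openin_transport by auto
  qed (auto simp: topspace_transport inv_into_into)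
qed (auto simp: topspace_transport inj)

lemma transport_chart:
  assumes U: "(U, \<phi>) \<in> atlas M"
  shows "is_chart (mtop T) (mdim M) (f ` U, \<phi> \<circ> g)"
    "\<And>p. p \<in> \<phi> ` U \<Longrightarrow> inv_into (f ` U) (\<phi> \<circ> g) p = f (inv_into U \<phi> p)"
proof -
  note c = charted_chart[OF smooth_manifold_charted[OF M] U]
  have U': "openin (mtop T) (f ` U)" using c(2) openin_transport by blast
  have gf: "g (f x) = x" if "x \<in> U" for x using that c(4) inj by auto
  have h: "homeomorphic_maps (mtop M) (mtop T) f g" by (rule homeomorphic_maps_transport)
  have 1: "continuous_map (subtopology (mtop T) (f ` U)) (subtopology (Euclidean_space (mdim M)) (\<phi> ` U)) (\<phi> \<circ> g)"
  proof -
    have "continuous_map (subtopology (mtop T) (f ` U)) (subtopology (mtop M) U) g"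
      using h gf by (auto simp: homeomorphic_maps_def continuous_map_in_subtopology continuous_map_from_subtopology)
    from continuous_map_compose[OF this is_chart_continuous(1)[OF c(1)]] gf
    show ?thesis by (auto simp: continuous_map_in_subtopology)
  qed
  have 2: "continuous_map (subtopology (Euclidean_space (mdim M)) (\<phi> ` U)) (subtopology (mtop T) (f ` U)) (\<lambda>p. f (inv_into U \<phi> p))"
    using continuous_map_compose[OF is_chart_continuous(2)[OF c(1)], of "mtop T" f] h
    by (auto simp: homeomorphic_maps_def continuous_map_in_subtopology o_def inv_into_into)
  have 3: "f (inv_into U \<phi> ((\<phi> \<circ> g) x)) = x" if "x \<in> f ` U" for x
    using that gf c(3) by auto
  have 4: "(\<phi> \<circ> g) (f (inv_into U \<phi> p)) = p" if "p \<in> \<phi> ` U" for p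
    using that gf c(3) by auto
  note * = is_chartI[OF U' is_chartD(3)[OF c(1)] 1 2 3 4]
  show "is_chart (mtop T) (mdim M) (f ` U, \<phi> \<circ> g)" by (rule *(1))
  show "inv_into (f ` U) (\<phi> \<circ> g) p = f (inv_into U \<phi> p)" if "p \<in> \<phi> ` U" for p
    by (rule *(2)[OF _ _ that])
qed

lemma atlas_transport: "c \<in> atlas T \<longleftrightarrow> (\<exists>U \<phi>. (U, \<phi>) \<in> atlas M \<and> c = (f ` U, \<phi> \<circ> g))"
  by (auto simp: transport_manifold_def)

lemma mdim_transport: "mdim T = mdim M"
  by (simp add: transport_manifold_def)

lemma charted_transport: "charted T"
  unfolding charted_def
proof
  show "\<forall>c\<in>atlas T. is_chart (mtop T) (mdim T) c"
    using transport_chart(1) by (auto simp: atlas_transport mdim_transport)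
  have "(\<Union>(U, \<phi>)\<in>atlas T. U) = f ` (\<Union>(U, \<phi>)\<in>atlas M. U)"
    by (simp add: transport_manifold_def image_UN case_prod_beta image_image)
  then show "(\<Union>(U, \<phi>)\<in>atlas T. U) = topspace (mtop T)"
    using smooth_manifold_charted[OF M] by (simp add: topspace_transport charted_def)
qed

lemma smooth_fun_transport:
  assumes W: "W \<subseteq> S" and h: "smooth_fun M W (\<lambda>x. h (f x))" and o: "openin (mtop M) W"
  shows "smooth_fun T (f ` W) h"
  unfolding smooth_fun_def
proof safe
  fix V \<psi> assume "(V, \<psi>) \<in> atlas T"
  then obtain U \<phi> where U: "(U, \<phi>) \<in> atlas M" "V = f ` U" "\<psi> = \<phi> \<circ> g" unfolding atlas_transport by blast
  note c = charted_chart[OF smooth_manifold_charted[OF M] U(1)]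
  have "f ` U \<inter> f ` W = f ` (U \<inter> W)" using inj_on_image_Int[OF inj c(4) W] by simp
  moreover have "g (f x) = x" if "x \<in> U \<inter> W" for x using that W inj by auto
  ultimately have im: "\<psi> ` (V \<inter> f ` W) = \<phi> ` (U \<inter> W)" by (auto simp: U image_image)
  have "smooth_on (mdim M) (\<phi> ` (U \<inter> W)) (\<lambda>p. h (inv_into V \<psi> p)) \<longleftrightarrow>
      smooth_on (mdim M) (\<phi> ` (U \<inter> W)) (\<lambda>p. h (f (inv_into U \<phi> p)))"
    by (rule smooth_on_cong[OF is_chart_open_image[OF c(1) o]]) (use transport_chart(2)[OF U(1)] in \<open>auto simp: U(2,3)\<close>)
  then show "smooth_on (mdim T) (\<psi> ` (V \<inter> f ` W)) (\<lambda>p. h (inv_into V \<psi> p))"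
    unfolding im mdim_transport using smooth_funD[OF h U(1)] by simp
qed

lemma smooth_map_to_transport: "smooth_map M T f"
  unfolding smooth_map_iff
proof safe
  show "continuous_map (mtop M) (mtop T) f" using homeomorphic_maps_transport by (simp add: homeomorphic_maps_def)
  note cM = smooth_manifold_charted[OF M]
  fix V \<psi> j assume "(V, \<psi>) \<in> atlas T" and j: "j < mdim T"
  then obtain U \<phi> where U: "(U, \<phi>) \<in> atlas M" "V = f ` U" "\<psi> = \<phi> \<circ> g" unfolding atlas_transport by blast
  note c = charted_chart[OF cM U(1)]
  have "smooth_fun M U (\<lambda>x. \<phi> x j)"
    using smooth_fun_coordinate[OF M U(1)] j by (simp add: mdim_transport)
  then have "smooth_fun M U (\<lambda>x. \<psi> (f x) j)"
    by (subst smooth_fun_cong[OF cM c(2), of _ "\<lambda>x. \<phi> x j"]) (use c(4) inj in \<open>auto simp: U\<close>)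
  then have "smooth_fun M (f -` V \<inter> S) (\<lambda>x. \<psi> (f x) j)"
    by (rule smooth_fun_mono) (use c(4) inj in \<open>auto simp: U inj_on_def\<close>)
  then show "smooth_fun M (f -` V) (\<lambda>x. \<psi> (f x) j)" by (rule smooth_fun_Int_topspace[OF cM])
qed

lemma smooth_map_from_transport: "smooth_map T M g"
  unfolding smooth_map_iff
proof safe
  show "continuous_map (mtop T) (mtop M) g" using homeomorphic_maps_transport by (simp add: homeomorphic_maps_def)
  note cM = smooth_manifold_charted[OF M]
  fix U \<phi> j assume U: "(U, \<phi>) \<in> atlas M" and j: "j < mdim M"
  note c = charted_chart[OF cM U(1)]
  have "smooth_fun M U (\<lambda>x. \<phi> (g (f x)) j)"
    by (subst smooth_fun_cong[OF cM c(2), of _ "\<lambda>x. \<phi> x j"])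
      (use smooth_fun_coordinate[OF M U j] c(4) inj in auto)
  from smooth_fun_transport[OF c(4) this c(2)]
  have "smooth_fun T (g -` U \<inter> topspace (mtop T)) (\<lambda>x. \<phi> (g x) j)"
    by (rule smooth_fun_mono) (use inj in \<open>auto simp: topspace_transport\<close>)
  then show "smooth_fun T (g -` U) (\<lambda>x. \<phi> (g x) j)" by (rule smooth_fun_Int_topspace[OF charted_transport])
qed

lemma smooth_manifold_transport: "smooth_manifold T"
proof (rule smooth_manifoldI[OF charted_transport])
  have "mtop M homeomorphic_space mtop T"
    using homeomorphic_maps_transport by (auto simp: homeomorphic_space_def)
  then show "Hausdorff_space (mtop T)" "second_countable (mtop T)"
    using M homeomorphic_Hausdorff_space homeomorphic_space_second_countability
    by (auto simp: smooth_manifold_def)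
  \<comment> \<open>\<open>f\<close> after its inverse is the identity on the image; smoothness of
    this composite gives compatibility of the transported charts.\<close>
  have "smooth_map T T (\<lambda>x. f (g x))"
    by (rule smooth_map_compose[OF charted_transport smooth_manifold_charted[OF M] charted_transport
          smooth_map_from_transport smooth_map_to_transport])
  then have id: "smooth_map T T (\<lambda>x. x)"
    by (rule smooth_map_cong[OF charted_transport charted_transport])
      (auto simp: topspace_transport f_inv_into_f)
  show "smooth_fun T U (\<lambda>x. \<phi> x j)" if "(U, \<phi>) \<in> atlas T" "j < mdim T" for U \<phi> j
    using smooth_map_chart[OF id that] by simp
qed

end

text \<open>Inherited from Euclidean space through charts. It supplies compact neighbourhoods in
  \<open>A\<close> and makes the Baire theorem applicable to the closed image in
  \<open>E\<close>.\<close>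

lemma locally_compact_manifold:
  assumes M: "charted M"
  shows "locally_compact_space (mtop M)"
  unfolding locally_compact_space_def
proof
  fix x assume "x \<in> topspace (mtop M)"
  then obtain U \<phi> where U: "(U, \<phi>) \<in> atlas M" "x \<in> U" using charted_cover[OF M] by blast
  note c = is_chartD[OF charted_chart(1)[OF M U(1)]]
  have "locally_compact_space (subtopology (Euclidean_space (mdim M)) (\<phi> ` U))"
    by (rule locally_compact_space_open_subset[OF _ locally_compact_Euclidean_space c(3)])
      (simp add: Hausdorff_Euclidean_space)
  moreover have "subtopology (mtop M) U homeomorphic_space subtopology (Euclidean_space (mdim M)) (\<phi> ` U)"
    using c(4) homeomorphic_map_imp_homeomorphic_space by blast
  ultimately have "locally_compact_space (subtopology (mtop M) U)"
    using homeomorphic_locally_compact_space by blast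
  then obtain V K where "openin (subtopology (mtop M) U) V" "compactin (subtopology (mtop M) U) K" "x \<in> V" "V \<subseteq> K"
    unfolding locally_compact_space_def c(5) using U(2) by meson
  then show "\<exists>U K. openin (mtop M) U \<and> compactin (mtop M) K \<and> x \<in> U \<and> U \<subseteq> K"
    by (intro exI[of _ V] exI[of _ K]) (simp add: openin_open_subtopology[OF c(1)] compactin_subtopology)
qed

section \<open>Closed injective homomorphisms of Lie groups\<close>

lemma lie_groupD:
  assumes "is_lie_group G"
  shows "group G" "smooth_manifold (mfd G)" "charted (mfd G)" "topspace (mtop (mfd G)) = carrier G"
    "smooth_map (prod_manifold (mfd G) (mfd G)) (mfd G) (\<lambda>(x, y). x \<otimes>\<^bsub>G\<^esub> y)"
    "smooth_map (mfd G) (mfd G) (\<lambda>x. inv\<^bsub>G\<^esub> x)"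
  using assms smooth_manifold_charted by (auto simp: is_lie_group_def)

lemma smooth_map_mult:
  assumes G: "is_lie_group G" and L: "charted L"
    and f: "smooth_map L (mfd G) f" and g: "smooth_map L (mfd G) g"
  shows "smooth_map L (mfd G) (\<lambda>x. f x \<otimes>\<^bsub>G\<^esub> g x)"
  using smooth_map_compose[OF L charted_prod_manifold[OF lie_groupD(3)[OF G] lie_groupD(3)[OF G]] lie_groupD(3)[OF G]
      smooth_map_pair[OF f g] lie_groupD(5)[OF G]] by simp

lemma smooth_map_inv:
  assumes G: "is_lie_group G" and L: "charted L" and f: "smooth_map L (mfd G) f"
  shows "smooth_map L (mfd G) (\<lambda>x. inv\<^bsub>G\<^esub> (f x))"
  by (rule smooth_map_compose[OF L lie_groupD(3)[OF G] lie_groupD(3)[OF G] f lie_groupD(6)[OF G]])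

lemma smooth_map_left_translation:
  assumes G: "is_lie_group G" and c: "c \<in> carrier G"
  shows "smooth_map (mfd G) (mfd G) (\<lambda>x. c \<otimes>\<^bsub>G\<^esub> x)"
  by (rule smooth_map_mult[OF G lie_groupD(3)[OF G] smooth_map_const smooth_map_id[OF lie_groupD(2)[OF G]]])
    (simp add: c lie_groupD(4)[OF G])

lemma openin_left_translation:
  assumes G: "is_lie_group G" and c: "c \<in> carrier G" and U: "openin (mtop (mfd G)) U"
  shows "openin (mtop (mfd G)) {x \<in> carrier G. c \<otimes>\<^bsub>G\<^esub> x \<in> U}"
  using openin_preimage[OF smooth_map_left_translation[OF G c] U] by (simp add: lie_groupD(4)[OF G])

text \<open>Continuity of \<open>(x, y) \<mapsto> inv x \<otimes> y\<close> at the identity. When a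
  point of a translate of \<open>C\<close> is moved to the identity, the whole translate consists of
  such quotients and therefore lands in \<open>N\<close>.\<close>

lemma compact_small_neighbourhood:
  assumes G: "is_lie_group G" and N: "openin (mtop (mfd G)) N" "\<one>\<^bsub>G\<^esub> \<in> N"
  obtains V C where "openin (mtop (mfd G)) V" "\<one>\<^bsub>G\<^esub> \<in> V" "V \<subseteq> C" "compactin (mtop (mfd G)) C" "C \<subseteq> carrier G"
    "\<forall>x\<in>C. \<forall>y\<in>C. inv\<^bsub>G\<^esub> x \<otimes>\<^bsub>G\<^esub> y \<in> N"
proof -
  interpret group G by (rule lie_groupD(1)[OF G])
  let ?X = "mtop (mfd G)"
  note g = lie_groupD[OF G]
  let ?P = "prod_manifold (mfd G) (mfd G)"
  have P: "charted ?P" by (rule charted_prod_manifold[OF g(3,3)])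
  have "smooth_map ?P (mfd G) (\<lambda>z. inv\<^bsub>G\<^esub> (fst z) \<otimes>\<^bsub>G\<^esub> snd z)"
    by (intro smooth_map_mult[OF G P] smooth_map_inv[OF G P] smooth_map_fst smooth_map_snd g)
  from openin_preimage[OF this N(1)]
  have "openin (prod_topology ?X ?X) {z \<in> carrier G \<times> carrier G. inv\<^bsub>G\<^esub> (fst z) \<otimes>\<^bsub>G\<^esub> snd z \<in> N}"
    by (simp add: g(4))
  moreover have "(\<one>\<^bsub>G\<^esub>, \<one>\<^bsub>G\<^esub>) \<in> {z \<in> carrier G \<times> carrier G. inv\<^bsub>G\<^esub> (fst z) \<otimes>\<^bsub>G\<^esub> snd z \<in> N}"
    using N(2) by simp
  ultimately obtain U1 U2 where U: "openin ?X U1" "openin ?X U2" "\<one>\<^bsub>G\<^esub> \<in> U1" "\<one>\<^bsub>G\<^esub> \<in> U2"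
    and UN: "U1 \<times> U2 \<subseteq> {z \<in> carrier G \<times> carrier G. inv\<^bsub>G\<^esub> (fst z) \<otimes>\<^bsub>G\<^esub> snd z \<in> N}"
    unfolding openin_prod_topology_alt by meson
  have "neighbourhood_base_of (compactin ?X) ?X"
    using locally_compact_space_neighbourhood_base[of ?X] locally_compact_manifold[OF g(3)] g(2)
    by (simp add: smooth_manifold_def)
  moreover have "openin ?X (U1 \<inter> U2) \<and> \<one>\<^bsub>G\<^esub> \<in> U1 \<inter> U2" using U by auto
  ultimately obtain V C where VC: "openin ?X V" "compactin ?X C" "\<one>\<^bsub>G\<^esub> \<in> V" "V \<subseteq> C" "C \<subseteq> U1 \<inter> U2"
    unfolding neighbourhood_base_of by meson
  show thesis
  proof (rule that[OF VC(1,3,4,2)])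
    show "C \<subseteq> carrier G" using compactin_subset_topspace[OF VC(2)] g(4) by simp
    show "\<forall>x\<in>C. \<forall>y\<in>C. inv\<^bsub>G\<^esub> x \<otimes>\<^bsub>G\<^esub> y \<in> N"
    proof (intro ballI)
      fix x y assume "x \<in> C" "y \<in> C"
      then have "(x, y) \<in> U1 \<times> U2" using VC(5) by blast
      then have "(x, y) \<in> {z \<in> carrier G \<times> carrier G. inv\<^bsub>G\<^esub> (fst z) \<otimes>\<^bsub>G\<^esub> snd z \<in> N}" using UN by (rule subsetD[rotated])
      then show "inv\<^bsub>G\<^esub> x \<otimes>\<^bsub>G\<^esub> y \<in> N" by simp
    qed
  qed
qed

text \<open>
  The open mapping theorem: \<open>A\<close> is a countable union of translates of a compact neighbourhood of the
  identity, so by Baire the image of one of them has interior in the closed subgroup \<open>i ` carrier A\<close>.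
\<close>

lemma open_at_identity:
  assumes A: "is_lie_group A" and E: "is_lie_group E" and hom: "i \<in> hom A E"
    and cont: "continuous_map (mtop (mfd A)) (mtop (mfd E)) i"
    and inj: "inj_on i (carrier A)" and clo: "closedin (mtop (mfd E)) (i ` carrier A)"
    and N: "openin (mtop (mfd A)) N" "\<one>\<^bsub>A\<^esub> \<in> N"
  shows "\<exists>B. openin (mtop (mfd E)) B \<and> \<one>\<^bsub>E\<^esub> \<in> B \<and> B \<inter> i ` carrier A \<subseteq> i ` N"
proof -
  interpret A: group A by (rule lie_groupD(1)[OF A])
  interpret E: group E by (rule lie_groupD(1)[OF E])
  interpret h: group_hom A E i by unfold_locales (rule hom)
  let ?X = "mtop (mfd A)" and ?Y = "mtop (mfd E)" and ?K = "i ` carrier A"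
  note a = lie_groupD[OF A] and e = lie_groupD[OF E]
  obtain V C where V: "openin ?X V" "\<one>\<^bsub>A\<^esub> \<in> V" "V \<subseteq> C" and C: "compactin ?X C" "C \<subseteq> carrier A"
    and CN: "\<forall>x\<in>C. \<forall>y\<in>C. inv\<^bsub>A\<^esub> x \<otimes>\<^bsub>A\<^esub> y \<in> N"
    using compact_small_neighbourhood[OF A N] by blast
  \<comment> \<open>The translate of \<open>V\<close> by \<open>b\<close>, written as a
    preimage.\<close>
  define T where "T b = {x \<in> carrier A. inv\<^bsub>A\<^esub> b \<otimes>\<^bsub>A\<^esub> x \<in> V}" for b
  have To: "openin ?X (T b)" if "b \<in> carrier A" for b
    unfolding T_def using openin_left_translation[OF A _ V(1)] that by simp
  have bT: "b \<in> T b" if "b \<in> carrier A" for b using that V(2) by (simp add: T_def)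
  have "\<Union> (T ` carrier A) = topspace ?X" using bT by (auto simp: a(4) T_def)
  moreover have "Lindelof_space ?X"
    using a(2) by (simp add: smooth_manifold_def second_countable_imp_Lindelof_space)
  ultimately obtain \<V> where \<V>: "countable \<V>" "\<V> \<subseteq> T ` carrier A" "\<Union>\<V> = topspace ?X"
    unfolding Lindelof_space_def using To by (metis (no_types, lifting) imageE)
  obtain D where D: "countable D" "D \<subseteq> carrier A" "\<V> = T ` D"
    using countable_subset_image[of \<V> T "carrier A"] \<V>(1,2) by blast
  \<comment> \<open>Images of translates of the compact set \<open>C\<close>: compact, hence closed,
    and those with \<open>b \<in> D\<close> are countably many and cover the image of
    \<open>A\<close>.\<close>
  define Z where "Z b = (\<lambda>c. i (b \<otimes>\<^bsub>A\<^esub> c)) ` C" for b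
  let ?S = "subtopology ?Y ?K"
  have KE: "?K \<subseteq> carrier E" by auto
  have tS: "topspace ?S = ?K" using KE by (auto simp: e(4))
  have "closedin ?S (Z b)" if b: "b \<in> carrier A" for b
  proof -
    have "continuous_map ?X ?Y (\<lambda>c. i (b \<otimes>\<^bsub>A\<^esub> c))"
      using continuous_map_compose[OF smooth_map_continuous[OF smooth_map_left_translation[OF A b]] cont]
      by (simp add: o_def)
    from image_compactin[OF C(1) this] have "closedin ?Y (Z b)"
      using e(2) by (auto simp: Z_def smooth_manifold_def intro: compactin_imp_closedin)
    moreover have "Z b \<subseteq> ?K" using C(2) b by (auto simp: Z_def)
    ultimately show ?thesis by (simp add: closedin_closed_subtopology[OF clo])
  qed
  note clZ = this
  have U: "\<Union> (Z ` D) = ?K"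
  proof
    show "\<Union> (Z ` D) \<subseteq> ?K" using C(2) D(2) by (auto simp: Z_def)
    show "?K \<subseteq> \<Union> (Z ` D)"
    proof
      fix y assume "y \<in> ?K"
      then obtain x where x: "x \<in> carrier A" "y = i x" by blast
      then obtain b where b: "b \<in> D" "x \<in> T b" using \<V>(3) D(3) a(4) by auto
      then have "inv\<^bsub>A\<^esub> b \<otimes>\<^bsub>A\<^esub> x \<in> C" using V(3) by (auto simp: T_def)
      moreover have "x = b \<otimes>\<^bsub>A\<^esub> (inv\<^bsub>A\<^esub> b \<otimes>\<^bsub>A\<^esub> x)"
        using x(1) b(1) D(2) by (simp add: A.m_assoc[symmetric] subset_iff)
      ultimately have "y \<in> Z b" unfolding Z_def x(2) by (metis (no_types, lifting) image_eqI)
      then show "y \<in> \<Union> (Z ` D)" using b(1) by blast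
    qed
  qed
  have lc: "locally_compact_space ?S"
    by (rule locally_compact_space_closed_subset[OF locally_compact_manifold[OF e(3)] clo])
  moreover have "Hausdorff_space ?S" using e(2) by (simp add: smooth_manifold_def Hausdorff_space_subtopology)
  ultimately have "regular_space ?S" by (simp add: locally_compact_Hausdorff_imp_regular_space)
  \<comment> \<open>Otherwise the union of the \<open>Z b\<close>, which is the whole subspace,
    would have empty interior.\<close>
  have "\<exists>b\<in>D. ?S interior_of Z b \<noteq> {}"
  proof (rule ccontr)
    assume "\<not> ?thesis"
    then have "?S interior_of \<Union> (Z ` D) = {}"
      using lc \<open>regular_space ?S\<close> D(1,2) clZ
      by (intro Baire_category_alt) auto
    moreover have "?S interior_of topspace ?S = topspace ?S" by (rule interior_of_topspace)
    ultimately show False using U tS h.one_closed by (metis A.one_closed empty_iff image_eqI)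
  qed
  then obtain b k where b: "b \<in> D" and k: "k \<in> ?S interior_of Z b" by blast
  have bA: "b \<in> carrier A" using b D(2) by blast
  have "openin ?S (?S interior_of Z b)" by (rule openin_interior_of)
  then obtain Q where Q: "openin ?Y Q" "?S interior_of Z b = Q \<inter> ?K"
    unfolding openin_subtopology by blast
  have IZ: "?S interior_of Z b \<subseteq> Z b" by (rule interior_of_subset)
  with k have "k \<in> Z b" by (rule subsetD[rotated])
  then obtain c where c: "c \<in> C" "k = i (b \<otimes>\<^bsub>A\<^esub> c)" by (auto simp: Z_def)
  have cA: "c \<in> carrier A" using c C(2) by blast
  have kE: "k \<in> carrier E" using c cA bA by simp
  \<comment> \<open>Translation moves the interior point \<open>k\<close> to the identity of
    \<open>E\<close>.\<close>
  define B where "B = {x \<in> carrier E. k \<otimes>\<^bsub>E\<^esub> x \<in> Q}"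
  have "B \<inter> ?K \<subseteq> i ` N"
  proof
    fix y assume y: "y \<in> B \<inter> ?K"
    then obtain x where x: "x \<in> carrier A" "y = i x" by blast
    have "k \<otimes>\<^bsub>E\<^esub> y = i (b \<otimes>\<^bsub>A\<^esub> c \<otimes>\<^bsub>A\<^esub> x)" using c cA bA x by simp
    moreover have "k \<otimes>\<^bsub>E\<^esub> y \<in> Q" using y by (simp add: B_def)
    moreover have "b \<otimes>\<^bsub>A\<^esub> c \<otimes>\<^bsub>A\<^esub> x \<in> carrier A" using x cA bA by simp
    ultimately have "i (b \<otimes>\<^bsub>A\<^esub> c \<otimes>\<^bsub>A\<^esub> x) \<in> Q \<inter> ?K" by (metis IntI imageI)
    then have "i (b \<otimes>\<^bsub>A\<^esub> c \<otimes>\<^bsub>A\<^esub> x) \<in> Z b" unfolding Q(2)[symmetric] by (rule subsetD[OF IZ])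
    then obtain d where d: "d \<in> C" "i (b \<otimes>\<^bsub>A\<^esub> c \<otimes>\<^bsub>A\<^esub> x) = i (b \<otimes>\<^bsub>A\<^esub> d)" by (auto simp: Z_def)
    have dA: "d \<in> carrier A" using d C(2) by blast
    have "b \<otimes>\<^bsub>A\<^esub> (c \<otimes>\<^bsub>A\<^esub> x) = b \<otimes>\<^bsub>A\<^esub> d"
      using inj_onD[OF inj d(2)] bA cA dA x by (simp add: A.m_assoc)
    then have "c \<otimes>\<^bsub>A\<^esub> x = d" using bA cA dA x by simp
    then have "x = inv\<^bsub>A\<^esub> c \<otimes>\<^bsub>A\<^esub> d" using cA x by (simp add: A.m_assoc[symmetric] flip: \<open>c \<otimes>\<^bsub>A\<^esub> x = d\<close>)
    then show "y \<in> i ` N" using CN c(1) d(1) x(2) by blast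
  qed
  moreover have "openin ?Y B" unfolding B_def by (rule openin_left_translation[OF E kE Q(1)])
  moreover have "\<one>\<^bsub>E\<^esub> \<in> B" using k Q(2) kE by (auto simp: B_def)
  ultimately show ?thesis by blast
qed

text \<open>Openness of \<open>i\<close> onto its image, known at the identity by
  \<open>open_at_identity\<close>, is moved to any other point \<open>i b\<close> by translations in
  \<open>A\<close> and \<open>E\<close>.\<close>

lemma continuous_map_inv_into_image:
  assumes A: "is_lie_group A" and E: "is_lie_group E" and hom: "i \<in> hom A E"
    and cont: "continuous_map (mtop (mfd A)) (mtop (mfd E)) i"
    and inj: "inj_on i (carrier A)" and clo: "closedin (mtop (mfd E)) (i ` carrier A)"
  shows "continuous_map (subtopology (mtop (mfd E)) (i ` carrier A)) (mtop (mfd A)) (inv_into (carrier A) i)"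
proof -
  interpret A: group A by (rule lie_groupD(1)[OF A])
  interpret E: group E by (rule lie_groupD(1)[OF E])
  interpret h: group_hom A E i by unfold_locales (rule hom)
  let ?X = "mtop (mfd A)" and ?Y = "mtop (mfd E)" and ?K = "i ` carrier A" and ?j = "inv_into (carrier A) i"
  note a = lie_groupD[OF A] and e = lie_groupD[OF E]
  have tS: "topspace (subtopology ?Y ?K) = ?K" by (auto simp: e(4))
  show ?thesis
    unfolding continuous_map_def tS
  proof (intro conjI allI impI)
    show "?j \<in> ?K \<rightarrow> topspace ?X" using inj by (auto simp: a(4))
    fix U assume U: "openin ?X U"
    show "openin (subtopology ?Y ?K) {x \<in> ?K. ?j x \<in> U}"
    proof (subst openin_subopen, intro ballI)
      fix x assume "x \<in> {x \<in> ?K. ?j x \<in> U}"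
      then obtain b where b: "b \<in> carrier A" "x = i b" "b \<in> U" using inj by auto
      obtain B where B: "openin ?Y B" "\<one>\<^bsub>E\<^esub> \<in> B" "B \<inter> ?K \<subseteq> i ` {y \<in> carrier A. b \<otimes>\<^bsub>A\<^esub> y \<in> U}"
        using open_at_identity[OF A E hom cont inj clo openin_left_translation[OF A b(1) U]] b by auto
      define W where "W = {y \<in> carrier E. inv\<^bsub>E\<^esub> x \<otimes>\<^bsub>E\<^esub> y \<in> B}"
      have W: "openin ?Y W" unfolding W_def using b by (intro openin_left_translation[OF E _ B(1)]) simp
      have "?j y \<in> U" if y: "y \<in> W \<inter> ?K" for y
      proof -
        obtain d where d: "d \<in> carrier A" "y = i d" using y by blast
        have "inv\<^bsub>E\<^esub> x \<otimes>\<^bsub>E\<^esub> y = i (inv\<^bsub>A\<^esub> b \<otimes>\<^bsub>A\<^esub> d)" using d b by simp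
        moreover have "inv\<^bsub>E\<^esub> x \<otimes>\<^bsub>E\<^esub> y \<in> B" using y by (simp add: W_def)
        moreover have "inv\<^bsub>A\<^esub> b \<otimes>\<^bsub>A\<^esub> d \<in> carrier A" using b d by simp
        ultimately have "i (inv\<^bsub>A\<^esub> b \<otimes>\<^bsub>A\<^esub> d) \<in> B \<inter> ?K" by (metis IntI imageI)
        then obtain c where "c \<in> carrier A" "b \<otimes>\<^bsub>A\<^esub> c \<in> U" "i (inv\<^bsub>A\<^esub> b \<otimes>\<^bsub>A\<^esub> d) = i c" using B(3) by blast
        moreover from this have "inv\<^bsub>A\<^esub> b \<otimes>\<^bsub>A\<^esub> d = c"
          using \<open>inv\<^bsub>A\<^esub> b \<otimes>\<^bsub>A\<^esub> d \<in> carrier A\<close> inj_onD[OF inj] by blast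
        ultimately have "b \<otimes>\<^bsub>A\<^esub> (inv\<^bsub>A\<^esub> b \<otimes>\<^bsub>A\<^esub> d) \<in> U" by simp
        then have "d \<in> U" using b d by (simp add: A.m_assoc[symmetric])
        then show ?thesis using d inj by simp
      qed
      moreover have "x \<in> W \<inter> ?K" using b B(2) by (auto simp: W_def)
      ultimately show "\<exists>T. openin (subtopology ?Y ?K) T \<and> x \<in> T \<and> T \<subseteq> {x \<in> ?K. ?j x \<in> U}"
        using W by (intro exI[of _ "W \<inter> ?K"]) (auto simp: openin_subtopology)
    qed
  qed
qed

text \<open>Coordinates from the dimension on are zero, so the first ones determine the value of the
  chart, which is injective.\<close>

lemma charts_separate:
  assumes M: "charted M" and V: "(V, \<psi>) \<in> atlas M" and x: "x \<in> V" "y \<in> V" "\<forall>j<mdim M. \<psi> x j = \<psi> y j"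
  shows "x = y"
proof -
  note c = charted_chart[OF M V]
  have "\<psi> x \<in> euc (mdim M)" "\<psi> y \<in> euc (mdim M)"
    using x is_chartD(3)[OF c(1)] openin_Euclidean_subset by blast+
  then have "\<psi> x = \<psi> y" using x(3) by (auto simp: mem_euc fun_eq_iff) (metis not_le)
  then show ?thesis using c(3) x by (auto dest: inj_onD)
qed

text \<open>Read in charts, \<open>i\<close> becomes an injective smooth map of Euclidean open sets.
  The location of \<open>B\<close> cannot be prescribed, since an injective smooth map may fail to
  be an immersion at a given point.\<close>

lemma smooth_local_left_inverse:
  assumes A: "charted A" "topspace (mtop A) \<noteq> {}" and E: "charted E" and i: "smooth_map A E i"
    and inj: "inj_on i (topspace (mtop A))"
  obtains B U \<phi> V \<psi> Q J \<eta> where "openin (mtop A) B" "B \<noteq> {}" "(U, \<phi>) \<in> atlas A" "B \<subseteq> U"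
    "(V, \<psi>) \<in> atlas E" "i ` B \<subseteq> V" "openin (Euclidean_space (mdim A)) Q"
    "\<forall>k<mdim A. J k < mdim E" "\<forall>k<mdim A. smooth_on (mdim A) Q (\<lambda>p. \<eta> p k)"
    "\<forall>x\<in>B. (\<lambda>k. if k < mdim A then \<psi> (i x) (J k) else 0) \<in> Q \<and>
       \<eta> (\<lambda>k. if k < mdim A then \<psi> (i x) (J k) else 0) = \<phi> x"
proof -
  obtain a where a: "a \<in> topspace (mtop A)" using A(2) by blast
  obtain U \<phi> where U: "(U, \<phi>) \<in> atlas A" "a \<in> U" using charted_cover[OF A(1) a] .
  obtain V \<psi> where V: "(V, \<psi>) \<in> atlas E" "i a \<in> V" using charted_cover[OF E smooth_map_mem[OF i a]] .
  note cU = charted_chart[OF A(1) U(1)] and cV = charted_chart[OF E V(1)]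
  define W where "W = {x \<in> topspace (mtop A). i x \<in> V}"
  have W: "openin (mtop A) W" unfolding W_def by (rule openin_preimage[OF i cV(2)])
  define P where "P = \<phi> ` (U \<inter> W)"
  have P: "openin (Euclidean_space (mdim A)) P" unfolding P_def by (rule is_chart_open_image[OF cU(1) W])
  have P0: "P \<noteq> {}" using U V a by (auto simp: P_def W_def)
  define F where "F p = \<psi> (i (inv_into U \<phi> p))" for p
  have F: "\<forall>j<mdim E. smooth_on (mdim A) P (\<lambda>p. F p j)"
  proof (intro allI impI)
    fix j assume j: "j < mdim E"
    show "smooth_on (mdim A) P (\<lambda>p. F p j)" unfolding F_def
      by (rule smooth_on_mono[OF smooth_funD[OF smooth_map_chart[OF i V(1) j] U(1)]]) (auto simp: P_def W_def)
  qed
  have Finj: "\<forall>x\<in>P. \<forall>y\<in>P. (\<forall>j<mdim E. F x j = F y j) \<longrightarrow> x = y"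
  proof (intro ballI impI)
    fix p q assume pq: "p \<in> P" "q \<in> P" "\<forall>j<mdim E. F p j = F q j"
    then obtain x y where x: "x \<in> U" "x \<in> W" "p = \<phi> x" and y: "y \<in> U" "y \<in> W" "q = \<phi> y" by (auto simp: P_def)
    have "i x = i y"
      by (rule charts_separate[OF E V(1)]) (use pq(3) x y cU(3) in \<open>auto simp: W_def F_def\<close>)
    then have "x = y" using inj x y by (auto simp: W_def dest: inj_onD)
    then show "p = q" using x y by simp
  qed
  obtain U' Q J \<eta> where U': "openin (Euclidean_space (mdim A)) U'" "U' \<subseteq> P" "U' \<noteq> {}"
    and Q: "openin (Euclidean_space (mdim A)) Q"
    "\<forall>k<mdim A. J k < mdim E" "\<forall>k<mdim A. smooth_on (mdim A) Q (\<lambda>y. \<eta> y k)"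
    and \<eta>: "\<forall>x\<in>U'. (\<lambda>k. if k < mdim A then F x (J k) else 0) \<in> Q \<and> \<eta> (\<lambda>k. if k < mdim A then F x (J k) else 0) = x"
    by (rule injective_smooth_left_inverse[OF P P0 F Finj])
  define B where "B = {x \<in> U. \<phi> x \<in> U'}"
  have BW: "x \<in> W" if "x \<in> B" for x
  proof -
    have "\<phi> x \<in> \<phi> ` (U \<inter> W)" using that U'(2) by (auto simp: B_def P_def)
    then show ?thesis using that cU(3) by (auto simp: B_def dest: inj_onD)
  qed
  show thesis
  proof (rule that[OF _ _ U(1) _ V(1) _ Q])
    show "openin (mtop A) B" unfolding B_def by (rule is_chart_open_preimage[OF cU(1) U'(1)])
    show "B \<noteq> {}" using U'(2,3) by (auto simp: B_def P_def)
    show "B \<subseteq> U" by (auto simp: B_def)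
    show "i ` B \<subseteq> V" using BW by (auto simp: W_def)
    show "\<forall>x\<in>B. (\<lambda>k. if k < mdim A then \<psi> (i x) (J k) else 0) \<in> Q \<and>
       \<eta> (\<lambda>k. if k < mdim A then \<psi> (i x) (J k) else 0) = \<phi> x"
    proof
      fix x assume "x \<in> B"
      then have x: "\<phi> x \<in> U'" "F (\<phi> x) = \<psi> (i x)" using cU(3) by (auto simp: B_def F_def)
      show "(\<lambda>k. if k < mdim A then \<psi> (i x) (J k) else 0) \<in> Q \<and>
       \<eta> (\<lambda>k. if k < mdim A then \<psi> (i x) (J k) else 0) = \<phi> x"
        using \<eta>[rule_format, OF x(1)] unfolding x(2) .
    qed
  qed
qed

text \<open>
  Note that \<open>i\<close> is not assumed to be an immersion. Translating in \<open>A\<close> moves any point of the image to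
  a spot where a smooth left inverse of \<open>i\<close> is available.
\<close>

lemma smooth_map_inv_into_image:
  assumes A: "is_lie_group A" and E: "is_lie_group E" and hom: "i \<in> hom A E"
    and i: "smooth_map (mfd A) (mfd E) i"
    and inj: "inj_on i (carrier A)" and clo: "closedin (mtop (mfd E)) (i ` carrier A)"
    and M: "charted M" and f: "smooth_map M (mfd E) f" "f ` topspace (mtop M) \<subseteq> i ` carrier A"
  shows "smooth_map M (mfd A) (\<lambda>x. inv_into (carrier A) i (f x))"
proof -
  interpret A: group A by (rule lie_groupD(1)[OF A])
  interpret E: group E by (rule lie_groupD(1)[OF E])
  interpret h: group_hom A E i by unfold_locales (rule hom)
  let ?X = "mtop (mfd A)" and ?Y = "mtop (mfd E)" and ?n = "mdim (mfd A)"
  note a = lie_groupD[OF A] and e = lie_groupD[OF E]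
  define j where "j x = inv_into (carrier A) i (f x)" for x
  have j: "j x \<in> carrier A" "i (j x) = f x" if "x \<in> topspace (mtop M)" for x
    using f(2) that by (auto simp: j_def inv_into_into f_inv_into_f image_subset_iff)
  \<comment> \<open>Continuity comes first: it makes the sets \<open>W\<close> below open, on which
    a single chart and the local left inverse can be used.\<close>
  have cj: "continuous_map (mtop M) ?X j"
  proof -
    have "continuous_map (mtop M) (subtopology ?Y (i ` carrier A)) f"
      using smooth_map_continuous[OF f(1)] f(2) by (auto simp: continuous_map_in_subtopology)
    from continuous_map_compose[OF this continuous_map_inv_into_image[OF A E hom smooth_map_continuous[OF i] inj clo]]
    show ?thesis by (simp add: j_def[abs_def] o_def)
  qed
  obtain B U \<phi> V \<psi> Q J \<eta> where B: "openin ?X B" "B \<noteq> {}" and U: "(U, \<phi>) \<in> atlas (mfd A)" "B \<subseteq> U"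
    and V: "(V, \<psi>) \<in> atlas (mfd E)" "i ` B \<subseteq> V" and Q: "openin (Euclidean_space ?n) Q"
    and J: "\<forall>k<?n. J k < mdim (mfd E)" and \<eta>s: "\<forall>k<?n. smooth_on ?n Q (\<lambda>p. \<eta> p k)"
    and \<eta>: "\<forall>x\<in>B. (\<lambda>k. if k < ?n then \<psi> (i x) (J k) else 0) \<in> Q \<and>
       \<eta> (\<lambda>k. if k < ?n then \<psi> (i x) (J k) else 0) = \<phi> x"
    by (rule smooth_local_left_inverse[OF a(3) _ e(3) i]) (use inj A.one_closed a(4) in auto)
  note cU = charted_chart[OF a(3) U(1)]
  obtain a0 where a0: "a0 \<in> B" using B(2) by blast
  have a0A: "a0 \<in> carrier A" using openin_subset[OF B(1)] a0 a(4) by auto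
  have "smooth_map M (mfd A) j"
    unfolding smooth_map_iff
  proof safe
    fix V2 \<psi>2 l assume V2: "(V2, \<psi>2) \<in> atlas (mfd A)" and l: "l < ?n"
    note cV2 = charted_chart[OF a(3) V2]
    have "smooth_fun M (j -` V2 \<inter> topspace (mtop M)) (\<lambda>x. \<psi>2 (j x) l)"
    proof (rule smooth_fun_local[OF M])
      fix x0 assume x0: "x0 \<in> j -` V2 \<inter> topspace (mtop M)"
      \<comment> \<open>Left translation by \<open>c\<close> takes \<open>j x0\<close> to
        \<open>a0\<close>, around which the local left inverse is available.\<close>
      define c where "c = a0 \<otimes>\<^bsub>A\<^esub> inv\<^bsub>A\<^esub> j x0"
      have cA: "c \<in> carrier A" using a0A j(1) x0 by (simp add: c_def)
      have cx0: "c \<otimes>\<^bsub>A\<^esub> j x0 = a0" using a0A j(1) x0 by (simp add: c_def A.m_assoc)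
      have f1: "smooth_map M (mfd E) (\<lambda>x. i c \<otimes>\<^bsub>E\<^esub> f x)"
        by (rule smooth_map_mult[OF E M smooth_map_const f(1)]) (simp add: cA e(4))
      have if1: "i (c \<otimes>\<^bsub>A\<^esub> j x) = i c \<otimes>\<^bsub>E\<^esub> f x" if "x \<in> topspace (mtop M)" for x
        using cA j[OF that] by simp
      have ch: "continuous_map (mtop M) ?X (\<lambda>x. c \<otimes>\<^bsub>A\<^esub> j x)"
        using continuous_map_compose[OF cj smooth_map_continuous[OF smooth_map_left_translation[OF A cA]]]
        by (simp add: o_def)
      define W where "W = {x \<in> topspace (mtop M). j x \<in> V2} \<inter> {x \<in> topspace (mtop M). c \<otimes>\<^bsub>A\<^esub> j x \<in> B}"
      have W: "openin (mtop M) W" unfolding W_def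
        by (intro openin_Int openin_continuous_map_preimage[OF cj cV2(2)] openin_continuous_map_preimage[OF ch B(1)])
      have x0W: "x0 \<in> W" using x0 cx0 a0 by (auto simp: W_def)
      \<comment> \<open>Selected coordinates of \<open>i (c \<otimes> j x)\<close>. They are smooth
        in \<open>x\<close> because this element equals \<open>i c \<otimes> f x\<close>, and
        \<open>\<eta>\<close> turns them into the coordinates of
        \<open>c \<otimes> j x\<close>.\<close>
      define G where "G x = (\<lambda>k. if k < ?n then \<psi> (i c \<otimes>\<^bsub>E\<^esub> f x) (J k) else 0)" for x
      have G: "G x \<in> Q" "\<eta> (G x) = \<phi> (c \<otimes>\<^bsub>A\<^esub> j x)" if "x \<in> W" for x
      proof -
        have x: "x \<in> topspace (mtop M)" "c \<otimes>\<^bsub>A\<^esub> j x \<in> B" using that by (auto simp: W_def)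
        show "G x \<in> Q" "\<eta> (G x) = \<phi> (c \<otimes>\<^bsub>A\<^esub> j x)"
          using \<eta>[rule_format, OF x(2)] unfolding G_def if1[OF x(1)] by blast+
      qed
      have sG: "smooth_fun M W (\<lambda>x. G x k)" if k: "k < ?n" for k
      proof -
        have "smooth_fun M W (\<lambda>x. \<psi> (i c \<otimes>\<^bsub>E\<^esub> f x) (J k))"
          by (rule smooth_fun_mono[OF smooth_map_chart[OF f1 V(1)]])
            (use J k V(2) if1 in \<open>auto simp: W_def\<close>)
        then show ?thesis using k by (simp add: G_def)
      qed
      have s\<phi>: "smooth_fun M W (\<lambda>x. \<phi> (c \<otimes>\<^bsub>A\<^esub> j x) k)" if k: "k < ?n" for k
      proof -
        have "smooth_fun M W (\<lambda>x. \<eta> (G x) k)"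
          by (rule smooth_fun_compose[OF M W Q \<eta>s[rule_format, OF k] sG G(1)])
        then show ?thesis by (subst smooth_fun_cong[OF M W, of _ "\<lambda>x. \<eta> (G x) k"]) (use G(2) in auto)
      qed
      \<comment> \<open>The way back: translation by \<open>inv c\<close> leads from the chart
        \<open>U\<close> into the chart \<open>V2\<close>, in which smoothness of \<open>j\<close>
        is to be tested.\<close>
      define D where "D = {y \<in> carrier A. inv\<^bsub>A\<^esub> c \<otimes>\<^bsub>A\<^esub> y \<in> V2}"
      have D: "openin ?X D" unfolding D_def using cA by (intro openin_left_translation[OF A _ cV2(2)]) simp
      have "smooth_fun (mfd A) D (\<lambda>y. \<psi>2 (inv\<^bsub>A\<^esub> c \<otimes>\<^bsub>A\<^esub> y) l)"
        by (rule smooth_fun_mono[OF smooth_map_chart[OF smooth_map_left_translation[OF A] V2 l]])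
          (use cA in \<open>auto simp: D_def\<close>)
      from smooth_funD[OF this U(1)]
      have sD: "smooth_on ?n (\<phi> ` (U \<inter> D)) (\<lambda>p. \<psi>2 (inv\<^bsub>A\<^esub> c \<otimes>\<^bsub>A\<^esub> inv_into U \<phi> p) l)" .
      have xD: "c \<otimes>\<^bsub>A\<^esub> j x \<in> U \<inter> D" "inv\<^bsub>A\<^esub> c \<otimes>\<^bsub>A\<^esub> (c \<otimes>\<^bsub>A\<^esub> j x) = j x" if "x \<in> W" for x
      proof -
        show *: "inv\<^bsub>A\<^esub> c \<otimes>\<^bsub>A\<^esub> (c \<otimes>\<^bsub>A\<^esub> j x) = j x"
          using that cA j(1)[of x] by (simp add: W_def A.m_assoc[symmetric])
        show "c \<otimes>\<^bsub>A\<^esub> j x \<in> U \<inter> D" using that U(2) cA j(1)[of x] by (auto simp: D_def W_def *)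
      qed
      have "smooth_fun M W (\<lambda>x. \<psi>2 (inv\<^bsub>A\<^esub> c \<otimes>\<^bsub>A\<^esub> inv_into U \<phi> (\<phi> (c \<otimes>\<^bsub>A\<^esub> j x))) l)"
        by (rule smooth_fun_compose[OF M W is_chart_open_image[OF cU(1) D] sD s\<phi>]) (use xD(1) in auto)
      then have "smooth_fun M W (\<lambda>x. \<psi>2 (j x) l)"
        by (subst smooth_fun_cong[OF M W, of _ "\<lambda>x. \<psi>2 (inv\<^bsub>A\<^esub> c \<otimes>\<^bsub>A\<^esub> inv_into U \<phi> (\<phi> (c \<otimes>\<^bsub>A\<^esub> j x))) l"])
          (use xD cU(3) in auto)
      then show "\<exists>W'. openin (mtop M) W' \<and> x0 \<in> W' \<and> W' \<subseteq> j -` V2 \<inter> topspace (mtop M) \<and>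
          smooth_fun M W' (\<lambda>x. \<psi>2 (j x) l)"
        using W x0W by (intro exI[of _ W]) (auto simp: W_def)
    qed
    then show "smooth_fun M (j -` V2) (\<lambda>x. \<psi>2 (j x) l)" by (rule smooth_fun_Int_topspace[OF M])
  qed (fact cj)
  then show ?thesis by (simp only: j_def[abs_def])
qed

section \<open>Cochains in low degrees\<close>

text \<open>The index set is written \<open>{1..1}\<close>, and similarly below, because arguments
  of cochains occur as restrictions to \<open>{1..n}\<close> in \<open>coboundary\<close> and
  \<open>transp_act\<close>; \<open>restrict_tuple1\<close> and its companions then rewrite them
  directly.\<close>

definition tuple1 :: "'g \<Rightarrow> nat \<Rightarrow> 'g" where "tuple1 g = (\<lambda>j\<in>{1..1}. g)"

definition tuple2 :: "'g \<Rightarrow> 'g \<Rightarrow> nat \<Rightarrow> 'g" where "tuple2 g h = (\<lambda>j\<in>{1..2}. if j = 1 then g else h)"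

definition tuple3 :: "'g \<Rightarrow> 'g \<Rightarrow> 'g \<Rightarrow> nat \<Rightarrow> 'g" where
  "tuple3 g h k = (\<lambda>j\<in>{1..3}. if j = 1 then g else if j = 2 then h else k)"

lemma restrict_tuple1: "restrict F {1..1} = tuple1 (F 1)"
  by (auto simp: tuple1_def fun_eq_iff)

lemma restrict_tuple2: "restrict F {1..2} = tuple2 (F 1) (F 2)"
  by (auto simp: tuple2_def fun_eq_iff restrict_def intro!: arg_cong[of _ _ F])

lemma restrict_tuple3: "restrict F {1..3} = tuple3 (F 1) (F 2) (F 3)"
  by (auto simp: tuple3_def fun_eq_iff restrict_def intro!: arg_cong[of _ _ F])

lemma tuple_nth:
  "tuple1 g 1 = g" "tuple2 g h 1 = g" "tuple2 g h 2 = h"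
  "tuple3 g h k 1 = g" "tuple3 g h k 2 = h" "tuple3 g h k 3 = k"
  by (simp_all add: tuple1_def tuple2_def tuple3_def)

lemma tuple_in_tuples:
  "g \<in> carrier G \<Longrightarrow> tuple1 g \<in> tuples G 1"
  "g \<in> carrier G \<Longrightarrow> h \<in> carrier G \<Longrightarrow> tuple2 g h \<in> tuples G 2"
  "g \<in> carrier G \<Longrightarrow> h \<in> carrier G \<Longrightarrow> k \<in> carrier G \<Longrightarrow> tuple3 g h k \<in> tuples G 3"
  by (auto simp: tuple1_def tuple2_def tuple3_def)

lemma tuples_eq_tuple:
  "x \<in> tuples G 1 \<Longrightarrow> x = tuple1 (x 1)"
  "x \<in> tuples G 2 \<Longrightarrow> x = tuple2 (x 1) (x 2)"
  "x \<in> tuples G 3 \<Longrightarrow> x = tuple3 (x 1) (x 2) (x 3)"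
  by (metis PiE_restrict restrict_tuple1, metis PiE_restrict restrict_tuple2, metis PiE_restrict restrict_tuple3)

lemma tuples_nth: "x \<in> tuples G n \<Longrightarrow> 1 \<le> j \<Longrightarrow> j \<le> n \<Longrightarrow> x j \<in> carrier G"
  by auto

lemma topspace_power_manifold:
  "topspace (mtop (mfd G)) = carrier G \<Longrightarrow> topspace (mtop (power_manifold n (mfd G))) = tuples G n"
  by simp

section \<open>Smooth modules and their cochains in degrees one and two\<close>

locale lie_module =
  fixes G :: "'g lie_group" and A :: "'a lie_group" and act :: "'g \<Rightarrow> 'a \<Rightarrow> 'a"
  assumes G: "is_lie_group G" and module: "smooth_module G A act"
begin

lemma A: "is_lie_group A" and A_comm: "comm_group A" and act_hom: "act \<in> hom G (AutoGroup A)"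
  and act_smooth: "smooth_map (prod_manifold (mfd G) (mfd A)) (mfd A) (\<lambda>(g, a). act g a)"
  using module by (auto simp: smooth_module_def)

sublocale G: group G by (rule lie_groupD(1)[OF G])
sublocale A: comm_group A by (rule A_comm)

lemmas lieG = lie_groupD[OF G] and lieA = lie_groupD[OF A]

lemma act_auto: "g \<in> carrier G \<Longrightarrow> act g \<in> auto A"
  using hom_in_carrier[OF act_hom] by (simp add: AutoGroup_def)

lemma act_group_hom: "g \<in> carrier G \<Longrightarrow> group_hom A A (act g)"
  using act_auto by unfold_locales (auto simp: auto_def)

lemma act_closed [simp]: "g \<in> carrier G \<Longrightarrow> a \<in> carrier A \<Longrightarrow> act g a \<in> carrier A"
  using group_hom.hom_closed[OF act_group_hom] .

lemma act_mult: "g \<in> carrier G \<Longrightarrow> a \<in> carrier A \<Longrightarrow> b \<in> carrier A \<Longrightarrow> act g (a \<otimes>\<^bsub>A\<^esub> b) = act g a \<otimes>\<^bsub>A\<^esub> act g b"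
  using group_hom.hom_mult[OF act_group_hom] .

lemma act_inv: "g \<in> carrier G \<Longrightarrow> a \<in> carrier A \<Longrightarrow> act g (inv\<^bsub>A\<^esub> a) = inv\<^bsub>A\<^esub> (act g a)"
  using group_hom.hom_inv[OF act_group_hom] .

lemma act_unit: "g \<in> carrier G \<Longrightarrow> act g \<one>\<^bsub>A\<^esub> = \<one>\<^bsub>A\<^esub>"
  using group_hom.hom_one[OF act_group_hom] .

lemma act_act:
  assumes "g \<in> carrier G" "h \<in> carrier G" "a \<in> carrier A"
  shows "act (g \<otimes>\<^bsub>G\<^esub> h) a = act g (act h a)"
proof -
  have "act (g \<otimes>\<^bsub>G\<^esub> h) = act g \<otimes>\<^bsub>AutoGroup A\<^esub> act h" using hom_mult[OF act_hom] assms by blast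
  then show ?thesis using assms act_auto[of g] act_auto[of h]
    by (simp add: AutoGroup_def BijGroup_def auto_def compose_def)
qed

text \<open>\<open>act \<one>\<close> is idempotent because \<open>\<one>\<close> is, and injective
  because it is an automorphism.\<close>

lemma act_one: "a \<in> carrier A \<Longrightarrow> act \<one>\<^bsub>G\<^esub> a = a"
proof -
  assume a: "a \<in> carrier A"
  have "act \<one>\<^bsub>G\<^esub> (act \<one>\<^bsub>G\<^esub> a) = act \<one>\<^bsub>G\<^esub> a" using act_act[of "\<one>\<^bsub>G\<^esub>" "\<one>\<^bsub>G\<^esub>" a] a by simp
  moreover have "inj_on (act \<one>\<^bsub>G\<^esub>) (carrier A)"
    using act_auto[of "\<one>\<^bsub>G\<^esub>"] by (auto simp: auto_def Bij_def bij_betw_def)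
  ultimately show ?thesis using a by (auto dest: inj_onD)
qed

lemma smooth_map_act:
  assumes M: "charted M" and f: "smooth_map M (mfd G) f" and g: "smooth_map M (mfd A) g"
  shows "smooth_map M (mfd A) (\<lambda>x. act (f x) (g x))"
  using smooth_map_compose[OF M charted_prod_manifold[OF lieG(3) lieA(3)] lieA(3) smooth_map_pair[OF f g] act_smooth]
  by simp

lemma cochains_iff:
  "\<sigma> \<in> cochains G A n \<longleftrightarrow> \<sigma> \<in> extensional (tuples G n) \<and> smooth_map (power_manifold n (mfd G)) (mfd A) \<sigma>"
  by (simp add: cochains_def)

lemma cochain_closed: "\<sigma> \<in> cochains G A n \<Longrightarrow> x \<in> tuples G n \<Longrightarrow> \<sigma> x \<in> carrier A"
  using smooth_map_mem[of "power_manifold n (mfd G)" "mfd A" \<sigma> x] topspace_power_manifold[OF lieG(4), of n] lieA(4)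
  by (auto simp: cochains_iff)

abbreviation "GG \<equiv> prod_manifold (mfd G) (mfd G)"

lemma GG: "charted GG" "topspace (mtop GG) = carrier G \<times> carrier G"
  using charted_prod_manifold[OF lieG(3,3)] lieG(4) by simp_all

lemma power_charted: "charted (power_manifold n (mfd G))"
  by (rule charted_power_manifold[OF lieG(3)])

lemma smooth_tuple1: "\<sigma> \<in> cochains G A 1 \<Longrightarrow> smooth_map (mfd G) (mfd A) (\<lambda>g. \<sigma> (tuple1 g))"
proof -
  assume "\<sigma> \<in> cochains G A 1"
  then have "smooth_map (power_manifold 1 (mfd G)) (mfd A) \<sigma>" by (simp add: cochains_iff)
  moreover have "smooth_map (mfd G) (power_manifold 1 (mfd G)) (\<lambda>x. \<lambda>i\<in>{1..1}. x)"
    by (rule smooth_map_into_power[where f = "\<lambda>_ x. x"]) (rule smooth_map_id[OF lieG(2)])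
  ultimately show ?thesis
    using smooth_map_compose[OF lieG(3) power_charted lieA(3)] by (simp only: tuple1_def)
qed

lemma smooth_tuple2: "\<sigma> \<in> cochains G A 2 \<Longrightarrow> smooth_map GG (mfd A) (\<lambda>z. \<sigma> (tuple2 (fst z) (snd z)))"
proof -
  assume "\<sigma> \<in> cochains G A 2"
  then have "smooth_map (power_manifold 2 (mfd G)) (mfd A) \<sigma>" by (simp add: cochains_iff)
  moreover have "smooth_map GG (power_manifold 2 (mfd G)) (\<lambda>z. \<lambda>i\<in>{1..2}. if i = 1 then fst z else snd z)"
  proof (rule smooth_map_into_power[where f = "\<lambda>i z. if i = 1 then fst z else snd z"])
    show "smooth_map GG (mfd G) (\<lambda>z. if i = 1 then fst z else snd z)" for i :: nat
      using smooth_map_fst[OF lieG(2,3)] smooth_map_snd[OF lieG(3,2)] by (cases "i = 1") simp_all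
  qed
  ultimately show ?thesis
    using smooth_map_compose[OF GG(1) power_charted lieA(3)] by (simp only: tuple2_def)
qed

lemma cochain1I:
  assumes "smooth_map (mfd G) (mfd A) f"
  shows "(\<lambda>x\<in>tuples G 1. f (x 1)) \<in> cochains G A 1"
proof -
  have "smooth_map (power_manifold 1 (mfd G)) (mfd A) (\<lambda>x. f (x 1))"
    by (rule smooth_map_compose[OF power_charted lieG(3) lieA(3) smooth_map_power_projection[OF lieG(2)] assms]) simp
  then have "smooth_map (power_manifold 1 (mfd G)) (mfd A) (\<lambda>x\<in>tuples G 1. f (x 1))"
    by (rule smooth_map_cong[OF power_charted lieA(3)])
      (unfold topspace_power_manifold[OF lieG(4)], rule restrict_apply'[symmetric])
  then show ?thesis by (simp add: cochains_iff)
qed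

lemma cochain2I:
  assumes "smooth_map GG (mfd A) (\<lambda>z. f (fst z) (snd z))"
  shows "(\<lambda>x\<in>tuples G 2. f (x 1) (x 2)) \<in> cochains G A 2"
proof -
  have "smooth_map (power_manifold 2 (mfd G)) GG (\<lambda>x. (x 1, x 2))"
    by (rule smooth_map_pair; rule smooth_map_power_projection[OF lieG(2)]) simp_all
  from smooth_map_compose[OF power_charted GG(1) lieA(3) this assms]
  have "smooth_map (power_manifold 2 (mfd G)) (mfd A) (\<lambda>x. f (x 1) (x 2))" by simp
  then have "smooth_map (power_manifold 2 (mfd G)) (mfd A) (\<lambda>x\<in>tuples G 2. f (x 1) (x 2))"
    by (rule smooth_map_cong[OF power_charted lieA(3)])
      (unfold topspace_power_manifold[OF lieG(4)], rule restrict_apply'[symmetric])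
  then show ?thesis by (simp add: cochains_iff)
qed

text \<open>Every operator in \<open>sym_acts\<close> is a composite of adjacent transpositions, so
  invariance under these generators passes on by induction.\<close>

lemma sym_cochains_iff:
  "\<sigma> \<in> sym_cochains G A act n \<longleftrightarrow> \<sigma> \<in> cochains G A n \<and> (\<forall>i\<in>{1..n}. transp_act G A act n i \<sigma> = \<sigma>)"
proof (intro iffI conjI ballI)
  assume *: "\<sigma> \<in> sym_cochains G A act n"
  then show "\<sigma> \<in> cochains G A n" by (simp add: sym_cochains_def)
  fix i assume "i \<in> {1..n}"
  then have "sym_acts G A act n (Transposition.transpose i (i + 1) \<circ> id) (transp_act G A act n i \<circ> id)"
    by (intro sym_acts.intros) auto
  then show "transp_act G A act n i \<sigma> = \<sigma>" using * unfolding sym_cochains_def by fastforce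
next
  assume *: "\<sigma> \<in> cochains G A n \<and> (\<forall>i\<in>{1..n}. transp_act G A act n i \<sigma> = \<sigma>)"
  have "F \<sigma> = \<sigma>" if "sym_acts G A act n p F" for p F
    using that by induction (use * in auto)
  with * show "\<sigma> \<in> sym_cochains G A act n" by (simp add: sym_cochains_def)
qed

lemma extensional_eq_iff:
  "\<sigma> \<in> extensional S \<Longrightarrow> restrict f S = \<sigma> \<longleftrightarrow> (\<forall>x\<in>S. f x = \<sigma> x)"
  by (auto simp: extensional_def fun_eq_iff)

lemma ball_tuples1: "(\<forall>x\<in>tuples G 1. P x) \<longleftrightarrow> (\<forall>g\<in>carrier G. P (tuple1 g))"
proof
  assume *: "\<forall>g\<in>carrier G. P (tuple1 g)"
  show "\<forall>x\<in>tuples G 1. P x"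
  proof
    fix x assume x: "x \<in> tuples G 1"
    have "P (tuple1 (x 1))" using * tuples_nth[OF x] by simp
    then show "P x" using tuples_eq_tuple(1)[OF x] by simp
  qed
qed (use tuple_in_tuples(1)[of _ G] in blast)

lemma ball_tuples2: "(\<forall>x\<in>tuples G 2. P x) \<longleftrightarrow> (\<forall>g\<in>carrier G. \<forall>h\<in>carrier G. P (tuple2 g h))"
proof
  assume *: "\<forall>g\<in>carrier G. \<forall>h\<in>carrier G. P (tuple2 g h)"
  show "\<forall>x\<in>tuples G 2. P x"
  proof
    fix x assume x: "x \<in> tuples G 2"
    have "P (tuple2 (x 1) (x 2))" using * tuples_nth[OF x] by simp
    then show "P x" using tuples_eq_tuple(2)[OF x] by simp
  qed
qed (use tuple_in_tuples(2)[of _ G] in blast)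

lemma ball_tuples3:
  "(\<forall>x\<in>tuples G 3. P x) \<longleftrightarrow> (\<forall>g\<in>carrier G. \<forall>h\<in>carrier G. \<forall>k\<in>carrier G. P (tuple3 g h k))"
proof
  assume *: "\<forall>g\<in>carrier G. \<forall>h\<in>carrier G. \<forall>k\<in>carrier G. P (tuple3 g h k)"
  show "\<forall>x\<in>tuples G 3. P x"
  proof
    fix x assume x: "x \<in> tuples G 3"
    have "P (tuple3 (x 1) (x 2) (x 3))" using * tuples_nth[OF x] by simp
    then show "P x" using tuples_eq_tuple(3)[OF x] by simp
  qed
qed (use tuple_in_tuples(3)[of _ G] in blast)

lemma sym_cochains1_iff:
  "\<sigma> \<in> sym_cochains G A act 1 \<longleftrightarrow> \<sigma> \<in> cochains G A 1 \<and>
     (\<forall>g\<in>carrier G. inv\<^bsub>A\<^esub> (act g (\<sigma> (tuple1 (inv\<^bsub>G\<^esub> g)))) = \<sigma> (tuple1 g))"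
proof -
  have "transp_act G A act 1 1 \<sigma> = \<sigma> \<longleftrightarrow>
     (\<forall>g\<in>carrier G. inv\<^bsub>A\<^esub> (act g (\<sigma> (tuple1 (inv\<^bsub>G\<^esub> g)))) = \<sigma> (tuple1 g))"
    if "\<sigma> \<in> cochains G A 1"
  proof -
    have e: "\<sigma> \<in> extensional (tuples G 1)" using that by (simp add: cochains_iff)
    show ?thesis
      unfolding transp_act_def extensional_eq_iff[OF e] ball_tuples1 restrict_tuple1 by (simp add: tuple_nth[unfolded One_nat_def])
  qed
  moreover have "{1..1::nat} = {1}" by simp
  ultimately show ?thesis unfolding sym_cochains_iff by (metis singletonD singletonI)
qed

lemma sym_cochains2_iff:
  "\<sigma> \<in> sym_cochains G A act 2 \<longleftrightarrow> \<sigma> \<in> cochains G A 2 \<and>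
     (\<forall>g\<in>carrier G. \<forall>h\<in>carrier G. inv\<^bsub>A\<^esub> (act g (\<sigma> (tuple2 (inv\<^bsub>G\<^esub> g) (g \<otimes>\<^bsub>G\<^esub> h)))) = \<sigma> (tuple2 g h)) \<and>
     (\<forall>g\<in>carrier G. \<forall>h\<in>carrier G. inv\<^bsub>A\<^esub> (\<sigma> (tuple2 (g \<otimes>\<^bsub>G\<^esub> h) (inv\<^bsub>G\<^esub> h))) = \<sigma> (tuple2 g h))"
proof -
  have "transp_act G A act 2 1 \<sigma> = \<sigma> \<longleftrightarrow>
     (\<forall>g\<in>carrier G. \<forall>h\<in>carrier G. inv\<^bsub>A\<^esub> (act g (\<sigma> (tuple2 (inv\<^bsub>G\<^esub> g) (g \<otimes>\<^bsub>G\<^esub> h)))) = \<sigma> (tuple2 g h))"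
    "transp_act G A act 2 2 \<sigma> = \<sigma> \<longleftrightarrow>
     (\<forall>g\<in>carrier G. \<forall>h\<in>carrier G. inv\<^bsub>A\<^esub> (\<sigma> (tuple2 (g \<otimes>\<^bsub>G\<^esub> h) (inv\<^bsub>G\<^esub> h))) = \<sigma> (tuple2 g h))"
    if "\<sigma> \<in> cochains G A 2"
  proof -
    have e: "\<sigma> \<in> extensional (tuples G 2)" using that by (simp add: cochains_iff)
    note n = tuple_nth tuple_nth[unfolded One_nat_def]
    show "transp_act G A act 2 1 \<sigma> = \<sigma> \<longleftrightarrow>
     (\<forall>g\<in>carrier G. \<forall>h\<in>carrier G. inv\<^bsub>A\<^esub> (act g (\<sigma> (tuple2 (inv\<^bsub>G\<^esub> g) (g \<otimes>\<^bsub>G\<^esub> h)))) = \<sigma> (tuple2 g h))"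
      unfolding transp_act_def extensional_eq_iff[OF e] ball_tuples2 restrict_tuple2 by (simp add: n)
    show "transp_act G A act 2 2 \<sigma> = \<sigma> \<longleftrightarrow>
     (\<forall>g\<in>carrier G. \<forall>h\<in>carrier G. inv\<^bsub>A\<^esub> (\<sigma> (tuple2 (g \<otimes>\<^bsub>G\<^esub> h) (inv\<^bsub>G\<^esub> h))) = \<sigma> (tuple2 g h))"
      unfolding transp_act_def extensional_eq_iff[OF e] ball_tuples2 restrict_tuple2 by (simp add: n)
  qed
  moreover have "{1..2::nat} = {1, 2}" by auto
  then have "(\<forall>i\<in>{1..2}. transp_act G A act 2 i \<sigma> = \<sigma>) \<longleftrightarrow> transp_act G A act 2 1 \<sigma> = \<sigma> \<and> transp_act G A act 2 2 \<sigma> = \<sigma>"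
    by (simp only: ball_simps) blast
  ultimately show ?thesis unfolding sym_cochains_iff by blast
qed

lemma coboundary1:
  assumes \<sigma>: "\<sigma> \<in> cochains G A 1"
  shows "coboundary G A act 1 \<sigma> = (\<lambda>x\<in>tuples G 2.
    act (x 1) (\<sigma> (tuple1 (x 2))) \<otimes>\<^bsub>A\<^esub> inv\<^bsub>A\<^esub> (\<sigma> (tuple1 (x 1 \<otimes>\<^bsub>G\<^esub> x 2))) \<otimes>\<^bsub>A\<^esub> \<sigma> (tuple1 (x 1)))"
proof -
  have "1 + 1 = (2::nat)" by simp
  show ?thesis unfolding coboundary_def \<open>1 + 1 = (2::nat)\<close>
  proof (rule restrict_ext)
    fix x assume x: "x \<in> tuples G 2"
    have c: "x 1 \<in> carrier G" "x 2 \<in> carrier G" using tuples_nth[OF x] by simp_all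
    note s = cochain_closed[OF \<sigma> tuple_in_tuples(1)]
    have "{1..1::nat} = {1}" by simp
    then have f: "(\<Otimes>\<^bsub>A\<^esub>i\<in>{1..1}. F i) = F 1" if "F 1 \<in> carrier A" for F :: "nat \<Rightarrow> 'a"
      using A.finprod_insert[of "{}" 1 F] that by simp
    have "(\<Otimes>\<^bsub>A\<^esub>i\<in>{1..1}. \<sigma> (\<lambda>j\<in>{1..1}. if j < i then x j else if j = i then x i \<otimes>\<^bsub>G\<^esub> x (i + 1) else x (j + 1)) [^]\<^bsub>A\<^esub> ((-1) ^ i :: int))
      = inv\<^bsub>A\<^esub> (\<sigma> (tuple1 (x 1 \<otimes>\<^bsub>G\<^esub> x 2)))"
      using c s by (subst f) (simp_all only: restrict_tuple1, simp_all add: A.int_pow_neg A.int_pow_1 numeral_2_eq_2[symmetric])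
    then show "act (x 1) (\<sigma> (\<lambda>j\<in>{1..1}. x (j + 1))) \<otimes>\<^bsub>A\<^esub>
       (\<Otimes>\<^bsub>A\<^esub>i\<in>{1..1}. \<sigma> (\<lambda>j\<in>{1..1}. if j < i then x j else if j = i then x i \<otimes>\<^bsub>G\<^esub> x (i + 1) else x (j + 1)) [^]\<^bsub>A\<^esub> ((-1) ^ i :: int)) \<otimes>\<^bsub>A\<^esub>
       \<sigma> (\<lambda>j\<in>{1..1}. x j) [^]\<^bsub>A\<^esub> ((-1) ^ 2 :: int) =
       act (x 1) (\<sigma> (tuple1 (x 2))) \<otimes>\<^bsub>A\<^esub> inv\<^bsub>A\<^esub> (\<sigma> (tuple1 (x 1 \<otimes>\<^bsub>G\<^esub> x 2))) \<otimes>\<^bsub>A\<^esub> \<sigma> (tuple1 (x 1))"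
      using c s by (simp only: restrict_tuple1) (simp add: A.int_pow_1 numeral_2_eq_2[symmetric])
  qed
qed

text \<open>The terms with negative sign are moved to the right, which leaves an identity without
  inverses; in this form it expresses associativity of the product in an extension.\<close>

lemma cocycle2_iff:
  assumes \<sigma>: "\<sigma> \<in> cochains G A 2"
  shows "coboundary G A act 2 \<sigma> = \<one>\<^bsub>cochain_group G A (2 + 1)\<^esub> \<longleftrightarrow>
    (\<forall>g\<in>carrier G. \<forall>h\<in>carrier G. \<forall>k\<in>carrier G.
       act g (\<sigma> (tuple2 h k)) \<otimes>\<^bsub>A\<^esub> \<sigma> (tuple2 g (h \<otimes>\<^bsub>G\<^esub> k)) = \<sigma> (tuple2 g h) \<otimes>\<^bsub>A\<^esub> \<sigma> (tuple2 (g \<otimes>\<^bsub>G\<^esub> h) k))"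
proof -
  have 3: "2 + 1 = (3::nat)" by simp
  have ext: "(\<lambda>x\<in>tuples G 3. \<one>\<^bsub>A\<^esub>) \<in> extensional (tuples G 3)" by simp
  note s = cochain_closed[OF \<sigma> tuple_in_tuples(2)]
  have "{1..2::nat} = insert 1 {2}" by auto
  then have f: "(\<Otimes>\<^bsub>A\<^esub>i\<in>{1..2}. F i) = F 1 \<otimes>\<^bsub>A\<^esub> F 2" if "F 1 \<in> carrier A" "F 2 \<in> carrier A" for F :: "nat \<Rightarrow> 'a"
    using A.finprod_insert[of "{2}" 1 F] A.finprod_insert[of "{}" 2 F] that by simp
  have *: "(act (x 1) (\<sigma> (\<lambda>j\<in>{1..2}. x (j + 1))) \<otimes>\<^bsub>A\<^esub>
       (\<Otimes>\<^bsub>A\<^esub>i\<in>{1..2}. \<sigma> (\<lambda>j\<in>{1..2}. if j < i then x j else if j = i then x i \<otimes>\<^bsub>G\<^esub> x (i + 1) else x (j + 1)) [^]\<^bsub>A\<^esub> ((-1) ^ i :: int)) \<otimes>\<^bsub>A\<^esub>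
       \<sigma> (\<lambda>j\<in>{1..2}. x j) [^]\<^bsub>A\<^esub> ((-1) ^ 3 :: int) = \<one>\<^bsub>A\<^esub>) \<longleftrightarrow>
       act g (\<sigma> (tuple2 h k)) \<otimes>\<^bsub>A\<^esub> \<sigma> (tuple2 g (h \<otimes>\<^bsub>G\<^esub> k)) = \<sigma> (tuple2 g h) \<otimes>\<^bsub>A\<^esub> \<sigma> (tuple2 (g \<otimes>\<^bsub>G\<^esub> h) k)"
    if c: "g \<in> carrier G" "h \<in> carrier G" "k \<in> carrier G" and x: "x = tuple3 g h k" for g h k x
  proof -
    have n: "x 1 = g" "x (Suc 0) = g" "x 2 = h" "x (Suc (Suc 0)) = h" "x 3 = k"
      using tuple_nth(4-6)[of g h k] by (simp_all add: x numeral_2_eq_2)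
    have m: "(\<Otimes>\<^bsub>A\<^esub>i\<in>{1..2}. \<sigma> (\<lambda>j\<in>{1..2}. if j < i then x j else if j = i then x i \<otimes>\<^bsub>G\<^esub> x (i + 1) else x (j + 1)) [^]\<^bsub>A\<^esub> ((-1) ^ i :: int))
      = inv\<^bsub>A\<^esub> (\<sigma> (tuple2 (g \<otimes>\<^bsub>G\<^esub> h) k)) \<otimes>\<^bsub>A\<^esub> \<sigma> (tuple2 g (h \<otimes>\<^bsub>G\<^esub> k))"
      using c s by (subst f) (simp_all only: restrict_tuple2, simp_all add: n A.int_pow_neg A.int_pow_1 numeral_2_eq_2[symmetric])
    define a b u v where "a = act g (\<sigma> (tuple2 h k))" and "b = \<sigma> (tuple2 g (h \<otimes>\<^bsub>G\<^esub> k))"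
      and "u = \<sigma> (tuple2 g h)" and "v = \<sigma> (tuple2 (g \<otimes>\<^bsub>G\<^esub> h) k)"
    have cl: "a \<in> carrier A" "b \<in> carrier A" "u \<in> carrier A" "v \<in> carrier A"
      using c s by (simp_all add: a_def b_def u_def v_def)
    have "a \<otimes>\<^bsub>A\<^esub> (inv\<^bsub>A\<^esub> v \<otimes>\<^bsub>A\<^esub> b) \<otimes>\<^bsub>A\<^esub> inv\<^bsub>A\<^esub> u = (a \<otimes>\<^bsub>A\<^esub> b) \<otimes>\<^bsub>A\<^esub> inv\<^bsub>A\<^esub> (u \<otimes>\<^bsub>A\<^esub> v)"
      using cl by (simp add: A.inv_mult A.m_ac)
    also have "\<dots> = \<one>\<^bsub>A\<^esub> \<longleftrightarrow> a \<otimes>\<^bsub>A\<^esub> b = u \<otimes>\<^bsub>A\<^esub> v"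
      using cl by (metis A.inv_solve_right A.l_one A.m_closed A.one_closed A.inv_closed A.r_inv)
    finally have "a \<otimes>\<^bsub>A\<^esub> (inv\<^bsub>A\<^esub> v \<otimes>\<^bsub>A\<^esub> b) \<otimes>\<^bsub>A\<^esub> inv\<^bsub>A\<^esub> u = \<one>\<^bsub>A\<^esub> \<longleftrightarrow> a \<otimes>\<^bsub>A\<^esub> b = u \<otimes>\<^bsub>A\<^esub> v" .
    then show ?thesis
      unfolding m unfolding a_def b_def u_def v_def restrict_tuple2 using c s
      by (simp add: n A.int_pow_neg A.int_pow_1)
  qed
  show ?thesis
    unfolding coboundary_def cochain_group_def 3 monoid.select_convs extensional_eq_iff[OF ext] ball_tuples3
    using * tuple_in_tuples(3)[of _ G] by (simp del: One_nat_def)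
qed

end

section \<open>Factor sets of symmetric smooth sections\<close>

text \<open>Together with \<open>m_assoc\<close> and \<open>inv_mult_group\<close> these rules
  cancel inside right-associated words. The identities between factor sets below reduce to such
  cancellations in \<open>E\<close>.\<close>

lemma (in group) inv_cancel [simp]:
  assumes "x \<in> carrier G" "y \<in> carrier G"
  shows "x \<otimes> (inv x \<otimes> y) = y" "inv x \<otimes> (x \<otimes> y) = y"
  using assms by (simp_all add: m_assoc[symmetric])

definition symmetric_smooth_section :: "'g lie_group \<Rightarrow> ('a, 'e, 'g) extension \<Rightarrow> ('g \<Rightarrow> 'e) \<Rightarrow> bool" where
  "symmetric_smooth_section G = (\<lambda>(E, i, \<pi>) s. is_section G (E, i, \<pi>) s \<and> smooth_map (mfd G) (mfd E) s \<and>
     (\<forall>g\<in>carrier G. s (inv\<^bsub>G\<^esub> g) = inv\<^bsub>E\<^esub> (s g)))"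

lemma has_symmetric_smooth_section_iff:
  "has_symmetric_smooth_section G X \<longleftrightarrow> (\<exists>s. symmetric_smooth_section G X s)"
  by (cases X) (simp add: has_symmetric_smooth_section_def symmetric_smooth_section_def)

definition factor_set :: "'g lie_group \<Rightarrow> 'a lie_group \<Rightarrow> 'e lie_group \<Rightarrow> ('a \<Rightarrow> 'e) \<Rightarrow> ('g \<Rightarrow> 'e) \<Rightarrow> 'g \<Rightarrow> 'g \<Rightarrow> 'a" where
  "factor_set G A E i s g h = inv_into (carrier A) i (s g \<otimes>\<^bsub>E\<^esub> s h \<otimes>\<^bsub>E\<^esub> inv\<^bsub>E\<^esub> (s (g \<otimes>\<^bsub>G\<^esub> h)))"

definition section_cocycle :: "'g lie_group \<Rightarrow> 'a lie_group \<Rightarrow> ('a, 'e, 'g) extension \<Rightarrow> ('g \<Rightarrow> 'e) \<Rightarrow> (nat \<Rightarrow> 'g) \<Rightarrow> 'a" where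
  "section_cocycle G A = (\<lambda>(E, i, \<pi>) s. \<lambda>x\<in>tuples G 2. factor_set G A E i s (x 1) (x 2))"

locale lie_module_extension = lie_module G A act
  for G :: "'g lie_group" and A :: "'a lie_group" and act +
  fixes E :: "'e lie_group" and i :: "'a \<Rightarrow> 'e" and \<pi> :: "'e \<Rightarrow> 'g"
  assumes ext: "lie_extension G A (E, i, \<pi>)" and corr: "corresponds_to_action G A act (E, i, \<pi>)"
begin

lemma E: "is_lie_group E" and i_hom: "i \<in> hom A E" and i_smooth: "smooth_map (mfd A) (mfd E) i"
  and pi_hom: "\<pi> \<in> hom E G" and pi_smooth: "smooth_map (mfd E) (mfd G) \<pi>"
  and i_inj: "inj_on i (carrier A)" and i_image: "i ` carrier A = kernel E G \<pi>"
  and pi_surj: "\<pi> ` carrier E = carrier G"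
  using ext by (auto simp: lie_extension_def)

sublocale E: group E by (rule lie_groupD(1)[OF E])
sublocale i: group_hom A E i by unfold_locales (rule i_hom)
sublocale pi: group_hom E G \<pi> by unfold_locales (rule pi_hom)

lemmas lieE = lie_groupD[OF E]

abbreviation j where "j \<equiv> inv_into (carrier A) i"

lemma i_eq_iff: "a \<in> carrier A \<Longrightarrow> b \<in> carrier A \<Longrightarrow> i a = i b \<longleftrightarrow> a = b"
  using i_inj by (auto dest: inj_onD)

lemma j_i [simp]: "a \<in> carrier A \<Longrightarrow> j (i a) = a"
  using i_inj by simp

lemma pi_i [simp]: "a \<in> carrier A \<Longrightarrow> \<pi> (i a) = \<one>\<^bsub>G\<^esub>"
  using i_image by (auto simp: kernel_def)

lemma j_kernel:
  assumes "e \<in> carrier E" "\<pi> e = \<one>\<^bsub>G\<^esub>"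
  shows "j e \<in> carrier A" "i (j e) = e"
proof -
  have "e \<in> i ` carrier A" using assms i_image by (simp add: kernel_def)
  then show "j e \<in> carrier A" "i (j e) = e" by (simp_all add: inv_into_into f_inv_into_f)
qed

text \<open>The image is the kernel of \<open>\<pi>\<close>, the preimage of a point in a Hausdorff
  space.\<close>

lemma closedin_image: "closedin (mtop (mfd E)) (i ` carrier A)"
proof -
  have "closedin (mtop (mfd G)) {\<one>\<^bsub>G\<^esub>}"
    using lieG(2,4) by (intro closedin_Hausdorff_singleton) (simp_all add: smooth_manifold_def)
  from closedin_continuous_map_preimage[OF smooth_map_continuous[OF pi_smooth] this]
  show ?thesis by (simp add: i_image kernel_def lieE(4))
qed

text \<open>The point at which the theory of closed injective homomorphisms enters: factor sets,
  \<open>coord\<close> and differences of sections become smooth through it.\<close>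

lemma smooth_j:
  assumes M: "charted M" and f: "smooth_map M (mfd E) f"
    and ker: "\<And>x. x \<in> topspace (mtop M) \<Longrightarrow> \<pi> (f x) = \<one>\<^bsub>G\<^esub>"
  shows "smooth_map M (mfd A) (\<lambda>x. j (f x))"
proof (rule smooth_map_inv_into_image[OF A E i_hom i_smooth i_inj closedin_image M f])
  show "f ` topspace (mtop M) \<subseteq> i ` carrier A"
    using ker smooth_map_mem[OF f] by (auto simp: i_image kernel_def lieE(4))
qed

text \<open>\<open>corresponds_to_action\<close> speaks of values of sections, and every element of
  \<open>E\<close> is such a value because sections need not be smooth or even continuous
  there.\<close>

lemma conj_i:
  assumes e: "e \<in> carrier E" and a: "a \<in> carrier A"
  shows "e \<otimes>\<^bsub>E\<^esub> i a \<otimes>\<^bsub>E\<^esub> inv\<^bsub>E\<^esub> e = i (act (\<pi> e) a)"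
proof -
  \<comment> \<open>An arbitrary section, changed at one point so that it passes through
    \<open>e\<close>.\<close>
  define s where "s = (inv_into (carrier E) \<pi>)(\<pi> e := e)"
  have "is_section G (E, i, \<pi>) s"
    using pi_surj e by (auto simp: is_section_def s_def inv_into_into f_inv_into_f)
  then have "act (\<pi> e) a = j (s (\<pi> e) \<otimes>\<^bsub>E\<^esub> i a \<otimes>\<^bsub>E\<^esub> inv\<^bsub>E\<^esub> (s (\<pi> e)))"
    using corr e a by (simp add: corresponds_to_action_def)
  also have "s (\<pi> e) = e" by (simp add: s_def)
  finally have "act (\<pi> e) a = j (e \<otimes>\<^bsub>E\<^esub> i a \<otimes>\<^bsub>E\<^esub> inv\<^bsub>E\<^esub> e)" .
  then show ?thesis using e a by (simp add: j_kernel)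
qed

lemma i_act:
  assumes "e \<in> carrier E" "a \<in> carrier A" "\<pi> e = g"
  shows "i (act g a) = e \<otimes>\<^bsub>E\<^esub> i a \<otimes>\<^bsub>E\<^esub> inv\<^bsub>E\<^esub> e"
  using conj_i assms by simp

context
  fixes s assumes s: "symmetric_smooth_section G (E, i, \<pi>) s"
begin

lemma section_closed [simp]: "g \<in> carrier G \<Longrightarrow> s g \<in> carrier E"
  and pi_section [simp]: "g \<in> carrier G \<Longrightarrow> \<pi> (s g) = g"
  and section_inv: "g \<in> carrier G \<Longrightarrow> s (inv\<^bsub>G\<^esub> g) = inv\<^bsub>E\<^esub> (s g)"
  and section_smooth: "smooth_map (mfd G) (mfd E) s"
  using s by (auto simp: symmetric_smooth_section_def is_section_def)

lemma factor_set_closed [simp]: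
    "g \<in> carrier G \<Longrightarrow> h \<in> carrier G \<Longrightarrow> factor_set G A E i s g h \<in> carrier A"
  and i_factor_set: "g \<in> carrier G \<Longrightarrow> h \<in> carrier G \<Longrightarrow>
    i (factor_set G A E i s g h) = s g \<otimes>\<^bsub>E\<^esub> s h \<otimes>\<^bsub>E\<^esub> inv\<^bsub>E\<^esub> (s (g \<otimes>\<^bsub>G\<^esub> h))"
  unfolding factor_set_def by (simp_all add: j_kernel)

lemma section_cocycle_nth:
  "g \<in> carrier G \<Longrightarrow> h \<in> carrier G \<Longrightarrow> section_cocycle G A (E, i, \<pi>) s (tuple2 g h) = factor_set G A E i s g h"
  using tuple_in_tuples(2)[of g G h] by (simp add: section_cocycle_def tuple_nth tuple_nth[unfolded One_nat_def])

lemma section_cocycle_in_cochains: "section_cocycle G A (E, i, \<pi>) s \<in> cochains G A 2"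
proof -
  have f: "smooth_map GG (mfd E) (\<lambda>z. s (fst z))" "smooth_map GG (mfd E) (\<lambda>z. s (snd z))"
    by (rule smooth_map_compose[OF GG(1) lieG(3) lieE(3) _ section_smooth],
        simp add: smooth_map_fst smooth_map_snd lieG)+
  have m: "smooth_map GG (mfd E) (\<lambda>z. s (fst z \<otimes>\<^bsub>G\<^esub> snd z))"
    by (rule smooth_map_compose[OF GG(1) lieG(3) lieE(3) _ section_smooth],
        rule smooth_map_mult[OF G GG(1)]) (simp_all add: smooth_map_fst smooth_map_snd lieG)
  have "smooth_map GG (mfd A) (\<lambda>z. j (s (fst z) \<otimes>\<^bsub>E\<^esub> s (snd z) \<otimes>\<^bsub>E\<^esub> inv\<^bsub>E\<^esub> (s (fst z \<otimes>\<^bsub>G\<^esub> snd z))))"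
  proof (rule smooth_j[OF GG(1)])
    show "smooth_map GG (mfd E) (\<lambda>z. s (fst z) \<otimes>\<^bsub>E\<^esub> s (snd z) \<otimes>\<^bsub>E\<^esub> inv\<^bsub>E\<^esub> (s (fst z \<otimes>\<^bsub>G\<^esub> snd z)))"
      by (rule smooth_map_mult[OF E GG(1) smooth_map_mult[OF E GG(1) f] smooth_map_inv[OF E GG(1) m]])
  qed (auto simp: lieG(4))
  from cochain2I[OF this] show ?thesis by (simp add: section_cocycle_def factor_set_def)
qed

text \<open>After applying the injective \<open>i\<close> everything is a word identity in
  \<open>E\<close>. The two symmetry conditions use \<open>s (inv g) = inv (s g)\<close>; in the
  cocycle identity both sides become the product of \<open>s g\<close>, \<open>s h\<close>,
  \<open>s k\<close> and the inverse of \<open>s\<close> at the product of \<open>g\<close>,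
  \<open>h\<close>, \<open>k\<close>.\<close>

lemma section_cocycle_in_sym_cocycles: "section_cocycle G A (E, i, \<pi>) s \<in> sym_cocycles G A act 2"
proof -
  let ?f = "factor_set G A E i s" and ?c = "section_cocycle G A (E, i, \<pi>) s"
  have 1: "inv\<^bsub>A\<^esub> (act g (?f (inv\<^bsub>G\<^esub> g) (g \<otimes>\<^bsub>G\<^esub> h))) = ?f g h" if "g \<in> carrier G" "h \<in> carrier G" for g h
  proof -
    have "i (inv\<^bsub>A\<^esub> (act g (?f (inv\<^bsub>G\<^esub> g) (g \<otimes>\<^bsub>G\<^esub> h)))) = i (?f g h)"
      using that by (simp add: i_act[of "s g"] i_factor_set section_inv E.m_assoc E.inv_mult_group)
    then show ?thesis
      using that by (simp only: i_eq_iff A.inv_closed act_closed factor_set_closed G.m_closed G.inv_closed)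
  qed
  have 2: "inv\<^bsub>A\<^esub> (?f (g \<otimes>\<^bsub>G\<^esub> h) (inv\<^bsub>G\<^esub> h)) = ?f g h" if "g \<in> carrier G" "h \<in> carrier G" for g h
  proof -
    have "i (inv\<^bsub>A\<^esub> (?f (g \<otimes>\<^bsub>G\<^esub> h) (inv\<^bsub>G\<^esub> h))) = i (?f g h)"
      using that by (simp add: i_factor_set section_inv E.m_assoc E.inv_mult_group G.m_assoc)
    then show ?thesis
      using that by (simp only: i_eq_iff A.inv_closed act_closed factor_set_closed G.m_closed G.inv_closed)
  qed
  have 3: "act g (?f h k) \<otimes>\<^bsub>A\<^esub> ?f g (h \<otimes>\<^bsub>G\<^esub> k) = ?f g h \<otimes>\<^bsub>A\<^esub> ?f (g \<otimes>\<^bsub>G\<^esub> h) k"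
    if "g \<in> carrier G" "h \<in> carrier G" "k \<in> carrier G" for g h k
  proof -
    have "i (act g (?f h k) \<otimes>\<^bsub>A\<^esub> ?f g (h \<otimes>\<^bsub>G\<^esub> k)) = i (?f g h \<otimes>\<^bsub>A\<^esub> ?f (g \<otimes>\<^bsub>G\<^esub> h) k)"
      using that by (simp add: i_act[of "s g"] i_factor_set E.m_assoc E.inv_mult_group G.m_assoc)
    then show ?thesis using that by (simp only: i_eq_iff act_closed factor_set_closed A.m_closed G.m_closed)
  qed
  have "?c \<in> sym_cochains G A act 2"
    unfolding sym_cochains2_iff using section_cocycle_in_cochains 1 2 by (simp add: section_cocycle_nth)
  moreover have "coboundary G A act 2 ?c = \<one>\<^bsub>cochain_group G A (2 + 1)\<^esub>"
    unfolding cocycle2_iff[OF section_cocycle_in_cochains] using 3 by (simp add: section_cocycle_nth)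
  ultimately show ?thesis by (simp add: sym_cocycles_def)
qed

text \<open>The \<open>A\<close>-component of \<open>e\<close>. Together with \<open>\<pi>\<close>
  it identifies the elements of \<open>E\<close> with pairs from \<open>A\<close> and
  \<open>G\<close>.\<close>

definition coord :: "'e \<Rightarrow> 'a" where "coord e = j (e \<otimes>\<^bsub>E\<^esub> inv\<^bsub>E\<^esub> (s (\<pi> e)))"

lemma coord_closed: "e \<in> carrier E \<Longrightarrow> coord e \<in> carrier A"
  and coord_decomp: "e \<in> carrier E \<Longrightarrow> i (coord e) \<otimes>\<^bsub>E\<^esub> s (\<pi> e) = e"
  unfolding coord_def by (simp_all add: j_kernel E.m_assoc)

lemma coord_eq: "a \<in> carrier A \<Longrightarrow> g \<in> carrier G \<Longrightarrow> coord (i a \<otimes>\<^bsub>E\<^esub> s g) = a"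
  unfolding coord_def by (simp add: E.m_assoc)

lemma coord_smooth: "smooth_map (mfd E) (mfd A) coord"
proof -
  have "smooth_map (mfd E) (mfd A) (\<lambda>e. j (e \<otimes>\<^bsub>E\<^esub> inv\<^bsub>E\<^esub> (s (\<pi> e))))"
  proof (rule smooth_j[OF lieE(3)])
    show "smooth_map (mfd E) (mfd E) (\<lambda>e. e \<otimes>\<^bsub>E\<^esub> inv\<^bsub>E\<^esub> (s (\<pi> e)))"
      by (intro smooth_map_mult[OF E lieE(3)] smooth_map_inv[OF E lieE(3)] smooth_map_id[OF lieE(2)]
          smooth_map_compose[OF lieE(3) lieG(3) lieE(3) pi_smooth section_smooth])
  qed (simp add: lieE(4))
  then show ?thesis by (simp add: coord_def[abs_def])
qed

text \<open>Moving \<open>i b\<close> past \<open>s g\<close> produces the action, and the product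
  of \<open>s g\<close> and \<open>s h\<close> produces the factor set. The same formula defines the
  product in \<open>cocycle_extension\<close>.\<close>

lemma mult_decomp:
  assumes "a \<in> carrier A" "b \<in> carrier A" "g \<in> carrier G" "h \<in> carrier G"
  shows "(i a \<otimes>\<^bsub>E\<^esub> s g) \<otimes>\<^bsub>E\<^esub> (i b \<otimes>\<^bsub>E\<^esub> s h) =
    i (a \<otimes>\<^bsub>A\<^esub> act g b \<otimes>\<^bsub>A\<^esub> factor_set G A E i s g h) \<otimes>\<^bsub>E\<^esub> s (g \<otimes>\<^bsub>G\<^esub> h)"
  using assms by (simp add: i_act[of "s g"] i_factor_set E.m_assoc)

end

text \<open>The product of \<open>t g\<close> and \<open>t h\<close> is computed by
  \<open>mult_decomp\<close> and compared with the value of \<open>t\<close> at the product; what is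
  added to the factor set is the coboundary of \<open>l\<close>.\<close>

lemma factor_set_shift:
  assumes s: "symmetric_smooth_section G (E, i, \<pi>) s" and t: "symmetric_smooth_section G (E, i, \<pi>) t"
    and l: "\<And>g. g \<in> carrier G \<Longrightarrow> l g \<in> carrier A" "\<And>g. g \<in> carrier G \<Longrightarrow> t g = i (l g) \<otimes>\<^bsub>E\<^esub> s g"
    and g: "g \<in> carrier G" "h \<in> carrier G"
  shows "factor_set G A E i t g h = act g (l h) \<otimes>\<^bsub>A\<^esub> inv\<^bsub>A\<^esub> (l (g \<otimes>\<^bsub>G\<^esub> h)) \<otimes>\<^bsub>A\<^esub> l g \<otimes>\<^bsub>A\<^esub> factor_set G A E i s g h"
proof -
  note [simp] = section_closed[OF s] pi_section[OF s] factor_set_closed[OF s] l(1)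
  have "i (factor_set G A E i t g h) = (i (l g) \<otimes>\<^bsub>E\<^esub> s g) \<otimes>\<^bsub>E\<^esub> (i (l h) \<otimes>\<^bsub>E\<^esub> s h) \<otimes>\<^bsub>E\<^esub> inv\<^bsub>E\<^esub> (i (l (g \<otimes>\<^bsub>G\<^esub> h)) \<otimes>\<^bsub>E\<^esub> s (g \<otimes>\<^bsub>G\<^esub> h))"
    using g by (simp add: i_factor_set[OF t] l(2))
  also have "\<dots> = i (l g \<otimes>\<^bsub>A\<^esub> act g (l h) \<otimes>\<^bsub>A\<^esub> factor_set G A E i s g h \<otimes>\<^bsub>A\<^esub> inv\<^bsub>A\<^esub> (l (g \<otimes>\<^bsub>G\<^esub> h)))"
    using g by (simp only: mult_decomp[OF s] l(1)) (simp add: E.inv_mult_group E.m_assoc)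
  finally have "factor_set G A E i t g h = l g \<otimes>\<^bsub>A\<^esub> act g (l h) \<otimes>\<^bsub>A\<^esub> factor_set G A E i s g h \<otimes>\<^bsub>A\<^esub> inv\<^bsub>A\<^esub> (l (g \<otimes>\<^bsub>G\<^esub> h))"
    using g by (simp only: i_eq_iff factor_set_closed[OF t] factor_set_closed[OF s] A.m_closed A.inv_closed act_closed l(1) G.m_closed)
  then show ?thesis using g by (simp add: A.m_ac)
qed

lemma section_cocycle_shift:
  assumes s: "symmetric_smooth_section G (E, i, \<pi>) s" and t: "symmetric_smooth_section G (E, i, \<pi>) t"
    and \<mu>: "\<mu> \<in> cochains G A 1" and eq: "\<And>g. g \<in> carrier G \<Longrightarrow> t g = i (\<mu> (tuple1 g)) \<otimes>\<^bsub>E\<^esub> s g"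
  shows "section_cocycle G A (E, i, \<pi>) t =
    coboundary G A act 1 \<mu> \<otimes>\<^bsub>cochain_group G A 2\<^esub> section_cocycle G A (E, i, \<pi>) s"
  unfolding coboundary1[OF \<mu>] section_cocycle_def cochain_group_def prod.case monoid.select_convs
proof (rule restrict_ext)
  fix x assume x: "x \<in> tuples G 2"
  have g: "x 1 \<in> carrier G" "x 2 \<in> carrier G" using tuples_nth[OF x] by simp_all
  have l: "\<mu> (tuple1 g) \<in> carrier A" if "g \<in> carrier G" for g
    by (rule cochain_closed[OF \<mu> tuple_in_tuples(1)[OF that]])
  show "factor_set G A E i t (x 1) (x 2) = (\<lambda>x\<in>tuples G 2. act (x 1) (\<mu> (tuple1 (x 2))) \<otimes>\<^bsub>A\<^esub>
      inv\<^bsub>A\<^esub> \<mu> (tuple1 (x 1 \<otimes>\<^bsub>G\<^esub> x 2)) \<otimes>\<^bsub>A\<^esub> \<mu> (tuple1 (x 1))) x \<otimes>\<^bsub>A\<^esub>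
      (\<lambda>x\<in>tuples G 2. factor_set G A E i s (x 1) (x 2)) x"
    unfolding restrict_apply'[OF x] using factor_set_shift[where l = "\<lambda>g. \<mu> (tuple1 g)", OF s t l eq g] .
qed

text \<open>The quotient of \<open>t g\<close> by \<open>s g\<close> lies in the kernel of
  \<open>\<pi>\<close>, and its preimage \<open>l g\<close> is a symmetric cochain because both
  sections are symmetric. Hence the cohomology class does not depend on the section.\<close>

lemma sections_differ_by_cochain:
  assumes s: "symmetric_smooth_section G (E, i, \<pi>) s" and t: "symmetric_smooth_section G (E, i, \<pi>) t"
  shows "\<exists>\<mu>\<in>sym_cochains G A act 1. section_cocycle G A (E, i, \<pi>) t =
    coboundary G A act 1 \<mu> \<otimes>\<^bsub>cochain_group G A 2\<^esub> section_cocycle G A (E, i, \<pi>) s"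
proof -
  note [simp] = section_closed[OF s] pi_section[OF s] factor_set_closed[OF s]
    section_closed[OF t] pi_section[OF t] factor_set_closed[OF t]
  define l where "l g = j (t g \<otimes>\<^bsub>E\<^esub> inv\<^bsub>E\<^esub> (s g))" for g
  have l [simp]: "l g \<in> carrier A" and il: "i (l g) = t g \<otimes>\<^bsub>E\<^esub> inv\<^bsub>E\<^esub> (s g)" if "g \<in> carrier G" for g
    using that by (simp_all add: l_def j_kernel)
  have tl: "t g = i (l g) \<otimes>\<^bsub>E\<^esub> s g" if "g \<in> carrier G" for g
    using that by (simp add: il E.m_assoc)
  define \<mu> where "\<mu> = (\<lambda>x\<in>tuples G 1. l (x 1))"
  have \<mu>: "\<mu> (tuple1 g) = l g" if "g \<in> carrier G" for g
    using that tuple_in_tuples(1)[of g G] by (simp add: \<mu>_def tuple_nth[unfolded One_nat_def])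
  have "smooth_map (mfd G) (mfd A) l"
    unfolding l_def
    by (rule smooth_j[OF lieG(3)])
      (auto simp: lieG(4) intro!: smooth_map_mult[OF E lieG(3)] smooth_map_inv[OF E lieG(3)] section_smooth[OF s] section_smooth[OF t])
  then have c: "\<mu> \<in> cochains G A 1" unfolding \<mu>_def by (rule cochain1I)
  have "inv\<^bsub>A\<^esub> (act g (l (inv\<^bsub>G\<^esub> g))) = l g" if g: "g \<in> carrier G" for g
  proof -
    have "i (inv\<^bsub>A\<^esub> (act g (l (inv\<^bsub>G\<^esub> g)))) = i (l g)"
      using g by (simp add: i_act[of "s g"] il section_inv[OF s] section_inv[OF t] E.inv_mult_group E.m_assoc)
    then show ?thesis using g by (simp only: i_eq_iff A.inv_closed act_closed l G.inv_closed)
  qed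
  then have "\<mu> \<in> sym_cochains G A act 1" unfolding sym_cochains1_iff using c \<mu> by simp
  moreover have "section_cocycle G A (E, i, \<pi>) t =
    coboundary G A act 1 \<mu> \<otimes>\<^bsub>cochain_group G A 2\<^esub> section_cocycle G A (E, i, \<pi>) s"
    by (rule section_cocycle_shift[OF s t c]) (simp only: tl \<mu>)
  ultimately show ?thesis by blast
qed

text \<open>A converse to \<open>sections_differ_by_cochain\<close>: every factor set cohomologous
  to that of \<open>s\<close> belongs to a symmetric section of the same extension. This makes the
  classification injective.\<close>

lemma shift_section:
  assumes s: "symmetric_smooth_section G (E, i, \<pi>) s" and \<mu>: "\<mu> \<in> sym_cochains G A act 1"
  shows "\<exists>t. symmetric_smooth_section G (E, i, \<pi>) t \<and> section_cocycle G A (E, i, \<pi>) t =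
    coboundary G A act 1 \<mu> \<otimes>\<^bsub>cochain_group G A 2\<^esub> section_cocycle G A (E, i, \<pi>) s"
proof -
  note [simp] = section_closed[OF s] pi_section[OF s] factor_set_closed[OF s]
  have sym: "inv\<^bsub>A\<^esub> (act g (\<mu> (tuple1 (inv\<^bsub>G\<^esub> g)))) = \<mu> (tuple1 g)" if "g \<in> carrier G" for g
    using \<mu> that unfolding sym_cochains1_iff by blast
  have c: "\<mu> \<in> cochains G A 1" using \<mu> unfolding sym_cochains1_iff by blast
  define l where "l g = \<mu> (tuple1 g)" for g
  have l [simp]: "l g \<in> carrier A" if "g \<in> carrier G" for g
    unfolding l_def by (rule cochain_closed[OF c tuple_in_tuples(1)[OF that]])
  define t where "t g = i (l g) \<otimes>\<^bsub>E\<^esub> s g" for g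
  have ti: "t (inv\<^bsub>G\<^esub> g) = inv\<^bsub>E\<^esub> (t g)" if g: "g \<in> carrier G" for g
  proof -
    have "act g (l (inv\<^bsub>G\<^esub> g)) = inv\<^bsub>A\<^esub> (l g)" using sym[OF g] g unfolding l_def[symmetric]
      by (metis A.inv_inv act_closed G.inv_closed l)
    then have "i (act g (l (inv\<^bsub>G\<^esub> g))) = inv\<^bsub>E\<^esub> (i (l g))" using g by simp
    \<comment> \<open>Symmetry of \<open>\<mu>\<close>, expressed by conjugation in
      \<open>E\<close>; this is what \<open>t (inv g) = inv (t g)\<close> amounts to.\<close>
    then have *: "s g \<otimes>\<^bsub>E\<^esub> i (l (inv\<^bsub>G\<^esub> g)) \<otimes>\<^bsub>E\<^esub> inv\<^bsub>E\<^esub> (s g) = inv\<^bsub>E\<^esub> (i (l g))" using g by (simp add: i_act[of "s g"])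
    have "i (l (inv\<^bsub>G\<^esub> g)) \<otimes>\<^bsub>E\<^esub> inv\<^bsub>E\<^esub> (s g) = inv\<^bsub>E\<^esub> (s g) \<otimes>\<^bsub>E\<^esub> (s g \<otimes>\<^bsub>E\<^esub> i (l (inv\<^bsub>G\<^esub> g)) \<otimes>\<^bsub>E\<^esub> inv\<^bsub>E\<^esub> (s g))"
      using g by (simp add: E.m_assoc)
    then show ?thesis unfolding * using g by (simp add: t_def section_inv[OF s] E.inv_mult_group)
  qed
  have ts: "smooth_map (mfd G) (mfd E) t"
    unfolding t_def l_def
    by (rule smooth_map_mult[OF E lieG(3) smooth_map_compose[OF lieG(3) lieA(3) lieE(3) smooth_tuple1[OF c] i_smooth] section_smooth[OF s]])
  have tc: "t \<in> carrier G \<rightarrow> carrier E" "\<forall>g\<in>carrier G. \<pi> (t g) = g" by (simp_all add: t_def)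
  have t: "symmetric_smooth_section G (E, i, \<pi>) t"
    unfolding symmetric_smooth_section_def is_section_def prod.case using ti ts tc by blast
  have "section_cocycle G A (E, i, \<pi>) t =
    coboundary G A act 1 \<mu> \<otimes>\<^bsub>cochain_group G A 2\<^esub> section_cocycle G A (E, i, \<pi>) s"
    by (rule section_cocycle_shift[OF s t c]) (simp only: t_def l_def)
  with t show ?thesis by blast
qed

end

section \<open>Comparison of two extensions\<close>

locale two_extensions =
  X: lie_module_extension G A act E i \<pi> + Y: lie_module_extension G A act E' i' \<pi>'
  for G :: "'g lie_group" and A :: "'a lie_group" and act
    and E :: "'e lie_group" and i \<pi> and E' :: "'f lie_group" and i' \<pi>'
begin

text \<open>Composing \<open>s\<close> with the isomorphism gives such a section: the isomorphism
  respects inverses, both projections and both inclusions of \<open>A\<close>.\<close>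

lemma equivalent_imp_same_cocycle:
  assumes eq: "equivalent_extensions A (E, i, \<pi>) (E', i', \<pi>')" and s: "symmetric_smooth_section G (E, i, \<pi>) s"
  shows "\<exists>t. symmetric_smooth_section G (E', i', \<pi>') t \<and>
    section_cocycle G A (E', i', \<pi>') t = section_cocycle G A (E, i, \<pi>) s"
proof -
  note [simp] = X.section_closed[OF s] X.pi_section[OF s] X.factor_set_closed[OF s]
  obtain \<phi> where \<phi>: "\<phi> \<in> iso E E'" "smooth_map (mfd E) (mfd E') \<phi>" "\<forall>a\<in>carrier A. \<phi> (i a) = i' a"
    "\<forall>e\<in>carrier E. \<pi>' (\<phi> e) = \<pi> e"
    using eq unfolding equivalent_extensions_def by auto
  interpret phi: group_hom E E' \<phi> using \<phi>(1) by unfold_locales (simp add: iso_def)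
  define t where "t g = \<phi> (s g)" for g
  have ts: "smooth_map (mfd G) (mfd E') t" unfolding t_def
    by (rule smooth_map_compose[OF X.lieG(3) X.lieE(3) Y.lieE(3) X.section_smooth[OF s] \<phi>(2)])
  have tc: "t \<in> carrier G \<rightarrow> carrier E'" "\<forall>g\<in>carrier G. \<pi>' (t g) = g"
    using \<phi>(4) by (simp_all add: t_def)
  have ti: "t (inv\<^bsub>G\<^esub> g) = inv\<^bsub>E'\<^esub> (t g)" if "g \<in> carrier G" for g
    using that by (simp add: t_def X.section_inv[OF s])
  have t: "symmetric_smooth_section G (E', i', \<pi>') t"
    unfolding symmetric_smooth_section_def is_section_def prod.case using ts tc ti by blast
  have "factor_set G A E' i' t g h = factor_set G A E i s g h" if "g \<in> carrier G" "h \<in> carrier G" for g h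
  proof -
    have "i' (factor_set G A E' i' t g h) = \<phi> (i (factor_set G A E i s g h))"
      using that by (simp add: Y.i_factor_set[OF t] X.i_factor_set[OF s] t_def)
    also have "\<dots> = i' (factor_set G A E i s g h)" using \<phi>(3) that by simp
    finally show ?thesis using that Y.factor_set_closed[OF t] by (simp only: Y.i_eq_iff X.factor_set_closed[OF s])
  qed
  then have "section_cocycle G A (E', i', \<pi>') t = section_cocycle G A (E, i, \<pi>) s"
    unfolding section_cocycle_def prod.case by (intro restrict_ext) (simp add: X.G.is_group tuples_nth)
  with t show ?thesis by blast
qed

text \<open>The map that sends \<open>i a \<otimes> s g\<close> to \<open>i' a \<otimes> t g\<close>
  is multiplicative because \<open>mult_decomp\<close> expresses both products through the same
  factor set, and it is smooth in both directions because \<open>coord\<close> is.\<close>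

lemma same_cocycle_imp_equivalent:
  assumes s: "symmetric_smooth_section G (E, i, \<pi>) s" and t: "symmetric_smooth_section G (E', i', \<pi>') t"
    and eq: "section_cocycle G A (E, i, \<pi>) s = section_cocycle G A (E', i', \<pi>') t"
  shows "equivalent_extensions A (E, i, \<pi>) (E', i', \<pi>')"
proof -
  note [simp] = X.section_closed[OF s] X.pi_section[OF s] X.factor_set_closed[OF s] X.coord_closed[OF s] X.coord_decomp[OF s]
    Y.section_closed[OF t] Y.pi_section[OF t] Y.factor_set_closed[OF t] Y.coord_closed[OF t] Y.coord_decomp[OF t]
    X.coord_eq[OF s] Y.coord_eq[OF t]
  have fs: "factor_set G A E i s g h = factor_set G A E' i' t g h" if "g \<in> carrier G" "h \<in> carrier G" for g h
    using X.section_cocycle_nth[OF s that] Y.section_cocycle_nth[OF t that] eq by simp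
  define \<phi> where "\<phi> e = i' (X.coord s e) \<otimes>\<^bsub>E'\<^esub> t (\<pi> e)" for e
  define \<psi> where "\<psi> e = i (Y.coord t e) \<otimes>\<^bsub>E\<^esub> s (\<pi>' e)" for e
  have \<phi>c: "\<phi> e \<in> carrier E'" "\<pi>' (\<phi> e) = \<pi> e" "\<psi> (\<phi> e) = e" if "e \<in> carrier E" for e
    using that by (simp_all add: \<phi>_def \<psi>_def)
  have \<psi>c: "\<psi> e \<in> carrier E" "\<pi> (\<psi> e) = \<pi>' e" "\<phi> (\<psi> e) = e" if "e \<in> carrier E'" for e
    using that by (simp_all add: \<phi>_def \<psi>_def)
  have hom: "\<phi> (x \<otimes>\<^bsub>E\<^esub> y) = \<phi> x \<otimes>\<^bsub>E'\<^esub> \<phi> y" if "x \<in> carrier E" "y \<in> carrier E" for x y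
  proof -
    let ?a = "X.coord s x \<otimes>\<^bsub>A\<^esub> act (\<pi> x) (X.coord s y) \<otimes>\<^bsub>A\<^esub> factor_set G A E i s (\<pi> x) (\<pi> y)"
    have a: "?a \<in> carrier A" using that by simp
    have "x \<otimes>\<^bsub>E\<^esub> y = (i (X.coord s x) \<otimes>\<^bsub>E\<^esub> s (\<pi> x)) \<otimes>\<^bsub>E\<^esub> (i (X.coord s y) \<otimes>\<^bsub>E\<^esub> s (\<pi> y))"
      using that by simp
    also have "\<dots> = i ?a \<otimes>\<^bsub>E\<^esub> s (\<pi> x \<otimes>\<^bsub>G\<^esub> \<pi> y)"
      using that by (intro X.mult_decomp[OF s]) simp_all
    finally have "X.coord s (x \<otimes>\<^bsub>E\<^esub> y) = ?a" using that a by (simp only: X.coord_eq[OF s] X.pi.hom_closed X.G.m_closed)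
    then have "\<phi> (x \<otimes>\<^bsub>E\<^esub> y) = i' ?a \<otimes>\<^bsub>E'\<^esub> t (\<pi> x \<otimes>\<^bsub>G\<^esub> \<pi> y)" using that by (simp only: \<phi>_def X.pi.hom_mult)
    also have "\<dots> = \<phi> x \<otimes>\<^bsub>E'\<^esub> \<phi> y"
      using that unfolding \<phi>_def by (subst Y.mult_decomp[OF t]) (simp_all add: fs)
    finally show ?thesis .
  qed
  have bij: "bij_betw \<phi> (carrier E) (carrier E')"
    by (rule bij_betw_byWitness[where f' = \<psi>]) (use \<phi>c \<psi>c in auto)
  have iso: "\<phi> \<in> iso E E'" using bij hom \<phi>c(1) by (auto simp: iso_def hom_def)
  have s\<phi>: "smooth_map (mfd E) (mfd E') \<phi>"
    unfolding \<phi>_def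
    by (intro smooth_map_mult[OF Y.E X.lieE(3)] smooth_map_compose[OF X.lieE(3) X.lieA(3) Y.lieE(3) X.coord_smooth[OF s] Y.i_smooth]
        smooth_map_compose[OF X.lieE(3) X.lieG(3) Y.lieE(3) X.pi_smooth Y.section_smooth[OF t]])
  have "smooth_map (mfd E') (mfd E) \<psi>"
    unfolding \<psi>_def
    by (intro smooth_map_mult[OF X.E Y.lieE(3)] smooth_map_compose[OF Y.lieE(3) X.lieA(3) X.lieE(3) Y.coord_smooth[OF t] X.i_smooth]
        smooth_map_compose[OF Y.lieE(3) X.lieG(3) X.lieE(3) Y.pi_smooth X.section_smooth[OF s]])
  moreover have "\<psi> e = inv_into (carrier E) \<phi> e" if "e \<in> carrier E'" for e
    using inv_into_f_eq[OF bij_betw_imp_inj_on[OF bij] \<psi>c(1)[OF that] \<psi>c(3)[OF that]] by simp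
  ultimately have s\<psi>: "smooth_map (mfd E') (mfd E) (inv_into (carrier E) \<phi>)"
    by (rule smooth_map_cong[OF Y.lieE(3) X.lieE(3)]) (simp add: Y.lieE(4))
  have "\<phi> (i a) = i' a" if a: "a \<in> carrier A" for a
  proof -
    \<comment> \<open>The sections need not preserve the identity: \<open>?f\<close> is the element
      of \<open>A\<close> that corresponds to \<open>s \<one>\<close> and also to
      \<open>t \<one>\<close>, and it has to be divided out when \<open>i a\<close> is
      decomposed.\<close>
    let ?f = "factor_set G A E i s \<one>\<^bsub>G\<^esub> \<one>\<^bsub>G\<^esub>"
    have f: "?f \<in> carrier A" "i ?f = s \<one>\<^bsub>G\<^esub>" "i' ?f = t \<one>\<^bsub>G\<^esub>"
      using X.i_factor_set[OF s, of "\<one>\<^bsub>G\<^esub>" "\<one>\<^bsub>G\<^esub>"] Y.i_factor_set[OF t, of "\<one>\<^bsub>G\<^esub>" "\<one>\<^bsub>G\<^esub>"] fs[of "\<one>\<^bsub>G\<^esub>" "\<one>\<^bsub>G\<^esub>"]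
      by (simp_all add: X.E.m_assoc Y.E.m_assoc)
    have "i a = i (a \<otimes>\<^bsub>A\<^esub> inv\<^bsub>A\<^esub> ?f) \<otimes>\<^bsub>E\<^esub> s \<one>\<^bsub>G\<^esub>"
      using a f(1) by (simp add: f(2)[symmetric] X.E.m_assoc)
    then have "X.coord s (i a) = a \<otimes>\<^bsub>A\<^esub> inv\<^bsub>A\<^esub> ?f"
      using X.coord_eq[OF s, of "a \<otimes>\<^bsub>A\<^esub> inv\<^bsub>A\<^esub> ?f" "\<one>\<^bsub>G\<^esub>"] a f(1) by simp
    then have "\<phi> (i a) = i' (a \<otimes>\<^bsub>A\<^esub> inv\<^bsub>A\<^esub> ?f) \<otimes>\<^bsub>E'\<^esub> i' ?f" using a by (simp only: \<phi>_def X.pi_i f(3))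
    then show ?thesis using a f(1) by (simp add: Y.E.m_assoc)
  qed
  with iso s\<phi> s\<psi> \<phi>c(2) show ?thesis unfolding equivalent_extensions_def by auto
qed

end

section \<open>The extension defined by a symmetric cocycle\<close>

locale cocycle_extension = lie_module G A act
  for G :: "'g lie_group" and A :: "'a lie_group" and act +
  fixes \<sigma> :: "(nat \<Rightarrow> 'g) \<Rightarrow> 'a" and F :: "'g \<times> 'a \<Rightarrow> 'e"
  assumes \<sigma>: "\<sigma> \<in> sym_cocycles G A act 2" and F: "inj_on F (carrier G \<times> carrier A)"
begin

definition c where "c g h = \<sigma> (tuple2 g h)"

lemma \<sigma>_cochain: "\<sigma> \<in> cochains G A 2" and \<sigma>_sym: "\<sigma> \<in> sym_cochains G A act 2"
  using \<sigma> by (auto simp: sym_cocycles_def sym_cochains_def)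

lemma c_closed [simp]: "g \<in> carrier G \<Longrightarrow> h \<in> carrier G \<Longrightarrow> c g h \<in> carrier A"
  unfolding c_def by (rule cochain_closed[OF \<sigma>_cochain tuple_in_tuples(2)])

lemma c_sym: "g \<in> carrier G \<Longrightarrow> h \<in> carrier G \<Longrightarrow> inv\<^bsub>A\<^esub> (act g (c (inv\<^bsub>G\<^esub> g) (g \<otimes>\<^bsub>G\<^esub> h))) = c g h"
  using \<sigma>_sym unfolding sym_cochains2_iff c_def by blast

lemma c_cocycle:
  "g \<in> carrier G \<Longrightarrow> h \<in> carrier G \<Longrightarrow> k \<in> carrier G \<Longrightarrow>
    act g (c h k) \<otimes>\<^bsub>A\<^esub> c g (h \<otimes>\<^bsub>G\<^esub> k) = c g h \<otimes>\<^bsub>A\<^esub> c (g \<otimes>\<^bsub>G\<^esub> h) k"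
  using \<sigma> cocycle2_iff[OF \<sigma>_cochain] by (simp add: sym_cocycles_def c_def)

text \<open>The defect of normalisation. The cocycle identity at \<open>(\<one>, \<one>, k)\<close>
  and at \<open>(g, \<one>, \<one>)\<close> expresses every value of \<open>c\<close> with an
  argument \<open>\<one>\<close> through it.\<close>

definition u where "u = c \<one>\<^bsub>G\<^esub> \<one>\<^bsub>G\<^esub>"

lemma u_closed [simp]: "u \<in> carrier A" by (simp add: u_def)

lemma conjugate_u: "a \<in> carrier A \<Longrightarrow> u \<otimes>\<^bsub>A\<^esub> (a \<otimes>\<^bsub>A\<^esub> inv\<^bsub>A\<^esub> u) = a"
  using A.m_lcomm[of u a "inv\<^bsub>A\<^esub> u"] by simp

lemma c_one_left [simp]: "k \<in> carrier G \<Longrightarrow> c \<one>\<^bsub>G\<^esub> k = u"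
  using c_cocycle[of "\<one>\<^bsub>G\<^esub>" "\<one>\<^bsub>G\<^esub>" k] by (simp add: act_one u_def)

lemma c_one_right [simp]: "g \<in> carrier G \<Longrightarrow> c g \<one>\<^bsub>G\<^esub> = act g u"
  using c_cocycle[of g "\<one>\<^bsub>G\<^esub>" "\<one>\<^bsub>G\<^esub>"] by simp

text \<open>The symmetry condition at \<open>h = \<one>\<close> says that \<open>act g\<close> maps
  \<open>u\<close> and the inverse of \<open>c (inv g) g\<close> to the same element; acting by
  \<open>inv g\<close> removes \<open>act g\<close>.\<close>

lemma c_inv: "g \<in> carrier G \<Longrightarrow> c (inv\<^bsub>G\<^esub> g) g = inv\<^bsub>A\<^esub> u"
proof -
  assume g: "g \<in> carrier G"
  have "act g (inv\<^bsub>A\<^esub> (c (inv\<^bsub>G\<^esub> g) g)) = act g u"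
    using c_sym[of g "\<one>\<^bsub>G\<^esub>"] g by (simp add: act_inv)
  then have "act (inv\<^bsub>G\<^esub> g) (act g (inv\<^bsub>A\<^esub> (c (inv\<^bsub>G\<^esub> g) g))) = act (inv\<^bsub>G\<^esub> g) (act g u)" by simp
  then have "inv\<^bsub>A\<^esub> (c (inv\<^bsub>G\<^esub> g) g) = u" using g by (simp add: act_act[symmetric] act_one)
  then show ?thesis using g by (metis A.inv_inv G.inv_closed c_closed)
qed

abbreviation P where "P \<equiv> prod_manifold (mfd G) (mfd A)"
abbreviation T where "T \<equiv> transport_manifold F P"
abbreviation U where "U \<equiv> inv_into (carrier G \<times> carrier A) F"

definition E :: "'e lie_group" where
  "E = \<lparr>carrier = F ` (carrier G \<times> carrier A),
        mult = (\<lambda>x y. F (fst (U x) \<otimes>\<^bsub>G\<^esub> fst (U y),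
                         snd (U x) \<otimes>\<^bsub>A\<^esub> act (fst (U x)) (snd (U y)) \<otimes>\<^bsub>A\<^esub> c (fst (U x)) (fst (U y)))),
        one = F (\<one>\<^bsub>G\<^esub>, inv\<^bsub>A\<^esub> u), mfd = T\<rparr>"

text \<open>The shift by \<open>inv u\<close> compensates for the factor
  \<open>c \<one> \<one> = u\<close> in products, so that \<open>incl\<close> is a
  homomorphism.\<close>

definition incl :: "'a \<Rightarrow> 'e" where "incl a = F (\<one>\<^bsub>G\<^esub>, a \<otimes>\<^bsub>A\<^esub> inv\<^bsub>A\<^esub> u)"
definition proj :: "'e \<Rightarrow> 'g" where "proj x = fst (U x)"
definition sec :: "'g \<Rightarrow> 'e" where "sec g = F (g, \<one>\<^bsub>A\<^esub>)"

lemma topspace_P: "topspace (mtop P) = carrier G \<times> carrier A"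
  using lieG(4) lieA(4) by simp

lemma P: "smooth_manifold P" "charted P" "inj_on F (topspace (mtop P))"
  using smooth_manifold_prod_manifold[OF lieG(2) lieA(2)] smooth_manifold_charted F topspace_P by auto

lemma T: "smooth_manifold T" "charted T" "topspace (mtop T) = F ` (carrier G \<times> carrier A)"
    "smooth_map P T F" "smooth_map T P U"
  using smooth_manifold_transport[OF P(1,3)] charted_transport[OF P(1,3)] topspace_transport[OF P(1,3)]
    smooth_map_to_transport[OF P(1,3)] smooth_map_from_transport[OF P(1,3)] unfolding topspace_P by simp_all

lemma U_F [simp]: "g \<in> carrier G \<Longrightarrow> a \<in> carrier A \<Longrightarrow> U (F (g, a)) = (g, a)"
  using F by simp

lemma F_eq_iff: "g \<in> carrier G \<Longrightarrow> a \<in> carrier A \<Longrightarrow> h \<in> carrier G \<Longrightarrow> b \<in> carrier A \<Longrightarrow>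
   F (g, a) = F (h, b) \<longleftrightarrow> g = h \<and> a = b"
  using U_F by (metis prod.inject)

lemma carrier_E: "carrier E = F ` (carrier G \<times> carrier A)" and one_E: "\<one>\<^bsub>E\<^esub> = F (\<one>\<^bsub>G\<^esub>, inv\<^bsub>A\<^esub> u)"
  and mfd_E: "mfd E = T"
  by (simp_all add: E_def)

lemma F_closed [simp]: "g \<in> carrier G \<Longrightarrow> a \<in> carrier A \<Longrightarrow> F (g, a) \<in> carrier E"
  by (simp add: carrier_E)

lemma E_cases: assumes "x \<in> carrier E" obtains g a where "g \<in> carrier G" "a \<in> carrier A" "x = F (g, a)"
  using assms by (auto simp: carrier_E)

lemma mult_F [simp]:
  "g \<in> carrier G \<Longrightarrow> a \<in> carrier A \<Longrightarrow> h \<in> carrier G \<Longrightarrow> b \<in> carrier A \<Longrightarrow>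
   F (g, a) \<otimes>\<^bsub>E\<^esub> F (h, b) = F (g \<otimes>\<^bsub>G\<^esub> h, a \<otimes>\<^bsub>A\<^esub> act g b \<otimes>\<^bsub>A\<^esub> c g h)"
  by (simp add: E_def)

text \<open>Once the common factor \<open>?x\<close> is split off, associativity is the cocycle
  identity.\<close>

lemma mult_F_assoc:
  assumes "g \<in> carrier G" "h \<in> carrier G" "k \<in> carrier G" "a \<in> carrier A" "b \<in> carrier A" "d \<in> carrier A"
  shows "(a \<otimes>\<^bsub>A\<^esub> act g b \<otimes>\<^bsub>A\<^esub> c g h) \<otimes>\<^bsub>A\<^esub> act (g \<otimes>\<^bsub>G\<^esub> h) d \<otimes>\<^bsub>A\<^esub> c (g \<otimes>\<^bsub>G\<^esub> h) k =
    a \<otimes>\<^bsub>A\<^esub> act g (b \<otimes>\<^bsub>A\<^esub> act h d \<otimes>\<^bsub>A\<^esub> c h k) \<otimes>\<^bsub>A\<^esub> c g (h \<otimes>\<^bsub>G\<^esub> k)"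
proof -
  let ?x = "a \<otimes>\<^bsub>A\<^esub> act g b \<otimes>\<^bsub>A\<^esub> act g (act h d)"
  have "(a \<otimes>\<^bsub>A\<^esub> act g b \<otimes>\<^bsub>A\<^esub> c g h) \<otimes>\<^bsub>A\<^esub> act (g \<otimes>\<^bsub>G\<^esub> h) d \<otimes>\<^bsub>A\<^esub> c (g \<otimes>\<^bsub>G\<^esub> h) k = ?x \<otimes>\<^bsub>A\<^esub> (c g h \<otimes>\<^bsub>A\<^esub> c (g \<otimes>\<^bsub>G\<^esub> h) k)"
    using assms by (simp add: act_act A.m_ac)
  also have "\<dots> = ?x \<otimes>\<^bsub>A\<^esub> (act g (c h k) \<otimes>\<^bsub>A\<^esub> c g (h \<otimes>\<^bsub>G\<^esub> k))"
    using assms by (simp add: c_cocycle)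
  also have "\<dots> = a \<otimes>\<^bsub>A\<^esub> act g (b \<otimes>\<^bsub>A\<^esub> act h d \<otimes>\<^bsub>A\<^esub> c h k) \<otimes>\<^bsub>A\<^esub> c g (h \<otimes>\<^bsub>G\<^esub> k)"
    using assms by (simp add: act_mult A.m_ac)
  finally show ?thesis .
qed

text \<open>No correction by \<open>c\<close> appears: the factor \<open>c (inv g) g = inv u\<close>
  is already the \<open>A\<close>-component of the identity element. This is the effect of the
  symmetry of \<open>\<sigma>\<close>.\<close>

definition inverse_component where
  "inverse_component g a = inv\<^bsub>A\<^esub> (act (inv\<^bsub>G\<^esub> g) a)"

lemma inverse_component_closed [simp]: "g \<in> carrier G \<Longrightarrow> a \<in> carrier A \<Longrightarrow> inverse_component g a \<in> carrier A"
  by (simp add: inverse_component_def)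

lemma l_inv_F:
  "g \<in> carrier G \<Longrightarrow> a \<in> carrier A \<Longrightarrow> F (inv\<^bsub>G\<^esub> g, inverse_component g a) \<otimes>\<^bsub>E\<^esub> F (g, a) = \<one>\<^bsub>E\<^esub>"
  by (simp add: inverse_component_def one_E c_inv)

lemma group_E: "group E"
proof (rule groupI)
  show "\<one>\<^bsub>E\<^esub> \<in> carrier E" by (simp add: one_E)
  fix x assume "x \<in> carrier E"
  then obtain g a where x: "g \<in> carrier G" "a \<in> carrier A" "x = F (g, a)" by (rule E_cases)
  show "\<one>\<^bsub>E\<^esub> \<otimes>\<^bsub>E\<^esub> x = x" using x by (simp add: one_E act_one A.m_ac)
  show "\<exists>y\<in>carrier E. y \<otimes>\<^bsub>E\<^esub> x = \<one>\<^bsub>E\<^esub>"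
    using x l_inv_F[OF x(1,2)] by (intro bexI[of _ "F (inv\<^bsub>G\<^esub> g, inverse_component g a)"]) simp_all
  fix y assume "y \<in> carrier E"
  then obtain h b where y: "h \<in> carrier G" "b \<in> carrier A" "y = F (h, b)" by (rule E_cases)
  show "x \<otimes>\<^bsub>E\<^esub> y \<in> carrier E" using x y by simp
  fix z assume "z \<in> carrier E"
  then obtain k d where z: "k \<in> carrier G" "d \<in> carrier A" "z = F (k, d)" by (rule E_cases)
  show "x \<otimes>\<^bsub>E\<^esub> y \<otimes>\<^bsub>E\<^esub> z = x \<otimes>\<^bsub>E\<^esub> (y \<otimes>\<^bsub>E\<^esub> z)"
    using x y z mult_F_assoc by (simp add: G.m_assoc)
qed

sublocale E: group E by (rule group_E)

lemma inv_F: "g \<in> carrier G \<Longrightarrow> a \<in> carrier A \<Longrightarrow> inv\<^bsub>E\<^esub> (F (g, a)) = F (inv\<^bsub>G\<^esub> g, inverse_component g a)"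
  using l_inv_F by (intro E.inv_equality) simp_all

lemma smooth_map_c:
  assumes M: "charted M" and f: "smooth_map M (mfd G) f" and g: "smooth_map M (mfd G) g"
  shows "smooth_map M (mfd A) (\<lambda>x. c (f x) (g x))"
  using smooth_map_compose[OF M GG(1) lieA(3) smooth_map_pair[OF f g] smooth_tuple2[OF \<sigma>_cochain]]
  by (simp add: c_def)

lemma smooth_map_F:
  assumes M: "charted M" and f: "smooth_map M (mfd G) f" and g: "smooth_map M (mfd A) g"
  shows "smooth_map M T (\<lambda>x. F (f x, g x))"
  by (rule smooth_map_compose[OF M P(2) T(2) smooth_map_pair[OF f g] T(4)])

lemma smooth_map_components:
  assumes M: "charted M" and f: "smooth_map M T f"
  shows "smooth_map M (mfd G) (\<lambda>x. fst (U (f x)))" "smooth_map M (mfd A) (\<lambda>x. snd (U (f x)))"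
  by (rule smooth_map_compose[OF M P(2) lieG(3) smooth_map_compose[OF M T(2) P(2) f T(5)] smooth_map_fst[OF lieG(2) lieA(3)]],
      rule smooth_map_compose[OF M P(2) lieA(3) smooth_map_compose[OF M T(2) P(2) f T(5)] smooth_map_snd[OF lieG(3) lieA(2)]])

lemma lie_group_E: "is_lie_group E"
  unfolding is_lie_group_def mfd_E
proof (intro conjI)
  show "group E" by (rule group_E)
  show "smooth_manifold T" by (rule T)
  show "topspace (mtop T) = carrier E" by (simp add: T(3) carrier_E)
  have TT: "charted (prod_manifold T T)" by (rule charted_prod_manifold[OF T(2,2)])
  note x = smooth_map_components[OF TT smooth_map_fst[OF T(1,2)]]
    and y = smooth_map_components[OF TT smooth_map_snd[OF T(2,1)]]
  have "smooth_map (prod_manifold T T) T (\<lambda>z. fst z \<otimes>\<^bsub>E\<^esub> snd z)"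
    unfolding E_def monoid.select_convs
    by (rule smooth_map_F[OF TT smooth_map_mult[OF G TT x(1) y(1)]
          smooth_map_mult[OF A TT smooth_map_mult[OF A TT x(2) smooth_map_act[OF TT x(1) y(2)]] smooth_map_c[OF TT x(1) y(1)]]])
  then show "smooth_map (prod_manifold T T) T (\<lambda>(x, y). x \<otimes>\<^bsub>E\<^esub> y)" by (simp add: case_prod_beta')
  note x = smooth_map_components[OF T(2) smooth_map_id[OF T(1)]]
  \<comment> \<open>The explicit formula is smooth on all of \<open>T\<close>; by
    \<open>inv_F\<close> it agrees with the group inverse on the carrier.\<close>
  have "smooth_map T T (\<lambda>x. F (inv\<^bsub>G\<^esub> (fst (U x)), inverse_component (fst (U x)) (snd (U x))))"
    unfolding inverse_component_def
    by (rule smooth_map_F[OF T(2) smooth_map_inv[OF G T(2) x(1)]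
          smooth_map_inv[OF A T(2) smooth_map_act[OF T(2) smooth_map_inv[OF G T(2) x(1)] x(2)]]])
  then show "smooth_map T T (\<lambda>x. inv\<^bsub>E\<^esub> x)"
    by (rule smooth_map_cong[OF T(2,2)]) (auto simp: T(3) inv_F)
qed

lemma proj_F [simp]: "g \<in> carrier G \<Longrightarrow> a \<in> carrier A \<Longrightarrow> proj (F (g, a)) = g"
  by (simp add: proj_def)

lemma incl_inj: "inj_on incl (carrier A)"
  by (rule inj_onI) (simp add: incl_def F_eq_iff)

lemma sec_smooth: "smooth_map (mfd G) T sec"
  unfolding sec_def by (rule smooth_map_F[OF lieG(3) smooth_map_id[OF lieG(2)] smooth_map_const]) (simp add: lieA(4))

lemma sec_section: "is_section G (E, incl, proj) sec"
  by (simp add: is_section_def sec_def)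

lemma lie_extension_E: "lie_extension G A (E, incl, proj)"
  unfolding lie_extension_def prod.case mfd_E
proof (intro conjI)
  show "is_lie_group E" by (rule lie_group_E)
  show "incl \<in> hom A E"
    by (rule homI) (simp_all add: incl_def act_one A.m_ac)
  show "smooth_map (mfd A) T incl"
    unfolding incl_def
    by (rule smooth_map_F[OF lieA(3) smooth_map_const smooth_map_mult[OF A lieA(3) smooth_map_id[OF lieA(2)] smooth_map_const]])
      (simp_all add: lieG(4) lieA(4))
  show "proj \<in> hom E G"
    by (rule homI) (auto elim!: E_cases)
  show "smooth_map T (mfd G) proj"
    unfolding proj_def by (rule smooth_map_components(1)[OF T(2) smooth_map_id[OF T(1)]])
  show "inj_on incl (carrier A)" by (rule incl_inj)
  show "incl ` carrier A = kernel E G proj"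
  proof
    show "incl ` carrier A \<subseteq> kernel E G proj" by (auto simp: incl_def kernel_def)
    show "kernel E G proj \<subseteq> incl ` carrier A"
    proof
      fix x assume "x \<in> kernel E G proj"
      then have x: "x \<in> carrier E" "proj x = \<one>\<^bsub>G\<^esub>" by (simp_all add: kernel_def)
      from x(1) obtain g a where ga: "g \<in> carrier G" "a \<in> carrier A" "x = F (g, a)" by (rule E_cases)
      then have "x = incl (a \<otimes>\<^bsub>A\<^esub> u)" using x(2) by (simp add: incl_def A.m_assoc)
      then show "x \<in> incl ` carrier A" using ga by simp
    qed
  qed
  show "proj ` carrier E = carrier G"
  proof
    show "proj ` carrier E \<subseteq> carrier G" by (auto elim!: E_cases)
    show "carrier G \<subseteq> proj ` carrier E"
    proof
      fix g assume "g \<in> carrier G"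
      then show "g \<in> proj ` carrier E"
        using sec_section by (intro image_eqI[of _ _ "sec g"]) (auto simp: is_section_def)
    qed
  qed
  \<comment> \<open>The global section \<open>sec\<close> serves as local section, with the whole
    group as neighbourhood.\<close>
  show "\<exists>V s. openin (mtop (mfd G)) V \<and> \<one>\<^bsub>G\<^esub> \<in> V \<and> smooth_map (open_submanifold (mfd G) V) T s \<and> (\<forall>g\<in>V. proj (s g) = g)"
  proof (rule exI[of _ "topspace (mtop (mfd G))"], rule exI[of _ sec])
    show "openin (mtop (mfd G)) (topspace (mtop (mfd G))) \<and> \<one>\<^bsub>G\<^esub> \<in> topspace (mtop (mfd G)) \<and>
        smooth_map (open_submanifold (mfd G) (topspace (mtop (mfd G)))) T sec \<and> (\<forall>g\<in>topspace (mtop (mfd G)). proj (sec g) = g)"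
      unfolding open_submanifold_topspace[OF lieG(3)]
      using sec_smooth sec_section openin_topspace[of "mtop (mfd G)", unfolded lieG(4)]
      by (simp add: lieG(4) is_section_def)
  qed
qed

text \<open>The products of \<open>s g\<close> with \<open>incl a\<close> and of
  \<open>incl (act g a)\<close> with \<open>s g\<close> agree: the shift in \<open>incl\<close>
  cancels against \<open>c g \<one> = act g u\<close> in the first and against
  \<open>c \<one> g = u\<close> in the second.\<close>

lemma corresponds_E: "corresponds_to_action G A act (E, incl, proj)"
  unfolding corresponds_to_action_def prod.case
proof (intro allI impI ballI)
  fix s g a assume s: "is_section G (E, incl, proj) s" and g: "g \<in> carrier G" and a: "a \<in> carrier A"
  have "s g \<in> carrier E" "proj (s g) = g" using s g by (auto simp: is_section_def)
  then obtain b where b: "b \<in> carrier A" "s g = F (g, b)" by (elim E_cases) auto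
  have "s g \<otimes>\<^bsub>E\<^esub> incl a = F (g, b \<otimes>\<^bsub>A\<^esub> act g a)"
    using b g a by (simp add: incl_def act_mult act_inv A.m_assoc)
  also have "\<dots> = incl (act g a) \<otimes>\<^bsub>E\<^esub> s g"
    using b g a conjugate_u[of "act g a"] by (simp add: incl_def act_one A.m_ac)
  finally have "s g \<otimes>\<^bsub>E\<^esub> incl a \<otimes>\<^bsub>E\<^esub> inv\<^bsub>E\<^esub> (s g) = incl (act g a)"
    using b g a by (simp add: E.m_assoc incl_def del: mult_F)
  then show "act g a = inv_into (carrier A) incl (s g \<otimes>\<^bsub>E\<^esub> incl a \<otimes>\<^bsub>E\<^esub> inv\<^bsub>E\<^esub> (s g))"
    using incl_inj g a by simp
qed

text \<open>The section \<open>sec\<close> works. It is symmetric because the inverse of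
  \<open>F (g, \<one>)\<close> is \<open>F (inv g, \<one>)\<close>, and its factor set is
  \<open>c\<close> because \<open>c g h\<close> is the \<open>A\<close>-component of the product of
  \<open>sec g\<close> and \<open>sec h\<close>.\<close>

lemma extension_with_cocycle:
  "\<exists>X :: ('a, 'e, 'g) extension. \<exists>s. X \<in> sym_extensions G A act \<and> symmetric_smooth_section G X s \<and> section_cocycle G A X s = \<sigma>"
proof -
  interpret X: lie_module_extension G A act E incl proj
    by unfold_locales (rule lie_extension_E, rule corresponds_E)
  have "sec (inv\<^bsub>G\<^esub> g) = inv\<^bsub>E\<^esub> (sec g)" if "g \<in> carrier G" for g
    using that by (simp add: sec_def inv_F inverse_component_def act_unit)
  then have s: "symmetric_smooth_section G (E, incl, proj) sec"
    using sec_section sec_smooth by (simp add: symmetric_smooth_section_def mfd_E)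
  have "factor_set G A E incl sec g h = c g h" if "g \<in> carrier G" "h \<in> carrier G" for g h
  proof -
    have "incl (c g h) \<otimes>\<^bsub>E\<^esub> sec (g \<otimes>\<^bsub>G\<^esub> h) = sec g \<otimes>\<^bsub>E\<^esub> sec h"
      using that by (simp add: incl_def sec_def act_one act_unit A.m_assoc)
    then have "incl (factor_set G A E incl sec g h) = incl (c g h) \<otimes>\<^bsub>E\<^esub> sec (g \<otimes>\<^bsub>G\<^esub> h) \<otimes>\<^bsub>E\<^esub> inv\<^bsub>E\<^esub> (sec (g \<otimes>\<^bsub>G\<^esub> h))"
      using that by (simp only: X.i_factor_set[OF s])
    also have "\<dots> = incl (c g h)"
      using that X.section_closed[OF s, of "g \<otimes>\<^bsub>G\<^esub> h"] by (simp add: E.m_assoc del: mult_F)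
    finally show ?thesis using that X.factor_set_closed[OF s that] by (simp only: X.i_eq_iff c_closed)
  qed
  then have "\<forall>x\<in>tuples G 2. factor_set G A E incl sec (x 1) (x 2) = \<sigma> x"
    unfolding ball_tuples2 tuple_nth by (simp add: c_def)
  then have "section_cocycle G A (E, incl, proj) sec = \<sigma>"
    using \<sigma>_cochain unfolding section_cocycle_def prod.case cochains_iff by (simp only: extensional_eq_iff)
  moreover have "(E, incl, proj) \<in> sym_extensions G A act"
    using lie_extension_E corresponds_E s by (auto simp: sym_extensions_def has_symmetric_smooth_section_iff)
  ultimately show ?thesis using s by blast
qed

end

section \<open>The classification\<close>

context lie_module
begin

section \<open>Coboundaries and cohomology classes as cosets\<close>

abbreviation "H \<equiv> cochain_group G A 2"
abbreviation "B \<equiv> sym_coboundaries G A act 2"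

lemma sym_coboundaries2: "B = coboundary G A act 1 ` sym_cochains G A act 1"
  by (simp add: sym_coboundaries_def numeral_2_eq_2)

lemma mult_H: "f \<otimes>\<^bsub>H\<^esub> g = (\<lambda>x\<in>tuples G 2. f x \<otimes>\<^bsub>A\<^esub> g x)"
  by (simp add: cochain_group_def)

lemma sym_cochain1_closed: "\<mu> \<in> sym_cochains G A act 1 \<Longrightarrow> g \<in> carrier G \<Longrightarrow> \<mu> (tuple1 g) \<in> carrier A"
  by (rule cochain_closed[OF _ tuple_in_tuples(1)]) (simp_all add: sym_cochains_def)

lemma coboundary1_nth:
  assumes "\<mu> \<in> sym_cochains G A act 1" "g \<in> carrier G" "h \<in> carrier G"
  shows "coboundary G A act 1 \<mu> (tuple2 g h) =
    act g (\<mu> (tuple1 h)) \<otimes>\<^bsub>A\<^esub> inv\<^bsub>A\<^esub> (\<mu> (tuple1 (g \<otimes>\<^bsub>G\<^esub> h))) \<otimes>\<^bsub>A\<^esub> \<mu> (tuple1 g)"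
proof -
  have "\<mu> \<in> cochains G A 1" using assms(1) unfolding sym_cochains1_iff by blast
  then show ?thesis
    by (simp only: coboundary1 restrict_apply'[OF tuple_in_tuples(2)[OF assms(2,3)]] tuple_nth)
qed

lemma sym_cochain1I:
  assumes "smooth_map (mfd G) (mfd A) f" "\<And>g. g \<in> carrier G \<Longrightarrow> inv\<^bsub>A\<^esub> (act g (f (inv\<^bsub>G\<^esub> g))) = f g"
  shows "\<exists>\<mu>\<in>sym_cochains G A act 1. \<forall>g\<in>carrier G. \<mu> (tuple1 g) = f g"
proof (intro bexI ballI)
  show *: "(\<lambda>x\<in>tuples G 1. f (x 1)) (tuple1 g) = f g" if "g \<in> carrier G" for g
    by (simp only: restrict_apply'[OF tuple_in_tuples(1)[OF that]] tuple_nth)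
  show "(\<lambda>x\<in>tuples G 1. f (x 1)) \<in> sym_cochains G A act 1"
    unfolding sym_cochains1_iff using cochain1I[OF assms(1)] assms(2) * by (simp only: G.inv_closed) simp
qed

text \<open>Multiplying the underlying 1-cochains gives \<open>b''\<close>. Together with
  \<open>coboundary_inv\<close> and \<open>coboundary_one\<close> this is the subgroup property
  behind the comparison of cosets, stated pointwise on tuples.\<close>

lemma coboundary_mult:
  assumes "b \<in> B" "b' \<in> B"
  shows "\<exists>b''\<in>B. \<forall>x\<in>tuples G 2. b'' x = b x \<otimes>\<^bsub>A\<^esub> b' x"
proof -
  obtain \<mu> \<nu> where \<mu>: "\<mu> \<in> sym_cochains G A act 1" "b = coboundary G A act 1 \<mu>"
    and \<nu>: "\<nu> \<in> sym_cochains G A act 1" "b' = coboundary G A act 1 \<nu>"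
    using assms unfolding sym_coboundaries2 by blast
  note [simp] = sym_cochain1_closed[OF \<mu>(1)] sym_cochain1_closed[OF \<nu>(1)]
  have c: "\<mu> \<in> cochains G A 1" "\<nu> \<in> cochains G A 1" using \<mu> \<nu> unfolding sym_cochains1_iff by blast+
  have "\<exists>\<xi>\<in>sym_cochains G A act 1. \<forall>g\<in>carrier G. \<xi> (tuple1 g) = \<mu> (tuple1 g) \<otimes>\<^bsub>A\<^esub> \<nu> (tuple1 g)"
  proof (rule sym_cochain1I)
    show "smooth_map (mfd G) (mfd A) (\<lambda>g. \<mu> (tuple1 g) \<otimes>\<^bsub>A\<^esub> \<nu> (tuple1 g))"
      by (rule smooth_map_mult[OF A lieG(3) smooth_tuple1[OF c(1)] smooth_tuple1[OF c(2)]])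
    show "inv\<^bsub>A\<^esub> (act g (\<mu> (tuple1 (inv\<^bsub>G\<^esub> g)) \<otimes>\<^bsub>A\<^esub> \<nu> (tuple1 (inv\<^bsub>G\<^esub> g)))) = \<mu> (tuple1 g) \<otimes>\<^bsub>A\<^esub> \<nu> (tuple1 g)"
      if "g \<in> carrier G" for g
      using that \<mu>(1) \<nu>(1) unfolding sym_cochains1_iff by (simp add: act_mult A.inv_mult)
  qed
  then obtain \<xi> where \<xi>: "\<xi> \<in> sym_cochains G A act 1" "\<forall>g\<in>carrier G. \<xi> (tuple1 g) = \<mu> (tuple1 g) \<otimes>\<^bsub>A\<^esub> \<nu> (tuple1 g)" by blast
  have "\<forall>x\<in>tuples G 2. coboundary G A act 1 \<xi> x = b x \<otimes>\<^bsub>A\<^esub> b' x"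
    unfolding ball_tuples2 \<mu>(2) \<nu>(2)
    by (simp add: coboundary1_nth[OF \<xi>(1)] coboundary1_nth[OF \<mu>(1)] coboundary1_nth[OF \<nu>(1)] \<xi>(2) act_mult A.inv_mult A.m_ac del: One_nat_def)
  then show ?thesis using \<xi>(1) unfolding sym_coboundaries2 by blast
qed

lemma coboundary_inv:
  assumes "b \<in> B"
  shows "\<exists>b'\<in>B. \<forall>x\<in>tuples G 2. b' x = inv\<^bsub>A\<^esub> (b x)"
proof -
  obtain \<mu> where \<mu>: "\<mu> \<in> sym_cochains G A act 1" "b = coboundary G A act 1 \<mu>"
    using assms unfolding sym_coboundaries2 by blast
  note [simp] = sym_cochain1_closed[OF \<mu>(1)]
  have c: "\<mu> \<in> cochains G A 1" using \<mu> unfolding sym_cochains1_iff by blast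
  have "\<exists>\<xi>\<in>sym_cochains G A act 1. \<forall>g\<in>carrier G. \<xi> (tuple1 g) = inv\<^bsub>A\<^esub> (\<mu> (tuple1 g))"
  proof (rule sym_cochain1I)
    show "smooth_map (mfd G) (mfd A) (\<lambda>g. inv\<^bsub>A\<^esub> (\<mu> (tuple1 g)))"
      by (rule smooth_map_inv[OF A lieG(3) smooth_tuple1[OF c]])
    show "inv\<^bsub>A\<^esub> (act g (inv\<^bsub>A\<^esub> (\<mu> (tuple1 (inv\<^bsub>G\<^esub> g))))) = inv\<^bsub>A\<^esub> (\<mu> (tuple1 g))" if "g \<in> carrier G" for g
      using that \<mu>(1) unfolding sym_cochains1_iff by (simp add: act_inv)
  qed
  then obtain \<xi> where \<xi>: "\<xi> \<in> sym_cochains G A act 1" "\<forall>g\<in>carrier G. \<xi> (tuple1 g) = inv\<^bsub>A\<^esub> (\<mu> (tuple1 g))" by blast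
  have "\<forall>x\<in>tuples G 2. coboundary G A act 1 \<xi> x = inv\<^bsub>A\<^esub> (b x)"
    unfolding ball_tuples2 \<mu>(2)
    by (simp add: coboundary1_nth[OF \<xi>(1)] coboundary1_nth[OF \<mu>(1)] \<xi>(2) act_inv A.inv_mult A.m_ac del: One_nat_def)
  then show ?thesis using \<xi>(1) unfolding sym_coboundaries2 by blast
qed

lemma coboundary_one: "\<exists>b\<in>B. \<forall>x\<in>tuples G 2. b x = \<one>\<^bsub>A\<^esub>"
proof -
  have "\<exists>\<xi>\<in>sym_cochains G A act 1. \<forall>g\<in>carrier G. \<xi> (tuple1 g) = \<one>\<^bsub>A\<^esub>"
    by (rule sym_cochain1I) (simp_all add: smooth_map_const lieA(4) act_unit)
  then obtain \<xi> where \<xi>: "\<xi> \<in> sym_cochains G A act 1" "\<forall>g\<in>carrier G. \<xi> (tuple1 g) = \<one>\<^bsub>A\<^esub>" by blast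
  have "\<forall>x\<in>tuples G 2. coboundary G A act 1 \<xi> x = \<one>\<^bsub>A\<^esub>"
    unfolding ball_tuples2 by (simp add: coboundary1_nth[OF \<xi>(1)] \<xi>(2) act_unit del: One_nat_def)
  then show ?thesis using \<xi>(1) unfolding sym_coboundaries2 by blast
qed

lemma coboundary_closed: "b \<in> B \<Longrightarrow> x \<in> tuples G 2 \<Longrightarrow> b x \<in> carrier A"
proof -
  assume "b \<in> B" and x: "x \<in> tuples G 2"
  then obtain \<mu> where \<mu>: "\<mu> \<in> sym_cochains G A act 1" "b = coboundary G A act 1 \<mu>"
    unfolding sym_coboundaries2 by blast
  have "\<forall>x\<in>tuples G 2. b x \<in> carrier A"
    unfolding ball_tuples2 \<mu>(2) by (simp add: coboundary1_nth[OF \<mu>(1)] sym_cochain1_closed[OF \<mu>(1)] del: One_nat_def)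
  with x show ?thesis by blast
qed

text \<open>The right coset of \<open>\<sigma>\<close>, in the form in which \<open>Mod\<close>
  produces the elements of \<open>sym_smooth_cohomology\<close>.\<close>

definition cohomology_class where "cohomology_class \<sigma> = (\<lambda>b. b \<otimes>\<^bsub>H\<^esub> \<sigma>) ` B"

lemma carrier_cohomology: "carrier (sym_smooth_cohomology G A act 2) = cohomology_class ` sym_cocycles G A act 2"
  unfolding sym_smooth_cohomology_def FactGroup_def RCOSETS_def r_coset_def cohomology_class_def
  by auto

lemma cohomology_class_eq_iff:
  assumes \<sigma>: "\<sigma> \<in> cochains G A 2" and \<tau>: "\<tau> \<in> cochains G A 2"
  shows "cohomology_class \<sigma> = cohomology_class \<tau> \<longleftrightarrow> (\<exists>b\<in>B. \<tau> = b \<otimes>\<^bsub>H\<^esub> \<sigma>)"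
proof
  note c\<sigma> = cochain_closed[OF \<sigma>] and c\<tau> = cochain_closed[OF \<tau>]
  assume eq: "cohomology_class \<sigma> = cohomology_class \<tau>"
  \<comment> \<open>The trivial coboundary shows that \<open>\<tau>\<close> lies in its own
    coset.\<close>
  obtain e where e: "e \<in> B" "\<forall>x\<in>tuples G 2. e x = \<one>\<^bsub>A\<^esub>" using coboundary_one by blast
  have "e \<otimes>\<^bsub>H\<^esub> \<tau> = \<tau>" unfolding mult_H using \<tau> e(2) c\<tau> unfolding cochains_iff
    by (subst extensional_eq_iff) auto
  then have "\<tau> \<in> cohomology_class \<tau>" using e(1) unfolding cohomology_class_def by (metis imageI)
  then have "\<tau> \<in> cohomology_class \<sigma>" by (simp only: eq)
  then show "\<exists>b\<in>B. \<tau> = b \<otimes>\<^bsub>H\<^esub> \<sigma>" unfolding cohomology_class_def by blast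
next
  note c\<sigma> = cochain_closed[OF \<sigma>]
  assume "\<exists>b\<in>B. \<tau> = b \<otimes>\<^bsub>H\<^esub> \<sigma>"
  then obtain b where b: "b \<in> B" "\<tau> = b \<otimes>\<^bsub>H\<^esub> \<sigma>" by blast
  obtain b' where b': "b' \<in> B" "\<forall>x\<in>tuples G 2. b' x = inv\<^bsub>A\<^esub> (b x)" using coboundary_inv[OF b(1)] by blast
  show "cohomology_class \<sigma> = cohomology_class \<tau>"
  proof
    show "cohomology_class \<tau> \<subseteq> cohomology_class \<sigma>"
    proof
      fix y assume "y \<in> cohomology_class \<tau>"
      then obtain d where d: "d \<in> B" "y = d \<otimes>\<^bsub>H\<^esub> \<tau>" by (auto simp: cohomology_class_def)
      obtain k where k: "k \<in> B" "\<forall>x\<in>tuples G 2. k x = d x \<otimes>\<^bsub>A\<^esub> b x" using coboundary_mult[OF d(1) b(1)] by blast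
      have "y = k \<otimes>\<^bsub>H\<^esub> \<sigma>" unfolding d(2) b(2) mult_H
        by (rule restrict_ext) (simp add: k(2) A.m_assoc coboundary_closed b d c\<sigma>)
      then show "y \<in> cohomology_class \<sigma>" using k(1) by (simp add: cohomology_class_def)
    qed
    show "cohomology_class \<sigma> \<subseteq> cohomology_class \<tau>"
    proof
      fix y assume "y \<in> cohomology_class \<sigma>"
      then obtain d where d: "d \<in> B" "y = d \<otimes>\<^bsub>H\<^esub> \<sigma>" by (auto simp: cohomology_class_def)
      obtain k where k: "k \<in> B" "\<forall>x\<in>tuples G 2. k x = d x \<otimes>\<^bsub>A\<^esub> b' x" using coboundary_mult[OF d(1) b'(1)] by blast
      have "y = k \<otimes>\<^bsub>H\<^esub> \<tau>" unfolding d(2) b(2) mult_H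
        by (rule restrict_ext) (simp add: k(2) b'(2) A.m_assoc coboundary_closed b d c\<sigma>)
      then show "y \<in> cohomology_class \<tau>" using k(1) by (simp add: cohomology_class_def)
    qed
  qed
qed

lemma extension_locale:
  "(E, i, \<pi>) \<in> sym_extensions G A act \<Longrightarrow> lie_module_extension G A act E i \<pi>"
  by unfold_locales (simp_all add: sym_extensions_def)

text \<open>If the classes agree, the section of \<open>X\<close> is shifted until its factor set
  equals that of \<open>t\<close>, and equal factor sets give an equivalence. Conversely, the
  section of \<open>Y\<close> transported from \<open>s\<close> keeps its factor set, and it differs
  from \<open>t\<close> by a symmetric 1-cochain.\<close>

lemma same_class_iff_equivalent:
  assumes X: "X \<in> sym_extensions G A act" and Y: "Y \<in> sym_extensions G A act"
    and s: "symmetric_smooth_section G X s" and t: "symmetric_smooth_section G Y t"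
  shows "cohomology_class (section_cocycle G A X s) = cohomology_class (section_cocycle G A Y t) \<longleftrightarrow>
    equivalent_extensions A X Y"
proof -
  obtain E i \<pi> E' i' \<pi>' where XY: "X = (E, i, \<pi>)" "Y = (E', i', \<pi>')" by (metis prod_cases3)
  interpret X: lie_module_extension G A act E i \<pi> by (rule extension_locale) (use X XY in simp)
  interpret Y: lie_module_extension G A act E' i' \<pi>' by (rule extension_locale) (use Y XY in simp)
  interpret two_extensions G A act E i \<pi> E' i' \<pi>' ..
  note s = s[unfolded XY] and t = t[unfolded XY]
  have cX: "section_cocycle G A X s \<in> cochains G A 2" unfolding XY by (rule X.section_cocycle_in_cochains[OF s])
  have cY: "section_cocycle G A Y r \<in> cochains G A 2" if "symmetric_smooth_section G Y r" for r
    using Y.section_cocycle_in_cochains that by (simp add: XY)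
  show ?thesis
  proof
    assume "cohomology_class (section_cocycle G A X s) = cohomology_class (section_cocycle G A Y t)"
    then obtain b where "b \<in> B" "section_cocycle G A Y t = b \<otimes>\<^bsub>H\<^esub> section_cocycle G A X s"
      using cohomology_class_eq_iff[OF cX cY] t XY by blast
    then obtain \<mu> where \<mu>: "\<mu> \<in> sym_cochains G A act 1"
      "section_cocycle G A Y t = coboundary G A act 1 \<mu> \<otimes>\<^bsub>H\<^esub> section_cocycle G A X s"
      unfolding sym_coboundaries2 by blast
    obtain r where "symmetric_smooth_section G (E, i, \<pi>) r"
      "section_cocycle G A (E, i, \<pi>) r = coboundary G A act 1 \<mu> \<otimes>\<^bsub>H\<^esub> section_cocycle G A (E, i, \<pi>) s"
      using X.shift_section[OF s \<mu>(1)] by blast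
    then show "equivalent_extensions A X Y"
      using same_cocycle_imp_equivalent[OF _ t] \<mu>(2) unfolding XY by metis
  next
    assume "equivalent_extensions A X Y"
    then obtain r where r: "symmetric_smooth_section G (E', i', \<pi>') r"
      "section_cocycle G A (E', i', \<pi>') r = section_cocycle G A (E, i, \<pi>) s"
      using equivalent_imp_same_cocycle[OF _ s] unfolding XY by blast
    obtain \<mu> where "\<mu> \<in> sym_cochains G A act 1"
      "section_cocycle G A (E', i', \<pi>') t = coboundary G A act 1 \<mu> \<otimes>\<^bsub>H\<^esub> section_cocycle G A (E', i', \<pi>') r"
      using Y.sections_differ_by_cochain[OF r(1) t] by blast
    then have "\<exists>b\<in>B. section_cocycle G A Y t = b \<otimes>\<^bsub>H\<^esub> section_cocycle G A Y r"
      unfolding XY sym_coboundaries2 by blast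
    moreover have "symmetric_smooth_section G Y r" "symmetric_smooth_section G Y t" using r t XY by auto
    ultimately have "cohomology_class (section_cocycle G A Y r) = cohomology_class (section_cocycle G A Y t)"
      using cohomology_class_eq_iff[OF cY cY] by blast
    then show "cohomology_class (section_cocycle G A X s) = cohomology_class (section_cocycle G A Y t)"
      using r(2) by (simp add: XY)
  qed
qed

end

text \<open>The relation is the kernel of \<open>f\<close> on \<open>S\<close>; so \<open>f\<close>
  takes a single value on each class, which \<open>the_elem\<close> extracts, and distinct classes
  have distinct values.\<close>

lemma bij_betw_quotient_image:
  assumes "\<And>x y. x \<in> S \<Longrightarrow> y \<in> S \<Longrightarrow> Q x y \<longleftrightarrow> f x = f y"
  shows "\<exists>\<Psi>. bij_betw \<Psi> (S // {(x, y). x \<in> S \<and> y \<in> S \<and> Q x y}) (f ` S)"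
proof -
  let ?R = "{(x, y). x \<in> S \<and> y \<in> S \<and> Q x y}"
  have cls: "?R `` {x} = {y \<in> S. f y = f x}" if "x \<in> S" for x
    using assms that by auto
  have img: "the_elem (f ` (?R `` {x})) = f x" if "x \<in> S" for x
  proof -
    have "f ` (?R `` {x}) = {f x}" unfolding cls[OF that] using that by auto
    then show ?thesis by simp
  qed
  have "bij_betw (\<lambda>C. the_elem (f ` C)) (S // ?R) (f ` S)"
    unfolding bij_betw_def
  proof
    show "inj_on (\<lambda>C. the_elem (f ` C)) (S // ?R)"
    proof (rule inj_onI)
      fix C D assume C: "C \<in> S // ?R" and D: "D \<in> S // ?R" and eq: "the_elem (f ` C) = the_elem (f ` D)"
      obtain x where x: "x \<in> S" "C = ?R `` {x}" using C by (rule quotientE)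
      obtain y where y: "y \<in> S" "D = ?R `` {y}" using D by (rule quotientE)
      have "f x = f y" using eq img[OF x(1)] img[OF y(1)] unfolding x(2) y(2) by simp
      then show "C = D" unfolding x(2) y(2) cls[OF x(1)] cls[OF y(1)] by simp
    qed
    show "(\<lambda>C. the_elem (f ` C)) ` (S // ?R) = f ` S"
    proof
      show "(\<lambda>C. the_elem (f ` C)) ` (S // ?R) \<subseteq> f ` S"
      proof
        fix z assume "z \<in> (\<lambda>C. the_elem (f ` C)) ` (S // ?R)"
        then obtain C where C: "C \<in> S // ?R" "z = the_elem (f ` C)" by blast
        obtain x where x: "x \<in> S" "C = ?R `` {x}" using C(1) by (rule quotientE)
        show "z \<in> f ` S" unfolding C(2) x(2) img[OF x(1)] by (rule imageI[OF x(1)])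
      qed
      show "f ` S \<subseteq> (\<lambda>C. the_elem (f ` C)) ` (S // ?R)"
      proof
        fix z assume "z \<in> f ` S"
        then obtain x where x: "x \<in> S" "z = f x" by blast
        show "z \<in> (\<lambda>C. the_elem (f ` C)) ` (S // ?R)"
          unfolding x(2) img[OF x(1), symmetric] by (rule imageI, rule quotientI[OF x(1)])
      qed
    qed
  qed
  then show ?thesis by blast
qed

text \<open>The hypothesis \<open>universe\<close> enters through surjectivity: every symmetric
  cocycle has to be realised by an extension whose elements have type \<open>'e\<close>.\<close>

theorem theorem7p2:
  fixes G :: "'g lie_group" and A :: "'a lie_group" and act :: "'g \<Rightarrow> 'a \<Rightarrow> 'a"
  assumes "is_lie_group G" and "smooth_module G A act"
    and universe: "\<exists>f :: 'g \<times> 'a \<Rightarrow> 'e. inj_on f (carrier G \<times> carrier A)"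
  shows "\<exists>\<Psi> :: ('a, 'e, 'g) extension set \<Rightarrow> ((nat \<Rightarrow> 'g) \<Rightarrow> 'a) set.
           bij_betw \<Psi> (sym_extension_classes G A act) (carrier (sym_smooth_cohomology G A act 2))"
proof -
  interpret lie_module G A act by unfold_locales (fact assms)+
  obtain F :: "'g \<times> 'a \<Rightarrow> 'e" where F: "inj_on F (carrier G \<times> carrier A)" using universe by blast
  let ?S = "sym_extensions G A act :: ('a, 'e, 'g) extension set"
  have "\<forall>X. \<exists>s. X \<in> ?S \<longrightarrow> symmetric_smooth_section G X s"
    by (auto simp: sym_extensions_def has_symmetric_smooth_section_iff)
  \<comment> \<open>One section is fixed for every extension. The choice is harmless, since
    \<open>same_class_iff_equivalent\<close> holds for arbitrary symmetric sections.\<close>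
  from choice[OF this] obtain sec where sec: "\<forall>X. X \<in> ?S \<longrightarrow> symmetric_smooth_section G X (sec X)" ..
  define f where "f X = cohomology_class (section_cocycle G A X (sec X))" for X :: "('a, 'e, 'g) extension"
  have iff: "equivalent_extensions A X Y \<longleftrightarrow> f X = f Y" if "X \<in> ?S" "Y \<in> ?S" for X Y
    unfolding f_def using same_class_iff_equivalent[OF that] sec that by blast
  have "f ` ?S = cohomology_class ` sym_cocycles G A act 2"
  proof
    show "f ` ?S \<subseteq> cohomology_class ` sym_cocycles G A act 2"
    proof
      fix z assume "z \<in> f ` ?S"
      then obtain E i \<pi> where X: "(E, i, \<pi>) \<in> ?S" "z = f (E, i, \<pi>)" by auto
      interpret X: lie_module_extension G A act E i \<pi> by (rule extension_locale[OF X(1)])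
      show "z \<in> cohomology_class ` sym_cocycles G A act 2"
        unfolding X(2) f_def using sec X(1) by (intro imageI X.section_cocycle_in_sym_cocycles) blast
    qed
    show "cohomology_class ` sym_cocycles G A act 2 \<subseteq> f ` ?S"
    proof
      fix z assume "z \<in> cohomology_class ` sym_cocycles G A act 2"
      then obtain \<sigma> where z: "\<sigma> \<in> sym_cocycles G A act 2" "z = cohomology_class \<sigma>" by blast
      interpret cocycle_extension G A act \<sigma> F by unfold_locales (fact z(1) F)+
      obtain X :: "('a, 'e, 'g) extension" and s where X: "X \<in> ?S" "symmetric_smooth_section G X s"
        "section_cocycle G A X s = \<sigma>" using extension_with_cocycle by blast
      obtain E i \<pi> where e: "X = (E, i, \<pi>)" by (metis prod_cases3)
      \<comment> \<open>Reflexivity allows the section \<open>s\<close>, whose factor set is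
        \<open>\<sigma>\<close>, to be exchanged for the chosen \<open>sec X\<close> without
        changing the class.\<close>
      have "equivalent_extensions A X X"
      proof -
        interpret X: lie_module_extension G A act E i \<pi> by (rule extension_locale) (use X e in simp)
        interpret two_extensions G A act E i \<pi> E i \<pi> ..
        show ?thesis unfolding e by (rule same_cocycle_imp_equivalent[OF _ _ refl]) (use X(2) e in auto)
      qed
      then have "cohomology_class (section_cocycle G A X s) = f X"
        unfolding f_def using same_class_iff_equivalent[OF X(1,1,2)] sec X(1) by blast
      then show "z \<in> f ` ?S" using X z(2) by auto
    qed
  qed
  then show ?thesis
    unfolding sym_extension_classes_def carrier_cohomology
    using bij_betw_quotient_image[of ?S "equivalent_extensions A" f, OF iff] by simp
qed

end
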